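(* Let $g$ be the accelerating Kerr-Newman-(anti-)de Sitter metric with real parameters $a,m,q,\Lambda,\alpha$ (see context) and write $c=\cos\theta$. Then the norm of the covariant derivative of the Ricci tensor of $g$ equals $$\begin{aligned} \nabla_\mu R_{\kappa\lambda}\nabla^\mu R^{\kappa\lambda}=-\frac{80(\alpha rc-1)^8q^4}{(r^2+a^2c^2)^7}\Big(&a^2\Big[\tfrac{4\left((\alpha^2+\frac\Lambda3)a^2-\frac{\alpha^2q^2}{4}\right)\alpha^2r^4}{5}-2a^2\alpha^4mr^3+a^2\alpha^2\Big(\big(\alpha^2+\tfrac\Lambda3\big)a^2+\alpha^2q^2-1\Big)r^2\\ &\qquad+2a^2\alpha^2mr+\tfrac{\Lambda a^4}{3}\Big]c^6\\ &-2a^2\alpha\Big(-\tfrac{\alpha^2mr^4}{5}+\Big[\big(-\tfrac{6\alpha^2}{5}-\tfrac{2\Lambda}{5}\big)a^2-\tfrac{6\alpha^2q^2}{5}\Big]r^3+a^2m\Big)c^5\\ &+\Big(\Big(\tfrac{4\alpha^2(\alpha^2+\frac\Lambda3)a^2}{5}+\alpha^4q^2\Big)r^6+\tfrac{2a^2\alpha^4mr^5}{5}-\tfrac{26a^2\alpha^2mr^3}{5}-\tfrac{\Lambda a^4r^2}{15}\\ &\qquad-a^4\Big(\big(\alpha^2+\tfrac\Lambda3\big)a^2+\alpha^2q^2-1\Big)\Big)c^4\\ &+2\Big\{-\alpha^2mr^6+\tfrac{6(\alpha^2+\frac\Lambda3)a^2r^5}{5}-\tfrac{13a^2\alpha^2mr^4}{5}+\tfrac{13a^2mr^2}{5}+\big(-\tfrac65a^4-\tfrac65a^2q^2\big)r+a^4m\Big\}\alpha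 c^3\\ &+\Big(-\alpha^2\Big(\big(\alpha^2+\tfrac\Lambda3\big)a^2+\alpha^2q^2-1\Big)r^6-\tfrac{\Lambda a^2r^4}{15}+\tfrac{26a^2\alpha^2mr^3}{5}-\tfrac{2a^2mr}{5}+\tfrac{a^2q^2}{5}-\tfrac{4a^4}{5}\Big)c^2\\ &-\tfrac{2\alpha r^2(-5\alpha^2mr^4+a^2m+6a^2r)c}{5}\\ &+\Big[\tfrac{\Lambda r^4}{3}-2\alpha^2mr^3+\Big(\big(\alpha^2+\tfrac\Lambda3\big)a^2+\alpha^2q^2-1\Big)r^2+2mr-\tfrac{4a^2}{5}-q^2\Big]r^2\Big). \end{aligned}$$
   Context: Accelerating Kerr-Newman black hole in (anti-)de Sitter spacetime: in coordinates $(t,r,\theta,\phi)$, signature $(-,+,+,+)$, $$ds^2=\frac1{\Omega^2}\Big\{-\frac{Q}{\rho^2}\big[dt-a\sin^2\theta\,d\phi\big]^2+\frac{\rho^2}{Q}dr^2+\frac{\rho^2}{P}d\theta^2+\frac{P}{\rho^2}\sin^2\theta\big[a\,dt-(r^2+a^2)d\phi\big]^2\Big\},$$ $\Omega=1-\alpha r\cos\theta$, $\rho^2=r^2+a^2\cos^2\theta$, $P=1-2\alpha m\cos\theta+(\alpha^2(a^2+q^2)+\frac13\Lambda a^2)\cos^2\theta$, $Q=(a^2+q^2-2mr+r^2)(1-\alpha^2r^2)-\frac13\Lambda(a^2+r^2)r^2$. Here $\alpha$ is the acceleration parameter, $a$ the Kerr parameter, $m$ the mass, $q$ the electric charge, $\Lambda$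 the cosmological constant. The identity is on the domain where the metric is regular ($\Omega>0$, $\rho^2\ne0$, $Q\neq0$, $P>0$, $\sin\theta\neq0$). $R_{\kappa\lambda}$ is the Ricci tensor and $\nabla$ the Levi-Civita connection of $g$. *)

theory Defs
  imports "HOL-Analysis.Analysis"
begin

text \<open>
  Tensor calculus of a pseudo-Riemannian metric in a coordinate chart with coordinates indexed
  by \<open>'n\<close>: a tensor field of type (0,2) is a function \<open>T\<close> with components \<open>T x $ i $ j\<close>.
\<close>

definition partial_deriv :: "'n::finite \<Rightarrow> (real^'n \<Rightarrow> real) \<Rightarrow> real^'n \<Rightarrow> real" where
  "partial_deriv i f x = deriv (\<lambda>s. f (x + s *\<^sub>R axis i 1)) 0"

definition inv_metric :: "(real^'n \<Rightarrow> real^'n^'n) \<Rightarrow> real^'n \<Rightarrow> real^'n^'n" where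
  "inv_metric g x = matrix_inv (g x)"

text \<open>\<open>christoffel g k i j\<close> is the Christoffel symbol with upper index \<open>k\<close> of the Levi-Civita
  connection of \<open>g\<close>.\<close>

definition christoffel ::
    "(real^'n::finite \<Rightarrow> real^'n^'n) \<Rightarrow> 'n \<Rightarrow> 'n \<Rightarrow> 'n \<Rightarrow> real^'n \<Rightarrow> real" where
  "christoffel g k i j x = (\<Sum>l\<in>UNIV. inv_metric g x $ k $ l *
     (partial_deriv i (\<lambda>y. g y $ j $ l) x + partial_deriv j (\<lambda>y. g y $ i $ l) x
      - partial_deriv l (\<lambda>y. g y $ i $ j) x)) / 2"

text \<open>\<open>riemann g k l i j\<close> is the component with upper index \<open>k\<close> and lower indices \<open>l i j\<close>, in the
  convention where \<open>i j\<close> are the directions of the commutator of covariant derivatives; the Ricci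
  tensor contracts the first and third indices.\<close>

definition riemann ::
    "(real^'n::finite \<Rightarrow> real^'n^'n) \<Rightarrow> 'n \<Rightarrow> 'n \<Rightarrow> 'n \<Rightarrow> 'n \<Rightarrow> real^'n \<Rightarrow> real" where
  "riemann g k l i j x =
     partial_deriv i (christoffel g k j l) x - partial_deriv j (christoffel g k i l) x
     + (\<Sum>p\<in>UNIV. christoffel g k i p x * christoffel g p j l x
                 - christoffel g k j p x * christoffel g p i l x)"

definition ricci :: "(real^'n::finite \<Rightarrow> real^'n^'n) \<Rightarrow> real^'n \<Rightarrow> real^'n^'n" where
  "ricci g x = (\<chi> i j. \<Sum>k\<in>UNIV. riemann g k i k j x)"

definition cov_deriv ::
    "(real^'n::finite \<Rightarrow> real^'n^'n) \<Rightarrow> (real^'n \<Rightarrow> real^'n^'n) \<Rightarrow> 'n \<Rightarrow> 'n \<Rightarrow> 'n \<Rightarrow> real^'n \<Rightarrow> real" where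
  "cov_deriv g T \<mu> i j x = partial_deriv \<mu> (\<lambda>y. T y $ i $ j) x
     - (\<Sum>k\<in>UNIV. christoffel g k \<mu> i x * T x $ k $ j)
     - (\<Sum>k\<in>UNIV. christoffel g k \<mu> j x * T x $ i $ k)"

text \<open>The full contraction of a (0,3)-tensor field with itself, all indices being raised by the
  inverse metric; it may be negative for an indefinite metric.\<close>

definition norm_sq3 ::
    "(real^'n::finite \<Rightarrow> real^'n^'n) \<Rightarrow> ('n \<Rightarrow> 'n \<Rightarrow> 'n \<Rightarrow> real^'n \<Rightarrow> real) \<Rightarrow> real^'n \<Rightarrow> real" where
  "norm_sq3 g S x = (\<Sum>h\<in>UNIV. \<Sum>i\<in>UNIV. \<Sum>j\<in>UNIV. \<Sum>h'\<in>UNIV. \<Sum>i'\<in>UNIV. \<Sum>j'\<in>UNIV.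
     inv_metric g x $ h $ h' * inv_metric g x $ i $ i' * inv_metric g x $ j $ j'
     * S h i j x * S h' i' j' x)"

definition KN_Omega :: "real \<Rightarrow> real \<Rightarrow> real \<Rightarrow> real" where
  "KN_Omega \<alpha> r \<theta> = 1 - \<alpha> * r * cos \<theta>"

definition KN_rho2 :: "real \<Rightarrow> real \<Rightarrow> real \<Rightarrow> real" where
  "KN_rho2 a r \<theta> = r^2 + a^2 * (cos \<theta>)^2"

definition KN_P :: "real \<Rightarrow> real \<Rightarrow> real \<Rightarrow> real \<Rightarrow> real \<Rightarrow> real \<Rightarrow> real" where
  "KN_P a m q \<Lambda> \<alpha> \<theta> =
     1 - 2 * \<alpha> * m * cos \<theta> + (\<alpha>^2 * (a^2 + q^2) + 1/3 * \<Lambda> * a^2) * (cos \<theta>)^2"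

definition KN_Q :: "real \<Rightarrow> real \<Rightarrow> real \<Rightarrow> real \<Rightarrow> real \<Rightarrow> real \<Rightarrow> real" where
  "KN_Q a m q \<Lambda> \<alpha> r =
     (a^2 + q^2 - 2 * m * r + r^2) * (1 - \<alpha>^2 * r^2) - 1/3 * \<Lambda> * (a^2 + r^2) * r^2"

text \<open>The coordinates \<open>(t, r, \<theta>, \<phi>)\<close> of \<open>x\<close> are \<open>x $ 1, x $ 2, x $ 3, x $ 4\<close>. Below,
  \<open>\<omega>\<close> and \<open>\<eta>\<close> are the components of the covectors
  \<open>dt - a sin\<^sup>2 \<theta> d\<phi>\<close> and \<open>a dt - (r\<^sup>2 + a\<^sup>2) d\<phi>\<close>.\<close>

definition KN_metric ::
    "real \<Rightarrow> real \<Rightarrow> real \<Rightarrow> real \<Rightarrow> real \<Rightarrow> real^4 \<Rightarrow> real^4^4" where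
  "KN_metric a m q \<Lambda> \<alpha> x =
     (let r = x $ 2; \<theta> = x $ 3;
          \<Omega> = KN_Omega \<alpha> r \<theta>; \<rho>2 = KN_rho2 a r \<theta>;
          P = KN_P a m q \<Lambda> \<alpha> \<theta>; Q = KN_Q a m q \<Lambda> \<alpha> r;
          dr = axis 2 1 :: real^4; d\<theta> = axis 3 1 :: real^4;
          \<omega> = vector [1, 0, 0, - a * (sin \<theta>)^2] :: real^4;
          \<eta> = vector [a, 0, 0, - (r^2 + a^2)] :: real^4
      in \<chi> i j. 1 / \<Omega>^2 *
           (- (Q / \<rho>2) * (\<omega> $ i * \<omega> $ j) + \<rho>2 / Q * (dr $ i * dr $ j)
            + \<rho>2 / P * (d\<theta> $ i * d\<theta> $ j)
            + P / \<rho>2 * (sin \<theta>)^2 * (\<eta> $ i * \<eta> $ j)))"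

end

theory Submission
  imports Defs
begin

text \<open>
  The coordinates \<open>t\<close> and \<open>\<phi>\<close> are Killing and the metric is block diagonal with blocks
  \<open>{t, \<phi>}\<close>, \<open>{r}\<close>, \<open>{\<theta>}\<close>. Put \<open>N\<^sub>l = g\<^sup>-\<^sup>1 \<partial>\<^sub>l g\<close>. With \<open>W = sqrt |det g|\<close> the mixed Ricci
  components on the Killing block are the divergence \<open>- 1/(2 W) \<Sum>\<^sub>l \<partial>\<^sub>l (W g\<^sup>l\<^sup>l N\<^sub>l)\<close>. In the
  coframe \<open>\<omega> = dt - a sin\<^sup>2 \<theta> d\<phi>\<close>, \<open>\<eta> = a dt - (r\<^sup>2 + a\<^sup>2) d\<phi>\<close> the Killing block is diagonal and
  the fields \<open>W g\<^sup>l\<^sup>l N\<^sub>l\<close> become linear in \<open>P\<close>, \<open>Q\<close> and their first derivatives. This yields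
  \<open>Ric = \<Lambda> g + f (g - 2 g\<^sub>1)\<close> with \<open>f = q\<^sup>2 \<Omega>\<^sup>4 / \<rho>\<^sup>4\<close> and \<open>g\<^sub>1\<close> the part of \<open>g\<close> built from
  \<open>\<omega>\<close> and \<open>dr\<close>. Evaluating \<open>\<nabla> Ric\<close> on the orthogonal frame dual to \<open>\<omega>, dr, d\<theta>, \<eta>\<close>, where the
  contraction is a weighted sum of squares, gives with \<open>c = cos \<theta>\<close>, \<open>s = sin \<theta>\<close> the value
  \<open>q\<^sup>4 \<Omega>\<^sup>8 / \<rho>\<^sup>1\<^sup>4 (80 (Q (r + \<alpha> a\<^sup>2 c\<^sup>3)\<^sup>2 + P s\<^sup>2 (a\<^sup>2 c + \<alpha> r\<^sup>3)\<^sup>2) - 16 a\<^sup>2 \<Omega>\<^sup>2 (r\<^sup>2 P s\<^sup>2 + c\<^sup>2 Q))\<close>,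
  which is the claimed polynomial in \<open>c\<close>.
\<close>

section \<open>Stationary axisymmetric metrics\<close>

text \<open>The obstacle is size: in coordinates every Ricci component is a large rational function
  of r, cos \<theta>, sin \<theta> and five parameters. The curvature computation therefore keeps
  \<open>P\<close>, \<open>Q\<close>, their derivatives and the reciprocals of \<open>Om\<close> and
  \<open>rho\<close> as independent letters. The explicit polynomials \<open>P\<close> and
  \<open>Q\<close> are substituted only in the four residuals \<open>residual_oo\<close>,
  \<open>residual_ee\<close>, \<open>residual_rr\<close>, \<open>residual_tt\<close>, and for the
  norm only in the last step of the theorem. The pairs \<omega>, dr and \<eta>, d\<theta> span the
  two planes on which the Ricci tensor of a non-null Maxwell field is a multiple of the metric. This
  is where g_1 comes from, and why a single function f describes the trace-free part. The norm is
  short because one function governs it, \<open>rho / Om^2\<close>. It is the conformal factor of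
  the r, \<theta> part of the metric, f is q^2 times its inverse square, and its logarithmic
  derivatives reappear as the entries \<open>n22 2\<close> and \<open>n11 3\<close>. As the
  connection is metric, the term \<Lambda> g has no covariant derivative, and \<Lambda> survives
  only inside \<open>P\<close> and \<open>Q\<close>.\<close>

lemma coord_neq:
  "(1::4) \<noteq> 2" "(1::4) \<noteq> 3" "(1::4) \<noteq> 4" "(2::4) \<noteq> 3" "(2::4) \<noteq> 4" "(3::4) \<noteq> 4"
  "(2::4) \<noteq> 1" "(3::4) \<noteq> 1" "(4::4) \<noteq> 1" "(3::4) \<noteq> 2" "(4::4) \<noteq> 2" "(4::4) \<noteq> 3"
  by simp_all

text \<open>Decides case distinctions on numerals of type \<open>4\<close> by plain rewriting, so
  that \<open>unfolding\<close> can evaluate them without the simplifier rearranging the large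
  expressions around them.\<close>

lemmas coord_if_simps = coord_neq[THEN eq_False[THEN iffD2]] if_True if_False simp_thms(6)

lemma matrix_inv_eq:
  fixes A B :: "real^'n^'n"
  assumes "B ** A = mat 1"
  shows "matrix_inv A = B"
proof -
  have "A ** B = mat 1" using assms matrix_left_right_inverse by blast
  then have "A ** matrix_inv A = mat 1"
    using assms unfolding matrix_inv_def by (metis (mono_tags, lifting) someI_ex)
  then show ?thesis by (metis assms matrix_mul_assoc matrix_mul_lid matrix_mul_rid)
qed

text \<open>
  A function of \<open>(r, \<theta>)\<close> is constant in the Killing directions 1 and 4.
\<close>

definition has_pd :: "4 \<Rightarrow> (real \<Rightarrow> real \<Rightarrow> real) \<Rightarrow> real \<Rightarrow> real \<Rightarrow> real \<Rightarrow> bool" where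
  "has_pd i F d r \<theta> \<longleftrightarrow>
     (if i = 2 then ((\<lambda>r. F r \<theta>) has_real_derivative d) (at r)
      else if i = 3 then ((\<lambda>\<theta>. F r \<theta>) has_real_derivative d) (at \<theta>) else d = 0)"

lemma has_pd_simps [simp]:
  "has_pd 1 F d r \<theta> \<longleftrightarrow> d = 0"
  "has_pd 2 F d r \<theta> \<longleftrightarrow> ((\<lambda>r. F r \<theta>) has_real_derivative d) (at r)"
  "has_pd 3 F d r \<theta> \<longleftrightarrow> ((\<lambda>\<theta>. F r \<theta>) has_real_derivative d) (at \<theta>)"
  "has_pd 4 F d r \<theta> \<longleftrightarrow> d = 0"
  by (simp_all add: has_pd_def)

lemma has_pd_const: "has_pd i (\<lambda>r \<theta>. c) 0 r \<theta>"
  by (simp add: has_pd_def)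

lemma has_pd_add:
  "has_pd i F d r \<theta> \<Longrightarrow> has_pd i F' d' r \<theta> \<Longrightarrow> has_pd i (\<lambda>r \<theta>. F r \<theta> + F' r \<theta>) (d + d') r \<theta>"
  by (auto simp: has_pd_def intro!: derivative_eq_intros split: if_splits)

lemma has_pd_mult:
  "has_pd i F d r \<theta> \<Longrightarrow> has_pd i F' d' r \<theta> \<Longrightarrow>
    has_pd i (\<lambda>r \<theta>. F r \<theta> * F' r \<theta>) (d * F' r \<theta> + F r \<theta> * d') r \<theta>"
  by (auto simp: has_pd_def intro!: derivative_eq_intros split: if_splits)

lemma has_pd_cmult: "has_pd i F d r \<theta> \<Longrightarrow> has_pd i (\<lambda>r \<theta>. c * F r \<theta>) (c * d) r \<theta>"
  using has_pd_mult[OF has_pd_const] by simp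

lemma has_pd_divide:
  "has_pd i F d r \<theta> \<Longrightarrow> has_pd i F' d' r \<theta> \<Longrightarrow> F' r \<theta> \<noteq> 0 \<Longrightarrow>
    has_pd i (\<lambda>r \<theta>. F r \<theta> / F' r \<theta>) ((d * F' r \<theta> - F r \<theta> * d') / (F' r \<theta>)\<^sup>2) r \<theta>"
  by (auto simp: has_pd_def power2_eq_square intro!: derivative_eq_intros split: if_splits)

lemma has_pd_sum:
  "(\<And>k. k \<in> K \<Longrightarrow> has_pd i (F k) (d k) r \<theta>) \<Longrightarrow> has_pd i (\<lambda>r \<theta>. \<Sum>k\<in>K. F k r \<theta>) (\<Sum>k\<in>K. d k) r \<theta>"
  by (induction K rule: infinite_finite_induct) (simp_all add: has_pd_const has_pd_add)

lemma has_pd_unique: "has_pd i F d r \<theta> \<Longrightarrow> has_pd i F d' r \<theta> \<Longrightarrow> d = d'"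
  by (auto simp: has_pd_def split: if_splits intro: DERIV_unique)

text \<open>The coordinate line through \<open>x\<close> stays in the open set \<open>S\<close> for
  small parameters, so a formula that is valid only on \<open>S\<close> may be differentiated there.
  In directions 1 and 4 the function is constant along the line.\<close>

lemma partial_deriv_eqI:
  assumes "open S" "x \<in> S" and f: "\<And>y. y \<in> S \<Longrightarrow> f y = F (y $ 2) (y $ 3)"
    and d: "has_pd i F d (x $ 2) (x $ 3)"
  shows "partial_deriv i f x = d"
proof -
  define T where "T = {s::real. x + s *\<^sub>R axis i 1 \<in> S}"
  have "open T"
    unfolding T_def using open_vimage[OF \<open>open S\<close>, of "\<lambda>s. x + s *\<^sub>R axis i 1"]
    by (simp add: vimage_def continuous_intros)
  have "0 \<in> T" using \<open>x \<in> S\<close> by (simp add: T_def)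
  have *: "((\<lambda>s. F ((x + s *\<^sub>R axis i 1) $ 2) ((x + s *\<^sub>R axis i 1) $ 3)) has_real_derivative d)
      (at 0)"
  proof -
    consider "i = 1" | "i = 2" | "i = 3" | "i = 4" using exhaust_4 by blast
    then show ?thesis
    proof cases
      case 2
      then show ?thesis using d DERIV_shift[of "\<lambda>r. F r (x $ 3)" d 0 "x $ 2"]
        by (simp add: axis_def add.commute)
    next
      case 3
      then show ?thesis using d DERIV_shift[of "\<lambda>\<theta>. F (x $ 2) \<theta>" d 0 "x $ 3"]
        by (simp add: axis_def add.commute)
    qed (use d in \<open>simp_all add: axis_def\<close>)
  qed
  have "((\<lambda>s. f (x + s *\<^sub>R axis i 1)) has_real_derivative d) (at 0)"
    by (rule has_field_derivative_transform_within_open[OF * \<open>open T\<close> \<open>0 \<in> T\<close>])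
      (simp add: T_def f)
  then show ?thesis unfolding partial_deriv_def by (rule DERIV_imp_deriv)
qed

lemma has_pd_cong: "has_pd i F d r \<theta> \<Longrightarrow> d = d' \<Longrightarrow> has_pd i F d' r \<theta>"
  by simp

lemma has_pdI:
  assumes "((\<lambda>r. F r \<theta>) has_real_derivative d 2) (at r)"
    and "((\<lambda>\<theta>. F r \<theta>) has_real_derivative d 3) (at \<theta>)"
    and "d 1 = 0" "d 4 = 0"
  shows "has_pd l F (d l) r \<theta>"
  using assms exhaust_4[of l] by (auto simp: has_pd_def)

text \<open>
  \<open>N l\<close> stands for \<open>g\<^sup>-\<^sup>1 \<partial>\<^sub>l g\<close>.
\<close>

locale stationary_metric =
  fixes S :: "(real^4) set" and g :: "real^4 \<Rightarrow> real^4^4"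
    and dom :: "real \<Rightarrow> real \<Rightarrow> bool"
    and G H :: "4 \<Rightarrow> 4 \<Rightarrow> real \<Rightarrow> real \<Rightarrow> real"
    and N :: "4 \<Rightarrow> 4 \<Rightarrow> 4 \<Rightarrow> real \<Rightarrow> real \<Rightarrow> real"
  assumes open_S: "open S"
    and S_dom: "y \<in> S \<longleftrightarrow> dom (y $ 2) (y $ 3)"
    and g_eq: "y \<in> S \<Longrightarrow> g y $ i $ j = G i j (y $ 2) (y $ 3)"
    and G_sym: "G i j r \<theta> = G j i r \<theta>"
    and HG: "dom r \<theta> \<Longrightarrow> (\<Sum>k\<in>UNIV. H i k r \<theta> * G k j r \<theta>) = (if i = j then 1 else 0)"
    and G_deriv: "dom r \<theta> \<Longrightarrow> has_pd l (G i j) (\<Sum>k\<in>UNIV. G i k r \<theta> * N l k j r \<theta>) r \<theta>"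
begin

definition dG :: "4 \<Rightarrow> 4 \<Rightarrow> 4 \<Rightarrow> real \<Rightarrow> real \<Rightarrow> real" where
  "dG l i j r \<theta> = (\<Sum>k\<in>UNIV. G i k r \<theta> * N l k j r \<theta>)"

text \<open>Two of the three terms of the Levi-Civita formula are entries of \<open>g^-1 dg\<close>,
  that is of \<open>N\<close>; only the third needs an explicit contraction with the inverse
  metric.\<close>

definition Gam :: "4 \<Rightarrow> 4 \<Rightarrow> 4 \<Rightarrow> real \<Rightarrow> real \<Rightarrow> real" where
  "Gam k i j r \<theta> = (N i k j r \<theta> + N j k i r \<theta> - (\<Sum>l\<in>UNIV. H k l r \<theta> * dG l i j r \<theta>)) / 2"

lemma inv_metric_eq:
  assumes "x \<in> S"
  shows "inv_metric g x $ i $ j = H i j (x $ 2) (x $ 3)"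
proof -
  let ?H = "\<chi> i j. H i j (x $ 2) (x $ 3)"
  have "?H ** g x = mat 1"
    using HG[of "x $ 2" "x $ 3"] assms S_dom[of x]
    by (simp add: vec_eq_iff matrix_matrix_mult_def mat_def g_eq)
  then have "matrix_inv (g x) = ?H"
    by (rule matrix_inv_eq)
  then show ?thesis by (simp add: inv_metric_def)
qed

text \<open>The product \<open>G N\<close> does not show this symmetry. It follows from uniqueness
  of derivatives, as both sides differentiate the same function.\<close>

lemma dG_sym: "dom r \<theta> \<Longrightarrow> dG l i j r \<theta> = dG l j i r \<theta>"
proof -
  have "G i j = G j i" by (simp add: fun_eq_iff G_sym[of i j])
  then show "dom r \<theta> \<Longrightarrow> dG l i j r \<theta> = dG l j i r \<theta>"
    using G_deriv[of r \<theta> l i j] G_deriv[of r \<theta> l j i] by (simp add: dG_def has_pd_unique)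
qed

lemma christoffel_eq:
  assumes "x \<in> S"
  shows "christoffel g k i j x = Gam k i j (x $ 2) (x $ 3)"
proof -
  let ?r = "x $ 2" and ?\<theta> = "x $ 3"
  have D: "dom ?r ?\<theta>" using assms S_dom by blast
  have pd: "partial_deriv l (\<lambda>y. g y $ i $ j) x = dG l i j ?r ?\<theta>" for l i j
    unfolding dG_def using G_deriv[OF D] by (intro partial_deriv_eqI[OF open_S assms]) (auto simp:
        g_eq)
  have HdG: "(\<Sum>l\<in>UNIV. H k l ?r ?\<theta> * dG i l j ?r ?\<theta>) = N i k j ?r ?\<theta>" for i j
  proof -
    have "(\<Sum>l\<in>UNIV. H k l ?r ?\<theta> * dG i l j ?r ?\<theta>)
        = (\<Sum>p\<in>UNIV. (\<Sum>l\<in>UNIV. H k l ?r ?\<theta> * G l p ?r ?\<theta>) * N i p j ?r ?\<theta>)"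
      unfolding dG_def sum_distrib_left sum_distrib_right
      by (subst sum.swap) (simp add: mult.assoc)
    also have "\<dots> = N i k j ?r ?\<theta>"
      by (simp add: HG[OF D] if_distrib[of "\<lambda>x. x * _"] cong: if_cong)
    finally show ?thesis .
  qed
  have "christoffel g k i j x =
      ((\<Sum>l\<in>UNIV. H k l ?r ?\<theta> * dG i l j ?r ?\<theta>) + (\<Sum>l\<in>UNIV. H k l ?r ?\<theta> * dG j l i ?r ?\<theta>)
       - (\<Sum>l\<in>UNIV. H k l ?r ?\<theta> * dG l i j ?r ?\<theta>)) / 2"
    unfolding christoffel_def pd inv_metric_eq[OF assms] dG_sym[OF D, of i j] dG_sym[OF D, of j i]
    by (simp add: ring_distribs sum.distrib sum_subtractf)
  then show ?thesis by (simp add: HdG Gam_def)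
qed

text \<open>The contracted symbol is far simpler than its summands, so its derivative
  \<open>h\<close> is supplied directly. Splitting it into partial derivatives of the summands still
  requires each of them to be differentiable, hence \<open>ex\<close>.\<close>

lemma ricci_eq:
  assumes "x \<in> S"
    and d: "\<And>k. has_pd k (Gam k j i) (d k) (x $ 2) (x $ 3)"
    and h: "has_pd j (\<lambda>r \<theta>. \<Sum>k\<in>UNIV. Gam k k i r \<theta>) h (x $ 2) (x $ 3)"
    and ex: "\<And>k. \<exists>e. has_pd j (Gam k k i) e (x $ 2) (x $ 3)"
  shows "ricci g x $ i $ j = (\<Sum>k\<in>UNIV. d k) - h
    + (\<Sum>k\<in>UNIV. \<Sum>p\<in>UNIV. Gam k k p (x $ 2) (x $ 3) * Gam p j i (x $ 2) (x $ 3)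
        - Gam k j p (x $ 2) (x $ 3) * Gam p k i (x $ 2) (x $ 3))"
proof -
  obtain e where e: "\<And>k. has_pd j (Gam k k i) (e k) (x $ 2) (x $ 3)" using ex by metis
  have "(\<Sum>k\<in>UNIV. e k) = h"
    using has_pd_sum[of UNIV j "\<lambda>k. Gam k k i", OF e] h by (rule has_pd_unique)
  moreover have "partial_deriv k (christoffel g k j i) x = d k" for k
    using d christoffel_eq by (intro partial_deriv_eqI[OF open_S assms(1)])
  moreover have "partial_deriv j (christoffel g k k i) x = e k" for k
    using e christoffel_eq by (intro partial_deriv_eqI[OF open_S assms(1)])
  ultimately show ?thesis
    by (simp add: ricci_def riemann_def christoffel_eq[OF assms(1)] sum.distrib sum_subtractf)
qed

lemma has_pd_transform:
  assumes "has_pd i F d r \<theta>" "dom r \<theta>" and eq: "\<And>r \<theta>. dom r \<theta> \<Longrightarrow> F r \<theta> = F' r \<theta>"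
  shows "has_pd i F' d r \<theta>"
proof -
  \<comment> \<open>A pair of r and \<theta> is embedded in \<open>real^4\<close> with \<theta> in
    every coordinate but the second. The entries 1 and 4 may be chosen freely because
    \<open>dom\<close> depends on coordinates 2 and 3 alone.\<close>
  have "continuous_on UNIV (\<lambda>r. (\<chi> i. if i = 2 then r else \<theta>)::real^4)"
    "continuous_on UNIV (\<lambda>\<theta>. (\<chi> i. if i = 2 then r else \<theta>)::real^4)"
    by (intro continuous_on_vec_lambda; case_tac "i = 2"; simp)+
  then have o: "open {r. dom r \<theta>}" "open {\<theta>. dom r \<theta>}"
    using open_vimage[OF open_S, of "\<lambda>r. \<chi> i. if i = 2 then r else \<theta>"]
      open_vimage[OF open_S, of "\<lambda>\<theta>. \<chi> i. if i = 2 then r else \<theta>"]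
    by (simp_all add: vimage_def S_dom)
  show ?thesis
    using assms(1) has_field_derivative_transform_within_open[OF _ o(1), of "\<lambda>r. F r \<theta>" d r
        "\<lambda>r. F' r \<theta>"]
      has_field_derivative_transform_within_open[OF _ o(2), of "F r" d \<theta> "F' r"]
    by (auto simp: has_pd_def eq assms(2) split: if_splits)
qed

lemma cov_deriv_eq:
  assumes "x \<in> S" and T: "\<And>y i j. y \<in> S \<Longrightarrow> T y $ i $ j = F i j (y $ 2) (y $ 3)"
    and d: "has_pd l (F i j) d (x $ 2) (x $ 3)"
  shows "cov_deriv g T l i j x = d
     - (\<Sum>k\<in>UNIV. Gam k l i (x $ 2) (x $ 3) * F k j (x $ 2) (x $ 3))
     - (\<Sum>k\<in>UNIV. Gam k l j (x $ 2) (x $ 3) * F i k (x $ 2) (x $ 3))"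
  by (simp add: cov_deriv_def christoffel_eq[OF assms(1)] T[OF assms(1)]
      partial_deriv_eqI[OF open_S assms(1), of "\<lambda>y. T y $ i $ j", OF T d])

end

section \<open>Block-diagonal metrics\<close>

definition block_diag :: "(4 \<Rightarrow> 4 \<Rightarrow> real) \<Rightarrow> bool" where
  "block_diag F \<longleftrightarrow> (\<forall>i j. i \<noteq> j \<longrightarrow> {i, j} \<noteq> {1, 4} \<longrightarrow> F i j = 0)"

lemma block_diag_zero:
  assumes "block_diag F"
  shows "F 1 2 = 0" "F 1 3 = 0" "F 2 1 = 0" "F 2 3 = 0" "F 2 4 = 0"
    "F 3 1 = 0" "F 3 2 = 0" "F 3 4 = 0" "F 4 2 = 0" "F 4 3 = 0"
  using assms by (simp_all add: block_diag_def doubleton_eq_iff)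

locale block_metric = stationary_metric +
  assumes G_block: "block_diag (\<lambda>i j. G i j r \<theta>)"
    and H_block: "block_diag (\<lambda>i j. H i j r \<theta>)"
    and N_block: "block_diag (\<lambda>i j. N l i j r \<theta>)"
    and N_Killing: "N 1 i j r \<theta> = 0" "N 4 i j r \<theta> = 0"
begin

lemmas block_zero = block_diag_zero[OF G_block] block_diag_zero[OF H_block]
  block_diag_zero[OF N_block] N_Killing

lemma dG_zero [simp]:
  "dG 1 i j r \<theta> = 0" "dG 4 i j r \<theta> = 0"
  "dG l 1 2 r \<theta> = 0" "dG l 1 3 r \<theta> = 0" "dG l 2 1 r \<theta> = 0" "dG l 2 3 r \<theta> = 0" "dG l 2 4 r \<theta> = 0"
  "dG l 3 1 r \<theta> = 0" "dG l 3 2 r \<theta> = 0" "dG l 3 4 r \<theta> = 0" "dG l 4 2 r \<theta> = 0" "dG l 4 3 r \<theta> = 0"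
  by (simp_all add: dG_def sum_4 block_zero)

lemma H_G_diag: "dom r \<theta> \<Longrightarrow> H 2 2 r \<theta> * G 2 2 r \<theta> = 1" "dom r \<theta> \<Longrightarrow> H 3 3 r \<theta> * G 3 3 r \<theta> = 1"
  using HG[of r \<theta> 2 2] HG[of r \<theta> 3 3] by (simp_all add: sum_4 block_zero)

lemma Gam_Killing:
  assumes "i \<in> {1, 4}" "j \<in> {1, 4}" "dom r \<theta>"
  shows "Gam i j 2 r \<theta> = N 2 i j r \<theta> / 2" "Gam i 2 j r \<theta> = N 2 i j r \<theta> / 2"
    "Gam i j 3 r \<theta> = N 3 i j r \<theta> / 2" "Gam i 3 j r \<theta> = N 3 i j r \<theta> / 2"
    "Gam 2 i j r \<theta> = - H 2 2 r \<theta> * dG 2 i j r \<theta> / 2"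
    "Gam 3 i j r \<theta> = - H 3 3 r \<theta> * dG 3 i j r \<theta> / 2"
    "Gam k i j r \<theta> = (if k = 2 \<or> k = 3 then - H k k r \<theta> * dG k i j r \<theta> / 2 else 0)"
  using assms exhaust_4[of k] by (auto simp: Gam_def sum_4 block_zero)

text \<open>A parity rule: reversing the signs of coordinates 1 and 4 preserves a metric of this
  form, so components with an odd number of indices in \<open>{1, 4}\<close> vanish. The same count
  explains \<open>ricci_offblock\<close> and the vanishing clauses of
  \<open>cov_deriv_block\<close>.\<close>

lemma Gam_zero:
  assumes "i \<in> {1, 4}"
  shows "Gam i 2 2 r \<theta> = 0" "Gam i 2 3 r \<theta> = 0" "Gam i 3 2 r \<theta> = 0" "Gam i 3 3 r \<theta> = 0"
    "Gam 2 i 2 r \<theta> = 0" "Gam 2 i 3 r \<theta> = 0" "Gam 3 i 2 r \<theta> = 0" "Gam 3 i 3 r \<theta> = 0"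
    "Gam 2 2 i r \<theta> = 0" "Gam 2 3 i r \<theta> = 0" "Gam 3 2 i r \<theta> = 0" "Gam 3 3 i r \<theta> = 0"
  using assms by (auto simp: Gam_def sum_4 block_zero)

lemma Gam_meridian:
  assumes "dom r \<theta>"
  shows "Gam 2 2 2 r \<theta> = N 2 2 2 r \<theta> / 2" "Gam 2 2 3 r \<theta> = N 3 2 2 r \<theta> / 2"
    "Gam 2 3 2 r \<theta> = N 3 2 2 r \<theta> / 2"
    "Gam 2 3 3 r \<theta> = - H 2 2 r \<theta> * G 3 3 r \<theta> * N 2 3 3 r \<theta> / 2"
    "Gam 3 2 2 r \<theta> = - H 3 3 r \<theta> * G 2 2 r \<theta> * N 3 2 2 r \<theta> / 2"
    "Gam 3 2 3 r \<theta> = N 2 3 3 r \<theta> / 2"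
    "Gam 3 3 2 r \<theta> = N 2 3 3 r \<theta> / 2" "Gam 3 3 3 r \<theta> = N 3 3 3 r \<theta> / 2"
  using H_G_diag[OF assms] by (auto simp: Gam_def dG_def sum_4 block_zero algebra_simps)

lemma ricci_offblock:
  assumes "x \<in> S" "i \<in> {1, 4}" "j \<in> {2, 3}"
  shows "ricci g x $ i $ j = 0" "ricci g x $ j $ i = 0"
proof -
  have D: "dom (x $ 2) (x $ 3)" using assms(1) S_dom by blast
  have 0: "has_pd l F 0 (x $ 2) (x $ 3)" if "\<And>r \<theta>. dom r \<theta> \<Longrightarrow> F r \<theta> = 0" for F l
    using has_pd_transform[OF has_pd_const D, of 0 F] that by simp
  \<comment> \<open>In directions 1 and 4 \<open>has_pd\<close> says only that the value is 0, so it
    holds for every \<open>F\<close>.\<close>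
  have Kill: "has_pd k F 0 (x $ 2) (x $ 3)" if "k \<in> {1, 4}" for k F
    using that by (auto simp: has_pd_def)
  have mixed: "has_pd k (Gam k j i) 0 (x $ 2) (x $ 3)" "has_pd k (Gam k i j) 0 (x $ 2) (x $ 3)" for
      k
  proof -
    have "Gam k j i r \<theta> = 0" "Gam k i j r \<theta> = 0" if "k \<notin> {1, 4}" for r \<theta>
      using assms(2,3) that exhaust_4[of k] by (auto simp: Gam_zero)
    then show "has_pd k (Gam k j i) 0 (x $ 2) (x $ 3)" "has_pd k (Gam k i j) 0 (x $ 2) (x $ 3)"
      by (cases "k \<in> {1, 4}"; simp add: 0 Kill)+
  qed
  have tr: "has_pd l (Gam k k i) 0 (x $ 2) (x $ 3)" for k l
    using assms(2) exhaust_4[of k] by (auto intro!: 0 simp: Gam_zero Gam_Killing block_zero)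
  have sumtr: "has_pd j (\<lambda>r \<theta>. \<Sum>k\<in>UNIV. Gam k k i r \<theta>) 0 (x $ 2) (x $ 3)"
    using has_pd_sum[of UNIV j "\<lambda>k. Gam k k i", OF tr] by simp
  have "ricci g x $ i $ j = (\<Sum>k\<in>UNIV. \<Sum>p\<in>UNIV. Gam k k p (x $ 2) (x $ 3) * Gam p j i (x $ 2) (x $ 3)
        - Gam k j p (x $ 2) (x $ 3) * Gam p k i (x $ 2) (x $ 3))"
    using ricci_eq[OF assms(1) mixed(1) sumtr exI, OF tr] by simp
  also have "\<dots> = 0"
    using assms(2,3) by (auto simp: sum_4 Gam_zero Gam_Killing Gam_meridian D)
  finally show "ricci g x $ i $ j = 0" .
  have "ricci g x $ j $ i = (\<Sum>k\<in>UNIV. \<Sum>p\<in>UNIV. Gam k k p (x $ 2) (x $ 3) * Gam p i j (x $ 2) (x $ 3)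
        - Gam k i p (x $ 2) (x $ 3) * Gam p k j (x $ 2) (x $ 3))"
    using ricci_eq[OF assms(1) mixed(2) Kill[OF assms(2)] exI, OF Kill[OF assms(2)]] by simp
  also have "\<dots> = 0"
    using assms(2,3) by (auto simp: sum_4 Gam_zero Gam_Killing Gam_meridian D)
  finally show "ricci g x $ j $ i = 0" .
qed

lemma dG_Killing: "i \<in> {1, 4} \<Longrightarrow> dG l i j r \<theta> = (\<Sum>k\<in>{1,4}. G i k r \<theta> * N l k j r \<theta>)"
  by (auto simp: dG_def sum_4 block_zero)

text \<open>With \<open>N = g^-1 dg\<close> the sum is an entry of the matrix
  \<open>dg g^-1 dg\<close>, which is symmetric because \<open>g\<close> and \<open>dg\<close>
  are.\<close>

lemma dG_N_sym:
  assumes D: "dom r \<theta>" and "i \<in> {1, 4}" "j \<in> {1, 4}"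
  shows "(\<Sum>k\<in>{1,4}. dG l i k r \<theta> * N l k j r \<theta>) = (\<Sum>k\<in>{1,4}. dG l j k r \<theta> * N l k i r \<theta>)"
proof -
  have *: "(\<Sum>k\<in>UNIV. dG l i k r \<theta> * N l k j r \<theta>)
      = (\<Sum>k\<in>UNIV. \<Sum>p\<in>UNIV. G k p r \<theta> * N l p i r \<theta> * N l k j r \<theta>)" for i j
    unfolding dG_sym[OF D, of l i] by (simp add: dG_def sum_distrib_right)
  have "(\<Sum>k\<in>UNIV. dG l i k r \<theta> * N l k j r \<theta>) = (\<Sum>k\<in>UNIV. dG l j k r \<theta> * N l k i r \<theta>)"
    unfolding * by (subst sum.swap) (simp add: G_sym mult_ac)
  then show ?thesis using assms(2,3) by (auto simp: sum_4 block_zero)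
qed

text \<open>
  Here \<open>W\<close> is \<open>sqrt |det g|\<close> up to a constant, since \<open>\<Sum>\<^sub>k N l k k / 2\<close> is the logarithmic derivative
  of the latter. The products of Christoffel symbols cancel against the derivatives of \<open>g\<close> and \<open>W\<close>.
\<close>

lemma ricci_Killing:
  assumes x: "x \<in> S" and ij: "i \<in> {1, 4}" "j \<in> {1, 4}"
    and W: "\<And>r \<theta>. dom r \<theta> \<Longrightarrow> W r \<theta> \<noteq> 0"
      "\<And>l. has_pd l W (W (x $ 2) (x $ 3) * ((\<Sum>k\<in>UNIV. N l k k (x $ 2) (x $ 3)) / 2)) (x $ 2)
          (x $ 3)"
    and e: "\<And>l k. l \<in> {2, 3} \<Longrightarrow> k \<in> {1, 4} \<Longrightarrow>
      has_pd l (\<lambda>r \<theta>. W r \<theta> * H l l r \<theta> * N l k j r \<theta>) (e l k) (x $ 2) (x $ 3)"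
  shows "ricci g x $ i $ j = - (\<Sum>k\<in>{1,4}. G i k (x $ 2) (x $ 3) * (e 2 k
      + e 3 k)) / (2 * W (x $ 2) (x $ 3))"
proof -
  let ?r = "x $ 2" and ?\<theta> = "x $ 3"
  have D: "dom ?r ?\<theta>" using x S_dom by blast
  define h where "h l = (\<Sum>k\<in>UNIV. N l k k ?r ?\<theta>) / 2" for l
  define W0 where "W0 = W ?r ?\<theta>"
  have W0: "W0 \<noteq> 0" using W(1) D by (simp add: W0_def)
  define q where "q l = (\<Sum>k\<in>{1,4}. dG l i k ?r ?\<theta> * N l k j ?r ?\<theta>)" for l
  define F where "F l = (\<Sum>k\<in>{1,4}. G i k ?r ?\<theta> * e l k)" for l
  define d where "d l = (if l \<in> {2, 3} then
     - (H l l ?r ?\<theta> * q l + F l / W0 - h l * H l l ?r ?\<theta> * dG l i j ?r ?\<theta>) / 2 else 0)" for l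
  have d: "has_pd l (Gam l j i) (d l) ?r ?\<theta>" for l
  proof (cases "l \<in> {2, 3}")
    case True
    \<comment> \<open>The symbol \<open>Gam l j i\<close> is \<open>- K / (2 W)\<close>. Writing
      \<open>K\<close> as \<open>G\<close> times \<open>W H N\<close> lets the product rule use the
      given derivatives \<open>e\<close> of the divergence fields.\<close>
    define K where "K r \<theta> = (\<Sum>k\<in>{1,4}. G i k r \<theta> * (W r \<theta> * H l l r \<theta> * N l k j r \<theta>))" for r \<theta>
    have K: "K r \<theta> = W r \<theta> * H l l r \<theta> * dG l i j r \<theta>" for r \<theta>
      by (simp add: dG_Killing[OF ij(1)] K_def algebra_simps)
    have "has_pd l K (\<Sum>k\<in>{1,4}. dG l i k ?r ?\<theta> * (W0 * H l l ?r ?\<theta> * N l k j ?r ?\<theta>)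
        + G i k ?r ?\<theta> * e l k) ?r ?\<theta>"
      unfolding K_def W0_def dG_def
      by (intro has_pd_sum has_pd_mult G_deriv[OF D] e[OF True])
    moreover have "(\<Sum>k\<in>{1,4}. dG l i k ?r ?\<theta> * (W0 * H l l ?r ?\<theta> * N l k j ?r ?\<theta>)
        + G i k ?r ?\<theta> * e l k) = W0 * H l l ?r ?\<theta> * q l + F l"
      by (simp add: q_def F_def algebra_simps)
    ultimately have "has_pd l K (W0 * H l l ?r ?\<theta> * q l + F l) ?r ?\<theta>" by simp
    moreover have "- 1 / 2 * (((W0 * H l l ?r ?\<theta> * q l + F l) * W0 - K ?r ?\<theta> * (W0 * h l)) / W0\<^sup>2)
        = d l"
      using True W0 unfolding K W0_def[symmetric] by (simp add: d_def field_simps power2_eq_square)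
    ultimately have "has_pd l (\<lambda>r \<theta>. - 1 / 2 * (K r \<theta> / W r \<theta>)) (d l) ?r ?\<theta>"
      using has_pd_cmult[OF has_pd_divide[OF _ W(2)], of l K "W0 * H l l ?r ?\<theta> * q l + F l"
          "- 1 / 2"] W(1)[OF D]
      unfolding h_def[symmetric] W0_def[symmetric] by simp
    then show ?thesis
    proof (rule has_pd_transform[OF _ D])
      fix r \<theta> assume D': "dom r \<theta>"
      show "- 1 / 2 * (K r \<theta> / W r \<theta>) = Gam l j i r \<theta>"
        using True W(1)[OF D'] dG_sym[OF D', of l j i] Gam_Killing(7)[OF ij(2,1) D', of l]
            by (auto simp: K)
    qed
  qed (auto simp: has_pd_def d_def)
  have Kill: "has_pd j F' 0 ?r ?\<theta>" for F' using ij(2) by auto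
  have ric: "ricci g x $ i $ j = (\<Sum>k\<in>UNIV. d k) - 0
    + (\<Sum>k\<in>UNIV. \<Sum>p\<in>UNIV. Gam k k p ?r ?\<theta> * Gam p j i ?r ?\<theta>
        - Gam k j p ?r ?\<theta> * Gam p k i ?r ?\<theta>)"
    using Kill by (intro ricci_eq[OF x d]) auto
  have tr: "(\<Sum>k\<in>UNIV. Gam k k p ?r ?\<theta>) = (if p \<in> {2, 3} then h p else 0)" for p
    using exhaust_4[of p] by (auto simp: sum_4 Gam_zero Gam_Killing Gam_meridian D h_def block_zero)
  have 1: "(\<Sum>k\<in>UNIV. \<Sum>p\<in>UNIV. Gam k k p ?r ?\<theta> * Gam p j i ?r ?\<theta>)
      = h 2 * Gam 2 j i ?r ?\<theta> + h 3 * Gam 3 j i ?r ?\<theta>"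
    by (subst sum.swap, unfold sum_distrib_right[symmetric] tr) (simp add: sum_4)
  have 2: "(\<Sum>k\<in>UNIV. \<Sum>p\<in>UNIV. Gam k j p ?r ?\<theta> * Gam p k i ?r ?\<theta>)
      = - (H 2 2 ?r ?\<theta> * q 2 + H 3 3 ?r ?\<theta> * q 3) / 2"
  proof -
    \<comment> \<open>By parity a product survives only if exactly one of \<open>k\<close> and
      \<open>p\<close> lies in the Killing block.\<close>
    have "(\<Sum>k\<in>UNIV. \<Sum>p\<in>UNIV. Gam k j p ?r ?\<theta> * Gam p k i ?r ?\<theta>) =
      (\<Sum>k\<in>{1,4}. \<Sum>l\<in>{2,3}. Gam k j l ?r ?\<theta> * Gam l k i ?r ?\<theta> + Gam l j k ?r ?\<theta> * Gam k l i ?r ?\<theta>)"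
      using ij by (auto simp: sum_4 Gam_zero Gam_Killing(7) D)
    also have "\<dots> = - (\<Sum>l\<in>{2,3}. H l l ?r ?\<theta> * ((\<Sum>k\<in>{1,4}. dG l i k ?r ?\<theta> * N l k j ?r ?\<theta>)
          + (\<Sum>k\<in>{1,4}. dG l j k ?r ?\<theta> * N l k i ?r ?\<theta>))) / 4"
      unfolding dG_sym[OF D, of _ i] using ij by (simp add: Gam_Killing(1-6) D) (simp add:
          field_simps)
    also have "\<dots> = - (\<Sum>l\<in>{2,3}. H l l ?r ?\<theta> * (q l + q l)) / 4"
      by (simp only: dG_N_sym[OF D ij(2,1)] q_def)
    also have "\<dots> = - (2 * (H 2 2 ?r ?\<theta> * q 2 + H 3 3 ?r ?\<theta> * q 3)) / 4"
      by (simp add: algebra_simps)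
    finally show ?thesis by linarith
  qed
  have "ricci g x $ i $ j = d 2 + d 3 + (h 2 * Gam 2 j i ?r ?\<theta> + h 3 * Gam 3 j i ?r ?\<theta>)
      + (H 2 2 ?r ?\<theta> * q 2 + H 3 3 ?r ?\<theta> * q 3) / 2"
    unfolding ric sum_subtractf 1 2 sum_4[of d] by (simp add: d_def[of 1] d_def[of 4] field_simps)
  also have "\<dots> = - (F 2 / W0 + F 3 / W0) / 2"
    unfolding Gam_Killing(5,6)[OF ij(2,1) D] dG_sym[OF D, of _ j i] d_def
        by (simp add: algebra_simps add_divide_distrib diff_divide_distrib)
  also have "\<dots> = - (F 2 + F 3) / (2 * W0)"
    using W0 by (simp add: field_simps)
  also have "F 2 + F 3 = (\<Sum>k\<in>{1,4}. G i k ?r ?\<theta> * (e 2 k + e 3 k))"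
    by (simp add: F_def ring_distribs)
  finally show ?thesis by (simp add: W0_def)
qed

text \<open>As in a reduction along the two Killing directions, their block enters the meridian
  components only through the trace of \<open>N p\<close>, whose half has the derivative
  \<open>h\<close>, and through the trace of \<open>N j N i\<close>.\<close>

lemma ricci_meridian:
  assumes x: "x \<in> S" and ij: "i \<in> {2, 3}" "j \<in> {2, 3}"
    and d: "\<And>k. k \<in> {2, 3} \<Longrightarrow> has_pd k (Gam k j i) (d k) (x $ 2) (x $ 3)"
    and h: "has_pd j (\<lambda>r \<theta>. \<Sum>k\<in>UNIV. Gam k k i r \<theta>) h (x $ 2) (x $ 3)"
    and ex: "\<And>k. \<exists>e. has_pd j (Gam k k i) e (x $ 2) (x $ 3)"
  shows "ricci g x $ i $ j = d 2 + d 3 - h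
    + (\<Sum>p\<in>{2,3}. (\<Sum>k\<in>UNIV. N p k k (x $ 2) (x $ 3)) / 2 * Gam p j i (x $ 2) (x $ 3))
    - (\<Sum>k\<in>{1,4}. \<Sum>p\<in>{1,4}. N j k p (x $ 2) (x $ 3) * N i p k (x $ 2) (x $ 3)) / 4
    - (\<Sum>k\<in>{2,3}. \<Sum>p\<in>{2,3}. Gam k j p (x $ 2) (x $ 3) * Gam p k i (x $ 2) (x $ 3))"
proof -
  let ?r = "x $ 2" and ?\<theta> = "x $ 3"
  have D: "dom ?r ?\<theta>" using x S_dom by blast
  define d' where "d' k = (if k \<in> {2, 3} then d k else 0)" for k
  have d': "has_pd k (Gam k j i) (d' k) ?r ?\<theta>" for k
    using d[of k] exhaust_4[of k] by (auto simp: d'_def)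
  have tr: "(\<Sum>k\<in>UNIV. Gam k k p ?r ?\<theta>) = (\<Sum>k\<in>UNIV. N p k k ?r ?\<theta>) / 2" if "p \<in> {2, 3}" for p
    using that by (auto simp: sum_4 Gam_Killing Gam_meridian D)
  have 1: "(\<Sum>k\<in>UNIV. \<Sum>p\<in>UNIV. Gam k k p ?r ?\<theta> * Gam p j i ?r ?\<theta>)
      = (\<Sum>p\<in>{2,3}. (\<Sum>k\<in>UNIV. N p k k ?r ?\<theta>) / 2 * Gam p j i ?r ?\<theta>)"
  proof -
    have "Gam 1 j i ?r ?\<theta> = 0" "Gam 4 j i ?r ?\<theta> = 0" using ij by (auto simp: Gam_zero)
    then show ?thesis
      by (subst sum.swap, unfold sum_distrib_right[symmetric], subst sum_4) (simp add: tr)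
  qed
  have 2: "(\<Sum>k\<in>UNIV. \<Sum>p\<in>UNIV. Gam k j p ?r ?\<theta> * Gam p k i ?r ?\<theta>)
      = (\<Sum>k\<in>{1,4}. \<Sum>p\<in>{1,4}. N j k p ?r ?\<theta> * N i p k ?r ?\<theta>) / 4
        + (\<Sum>k\<in>{2,3}. \<Sum>p\<in>{2,3}. Gam k j p ?r ?\<theta> * Gam p k i ?r ?\<theta>)"
    using ij by (auto simp: sum_4 Gam_zero Gam_Killing D)
  show ?thesis
    unfolding ricci_eq[OF x d' h ex] sum_subtractf 1 2 by (simp add: sum_4 d'_def)
qed

text \<open>For \<open>F = G\<close> all these expressions vanish, as they must for a metric
  connection. So they measure how far \<open>T\<close> is from a constant multiple of the
  metric.\<close>

lemma cov_deriv_block: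
  assumes x: "x \<in> S" and T: "\<forall>y\<in>S. \<forall>i j. T y $ i $ j = F i j (y $ 2) (y $ 3)"
    and F_block: "\<And>r \<theta>. block_diag (\<lambda>i j. F i j r \<theta>)"
    and F_sym: "\<And>i j r \<theta>. F i j r \<theta> = F j i r \<theta>"
  shows "\<And>l i j d. l \<in> {2,3} \<Longrightarrow> i \<in> {1,4} \<Longrightarrow> j \<in> {1,4} \<Longrightarrow> has_pd l (F i j) d (x $ 2) (x $ 3) \<Longrightarrow>
      cov_deriv g T l i j x = d - (\<Sum>k\<in>{1,4}. N l k i (x $ 2) (x $ 3) * F k j (x $ 2) (x $ 3)
        + F i k (x $ 2) (x $ 3) * N l k j (x $ 2) (x $ 3)) / 2"
    and "\<And>l i j. l \<in> {2,3} \<Longrightarrow> i \<in> {1,4} \<Longrightarrow> j \<in> {1,4} \<Longrightarrow>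
      cov_deriv g T i l j x = (H l l (x $ 2) (x $ 3) * F l l (x $ 2) (x $ 3) * dG l i
          j (x $ 2) (x $ 3)
        - (\<Sum>k\<in>{1,4}. N l k i (x $ 2) (x $ 3) * F k j (x $ 2) (x $ 3))) / 2"
    and "\<And>l i j d. has_pd l (F i j) d (x $ 2) (x $ 3) \<Longrightarrow> cov_deriv g T l j i x
        = cov_deriv g T l i j x"
    and "\<And>d. has_pd 2 (F 2 2) d (x $ 2) (x $ 3) \<Longrightarrow>
      cov_deriv g T 2 2 2 x = d - N 2 2 2 (x $ 2) (x $ 3) * F 2 2 (x $ 2) (x $ 3)"
    and "\<And>d. has_pd 3 (F 2 2) d (x $ 2) (x $ 3) \<Longrightarrow>
      cov_deriv g T 3 2 2 x = d - N 3 2 2 (x $ 2) (x $ 3) * F 2 2 (x $ 2) (x $ 3)"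
    and "\<And>d. has_pd 2 (F 3 3) d (x $ 2) (x $ 3) \<Longrightarrow>
      cov_deriv g T 2 3 3 x = d - N 2 3 3 (x $ 2) (x $ 3) * F 3 3 (x $ 2) (x $ 3)"
    and "\<And>d. has_pd 3 (F 3 3) d (x $ 2) (x $ 3) \<Longrightarrow>
      cov_deriv g T 3 3 3 x = d - N 3 3 3 (x $ 2) (x $ 3) * F 3 3 (x $ 2) (x $ 3)"
    and "cov_deriv g T 2 2 3 x
        = (H 3 3 (x $ 2) (x $ 3) * G 2 2 (x $ 2) (x $ 3) * F 3 3 (x $ 2) (x $ 3)
        - F 2 2 (x $ 2) (x $ 3)) * N 3 2 2 (x $ 2) (x $ 3) / 2"
    and "cov_deriv g T 3 2 3 x
        = (H 2 2 (x $ 2) (x $ 3) * G 3 3 (x $ 2) (x $ 3) * F 2 2 (x $ 2) (x $ 3)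
        - F 3 3 (x $ 2) (x $ 3)) * N 2 3 3 (x $ 2) (x $ 3) / 2"
    and "\<And>i j l. i \<in> {1,4} \<Longrightarrow> j \<in> {1,4} \<Longrightarrow> l \<in> {1,4} \<Longrightarrow> cov_deriv g T l i j x = 0"
    and "\<And>i j l. i \<in> {1,4} \<Longrightarrow> j \<in> {2,3} \<Longrightarrow> l \<in> {2,3} \<Longrightarrow> cov_deriv g T l i j x = 0"
    and "\<And>i j l. i \<in> {2,3} \<Longrightarrow> j \<in> {2,3} \<Longrightarrow> l \<in> {1,4} \<Longrightarrow> cov_deriv g T l i j x = 0"
proof -
  let ?r = "x $ 2" and ?\<theta> = "x $ 3"
  have D: "dom ?r ?\<theta>" using x S_dom by blast
  have cd: "cov_deriv g T l i j x = d - (\<Sum>k\<in>UNIV. Gam k l i ?r ?\<theta> * F k j ?r ?\<theta>)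
      - (\<Sum>k\<in>UNIV. Gam k l j ?r ?\<theta> * F i k ?r ?\<theta>)" if "has_pd l (F i j) d ?r ?\<theta>" for l i j d
    using cov_deriv_eq[of x T F l i j d] x T that by blast
  note F_zero = block_diag_zero[OF F_block]
  note tab = sum_4 Gam_zero Gam_Killing Gam_meridian D F_zero
  have Kill: "has_pd l F' 0 ?r ?\<theta>" if "l \<in> {1, 4}" for l F' using that by auto
  have off: "has_pd l (F i j) 0 ?r ?\<theta>" if "i \<noteq> j" "{i, j} \<noteq> {1, 4}" for l i j
  proof -
    have "F i j = (\<lambda>r \<theta>. 0)" using F_block that unfolding block_diag_def by blast
    then show ?thesis by (simp add: has_pd_const)
  qed
  have F41: "F 4 1 r \<theta> = F 1 4 r \<theta>" for r \<theta> by (rule F_sym)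
  show "cov_deriv g T l i j x = d - (\<Sum>k\<in>{1,4}. N l k i ?r ?\<theta> * F k j ?r ?\<theta>
      + F i k ?r ?\<theta> * N l k j ?r ?\<theta>) / 2"
    if "l \<in> {2,3}" "i \<in> {1,4}" "j \<in> {1,4}" "has_pd l (F i j) d ?r ?\<theta>" for l i j d
    unfolding cd[OF that(4)] using that(1-3) by (auto simp: tab; simp add: field_simps)
  show "cov_deriv g T i l j x = (H l l ?r ?\<theta> * F l l ?r ?\<theta> * dG l i j ?r ?\<theta>
        - (\<Sum>k\<in>{1,4}. N l k i ?r ?\<theta> * F k j ?r ?\<theta>)) / 2"
    if "l \<in> {2,3}" "i \<in> {1,4}" "j \<in> {1,4}" for l i j
    unfolding cd[OF Kill[OF that(2)]] using that by (auto simp: tab; simp add: field_simps)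
  show "cov_deriv g T l j i x = cov_deriv g T l i j x" if "has_pd l (F i j) d ?r ?\<theta>" for l i j d
  proof -
    have "F j i = F i j" by (intro ext F_sym)
    then show ?thesis using cd[OF that] cd[of l j i d] that
      by (simp add: F_sym[of _ i] F_sym[of j])
  qed
  show "cov_deriv g T 2 2 2 x = d - N 2 2 2 ?r ?\<theta> * F 2 2 ?r ?\<theta>" if "has_pd 2 (F 2 2) d ?r ?\<theta>" for d
    unfolding cd[OF that] by (simp add: tab)
  show "cov_deriv g T 3 2 2 x = d - N 3 2 2 ?r ?\<theta> * F 2 2 ?r ?\<theta>" if "has_pd 3 (F 2 2) d ?r ?\<theta>" for d
    unfolding cd[OF that] by (simp add: tab)
  show "cov_deriv g T 2 3 3 x = d - N 2 3 3 ?r ?\<theta> * F 3 3 ?r ?\<theta>" if "has_pd 2 (F 3 3) d ?r ?\<theta>" for d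
    unfolding cd[OF that] by (simp add: tab)
  show "cov_deriv g T 3 3 3 x = d - N 3 3 3 ?r ?\<theta> * F 3 3 ?r ?\<theta>" if "has_pd 3 (F 3 3) d ?r ?\<theta>" for d
    unfolding cd[OF that] by (simp add: tab)
  show "cov_deriv g T 2 2 3 x = (H 3 3 ?r ?\<theta> * G 2 2 ?r ?\<theta> * F 3 3 ?r ?\<theta>
      - F 2 2 ?r ?\<theta>) * N 3 2 2 ?r ?\<theta> / 2"
    by (subst cd[of 2 2 3 0, OF off]; simp add: tab doubleton_eq_iff field_simps)
  show "cov_deriv g T 3 2 3 x = (H 2 2 ?r ?\<theta> * G 3 3 ?r ?\<theta> * F 2 2 ?r ?\<theta>
      - F 3 3 ?r ?\<theta>) * N 2 3 3 ?r ?\<theta> / 2"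
    by (subst cd[of 3 2 3 0, OF off]; simp add: tab doubleton_eq_iff field_simps)
  show "cov_deriv g T l i j x = 0" if "i \<in> {1,4}" "j \<in> {1,4}" "l \<in> {1,4}" for i j l
    unfolding cd[OF Kill[OF that(3)]] using that by (auto simp: tab)
  show "cov_deriv g T l i j x = 0" if "i \<in> {1,4}" "j \<in> {2,3}" "l \<in> {2,3}" for i j l
  proof -
    have "cov_deriv g T l i j x = 0 - (\<Sum>k\<in>UNIV. Gam k l i ?r ?\<theta> * F k j ?r ?\<theta>)
      - (\<Sum>k\<in>UNIV. Gam k l j ?r ?\<theta> * F i k ?r ?\<theta>)"
      by (rule cd[OF off]) (use that in \<open>auto simp: doubleton_eq_iff\<close>)
    also have "\<dots> = 0" using that by (auto simp: tab)
    finally show ?thesis .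
  qed
  show "cov_deriv g T l i j x = 0" if "i \<in> {2,3}" "j \<in> {2,3}" "l \<in> {1,4}" for i j l
    unfolding cd[OF Kill[OF that(3)]] using that by (auto simp: tab)
qed

end

section \<open>Contractions in an orthogonal frame\<close>

lemma sum_UNIV_triple:
  "(\<Sum>p\<in>UNIV. F (p :: 'a::finite \<times> 'b::finite \<times> 'c::finite))
      = (\<Sum>a\<in>UNIV. \<Sum>b\<in>UNIV. \<Sum>c\<in>UNIV. F (a, b, c))"
  by (simp add: sum.cartesian_product UNIV_Times_UNIV split_def)

lemma quadratic_form_diag:
  fixes l :: "'c::finite \<Rightarrow> real" and E :: "'c \<Rightarrow> 'p::finite \<Rightarrow> real"
  shows "(\<Sum>p\<in>UNIV. \<Sum>p'\<in>UNIV. (\<Sum>c\<in>UNIV. l c * E c p * E c p') * X p * X p')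
      = (\<Sum>c\<in>UNIV. l c * (\<Sum>p\<in>UNIV. E c p * X p)^2)"
proof -
  have "(\<Sum>p\<in>UNIV. \<Sum>p'\<in>UNIV. (\<Sum>c\<in>UNIV. l c * E c p * E c p') * X p * X p')
    = (\<Sum>p\<in>UNIV. \<Sum>p'\<in>UNIV. \<Sum>c\<in>UNIV. l c * ((E c p * X p) * (E c p' * X p')))"
    by (simp add: sum_distrib_right sum_distrib_left mult_ac)
  also have "\<dots> = (\<Sum>p\<in>UNIV. \<Sum>c\<in>UNIV. \<Sum>p'\<in>UNIV. l c * ((E c p * X p) * (E c p' * X p')))"
    by (intro sum.cong refl sum.swap)
  also have "\<dots> = (\<Sum>c\<in>UNIV. \<Sum>p\<in>UNIV. \<Sum>p'\<in>UNIV. l c * ((E c p * X p) * (E c p' * X p')))"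
    by (rule sum.swap)
  also have "\<dots> = (\<Sum>c\<in>UNIV. l c * (\<Sum>p\<in>UNIV. E c p * X p)^2)"
    unfolding power2_eq_square sum_product by (simp only: sum_distrib_left)
  finally show ?thesis .
qed

text \<open>A triple of indices is treated as one index. The sixfold sum is then a quadratic form
  whose matrix is a threefold tensor product of the inverse metric, and products of frame vectors
  diagonalise it. The weights carry the signature and the lengths of the frame vectors, so no square
  roots arise.\<close>

lemma norm_sq3_frame:
  fixes g :: "real^'n::finite \<Rightarrow> real^'n^'n" and l :: "'m::finite \<Rightarrow> real" and E :: "'m \<Rightarrow> 'n \<Rightarrow> real"
  assumes H: "\<And>i j. inv_metric g x $ i $ j = (\<Sum>a\<in>UNIV. l a * E a i * E a j)"
  shows "norm_sq3 g S x = (\<Sum>a\<in>UNIV. \<Sum>b\<in>UNIV. \<Sum>c\<in>UNIV. l a * l b * l c *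
    (\<Sum>h\<in>UNIV. E a h * (\<Sum>i\<in>UNIV. E b i * (\<Sum>j\<in>UNIV. E c j * S h i j x)))^2)"
proof -
  define l3 where "l3 = (\<lambda>(a, b, c). l a * l b * l c)"
  define E3 where "E3 = (\<lambda>(a, b, c) (h, i, j). E a h * E b i * E c j)"
  define X where "X = (\<lambda>(h, i, j). S h i j x)"
  have prod: "(\<Sum>p\<in>UNIV. l3 p * E3 p (h, i, j) * E3 p (h', i', j')) =
    inv_metric g x $ h $ h' * inv_metric g x $ i $ i' * inv_metric g x $ j $ j'" for h i j h' i' j'
  proof -
    have "(\<Sum>a\<in>UNIV. \<Sum>b\<in>UNIV. \<Sum>c\<in>UNIV. A a * (B b * C c))
        = (\<Sum>a\<in>UNIV. A a) * (\<Sum>b\<in>UNIV. B b) * (\<Sum>c\<in>UNIV. C c)"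
      for A B C :: "'m \<Rightarrow> real"
      by (simp add: sum_distrib_left[symmetric] sum_distrib_right[symmetric] mult.assoc)
    from this[of "\<lambda>a. l a * E a h * E a h'" "\<lambda>a. l a * E a i * E a i'" "\<lambda>a. l a * E a j * E a j'"]
    show ?thesis
      unfolding H sum_UNIV_triple l3_def E3_def by (simp add: mult_ac)
  qed
  have "norm_sq3 g S x = (\<Sum>p\<in>UNIV. \<Sum>p'\<in>UNIV. (\<Sum>c\<in>UNIV. l3 c * E3 c p * E3 c p') * X p * X p')"
    unfolding norm_sq3_def sum_UNIV_triple[where F = "\<lambda>p. \<Sum>p'\<in>UNIV. _ p p'"]
    unfolding sum_UNIV_triple[where F = "\<lambda>p'. (\<Sum>c\<in>UNIV. _ c p') * _ * X p'"] prod
        by (simp add: X_def)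
  also have "\<dots> = (\<Sum>c\<in>UNIV. l3 c * (\<Sum>p\<in>UNIV. E3 c p * X p)^2)"
    by (rule quadratic_form_diag)
  also have "\<dots> = (\<Sum>a\<in>UNIV. \<Sum>b\<in>UNIV. \<Sum>c\<in>UNIV. l a * l b * l c *
    (\<Sum>h\<in>UNIV. E a h * (\<Sum>i\<in>UNIV. E b i * (\<Sum>j\<in>UNIV. E c j * S h i j x)))^2)"
    unfolding sum_UNIV_triple by (simp add: l3_def E3_def X_def sum_distrib_left mult_ac)
  finally show ?thesis .
qed

section \<open>The accelerating Kerr-Newman metric in its Carter frame\<close>

locale kerr_newman =
  fixes a m q \<Lambda> \<alpha> :: real
begin

abbreviation g :: "real^4 \<Rightarrow> real^4^4" where "g \<equiv> KN_metric a m q \<Lambda> \<alpha>"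

definition Om where "Om = KN_Omega \<alpha>"
text \<open>This is the square of the \<rho> in the metric, so the seventh power of
  \<open>rho\<close> stands for \<rho>^14.\<close>

definition rho where "rho = KN_rho2 a"
text \<open>The dummy argument, here and in \<open>Q\<close>, gives all coefficients the
  two-argument type on which \<open>has_pd\<close> acts.\<close>

definition P where "P (r::real) \<theta> = KN_P a m q \<Lambda> \<alpha> \<theta>"
definition P1 where "P1 (r::real) \<theta> = sin \<theta> * (2 * \<alpha> * m - 2 * (\<alpha>^2 * (a^2 + q^2)
    + \<Lambda> * a^2 / 3) * cos \<theta>)"
definition P2 where "P2 (r::real) \<theta> = cos \<theta> * (2 * \<alpha> * m - 2 * (\<alpha>^2 * (a^2 + q^2)
    + \<Lambda> * a^2 / 3) * cos \<theta>)
  + 2 * (\<alpha>^2 * (a^2 + q^2) + \<Lambda> * a^2 / 3) * (sin \<theta>)^2"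
definition Q where "Q r (\<theta>::real) = KN_Q a m q \<Lambda> \<alpha> r"
definition Q1 where "Q1 r (\<theta>::real) = 2 * (r - m) * (1 - \<alpha>^2 * r^2) - 2 * \<alpha>^2 * r * (a^2 + q^2
    - 2 * m * r + r^2)
  - \<Lambda> / 3 * (2 * a^2 * r + 4 * r^3)"
definition Q2 where "Q2 r (\<theta>::real) = 2 * (1 - \<alpha>^2 * r^2) - 8 * \<alpha>^2 * r * (r - m)
    - 2 * \<alpha>^2 * (a^2 + q^2 - 2 * m * r + r^2)
  - \<Lambda> / 3 * (2 * a^2 + 12 * r^2)"

definition dom :: "real \<Rightarrow> real \<Rightarrow> bool" where
  "dom r \<theta> \<longleftrightarrow> Om r \<theta> > 0 \<and> rho r \<theta> \<noteq> 0 \<and> Q r \<theta> \<noteq> 0 \<and> P r \<theta> > 0 \<and> sin \<theta> \<noteq> 0"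

lemma domD:
  assumes "dom r \<theta>"
  shows "Om r \<theta> \<noteq> 0" "rho r \<theta> \<noteq> 0" "Q r \<theta> \<noteq> 0" "P r \<theta> \<noteq> 0" "sin \<theta> \<noteq> 0"
  using assms by (auto simp: dom_def)

lemma Om_eq: "Om r \<theta> = 1 - \<alpha> * r * cos \<theta>" by (simp add: Om_def KN_Omega_def)
lemma rho_eq: "rho r \<theta> = r^2 + a^2 * (cos \<theta>)^2" by (simp add: rho_def KN_rho2_def)
lemma P_eq: "P r \<theta> = 1 - 2 * \<alpha> * m * cos \<theta> + (\<alpha>^2 * (a^2 + q^2) + \<Lambda> * a^2 / 3) * (cos \<theta>)^2"
  by (simp add: P_def KN_P_def)
lemma Q_eq: "Q r \<theta> = (a^2 + q^2 - 2 * m * r + r^2) * (1 - \<alpha>^2 * r^2) - \<Lambda> / 3 * (a^2 + r^2) * r^2"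
  by (simp add: Q_def KN_Q_def)

lemma basic_DERIV [derivative_intros]:
  "((\<lambda>r. Om r \<theta>) has_real_derivative - \<alpha> * cos \<theta>) (at r)"
  "((\<lambda>\<theta>. Om r \<theta>) has_real_derivative \<alpha> * r * sin \<theta>) (at \<theta>)"
  "((\<lambda>r. rho r \<theta>) has_real_derivative 2 * r) (at r)"
  "((\<lambda>\<theta>. rho r \<theta>) has_real_derivative - 2 * a^2 * sin \<theta> * cos \<theta>) (at \<theta>)"
  "((\<lambda>r. P r \<theta>) has_real_derivative 0) (at r)"
  "((\<lambda>\<theta>. P r \<theta>) has_real_derivative P1 r \<theta>) (at \<theta>)"
  "((\<lambda>r. P1 r \<theta>) has_real_derivative 0) (at r)"
  "((\<lambda>\<theta>. P1 r \<theta>) has_real_derivative P2 r \<theta>) (at \<theta>)"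
  "((\<lambda>r. Q r \<theta>) has_real_derivative Q1 r \<theta>) (at r)"
  "((\<lambda>\<theta>. Q r \<theta>) has_real_derivative 0) (at \<theta>)"
  "((\<lambda>r. Q1 r \<theta>) has_real_derivative Q2 r \<theta>) (at r)"
  "((\<lambda>\<theta>. Q1 r \<theta>) has_real_derivative 0) (at \<theta>)"
  unfolding Om_eq rho_eq P_eq P1_def P2_def Q_eq Q1_def Q2_def
  by (auto intro!: derivative_eq_intros) (simp_all add: algebra_simps power2_eq_square
      power3_eq_cube)

lemmas basic_DERIV' = basic_DERIV[THEN DERIV_cong]

text \<open>
  \<open>fo\<close>, \<open>fe\<close> are the covectors \<open>\<omega>\<close>, \<open>\<eta>\<close> and \<open>eo\<close>, \<open>ee\<close> the dual vectors. Below, \<open>M\<close> is the matrix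
  with rows \<open>fo\<close>, \<open>fe\<close>, so that \<open>M\<^sup>-\<^sup>1\<close> has columns \<open>eo\<close>, \<open>ee\<close>, and \<open>L l = (\<partial>\<^sub>l M) M\<^sup>-\<^sup>1\<close>.
\<close>

definition fo where "fo i (r::real) \<theta> = (if i = 1 then 1 else if i = 4 then - a * (sin \<theta>)^2
    else (0::real))" for i :: 4
definition fe where "fe i r (\<theta>::real) = (if i = 1 then a else if i = 4 then - (r^2 + a^2)
    else (0::real))" for i :: 4
definition eo where "eo i r \<theta> = (if i = 1 then (r^2 + a^2) / rho r \<theta> else if i = 4 then a / rho r \<theta>
    else (0::real))" for i :: 4
definition ee where "ee i r \<theta> = (if i = 1 then - a * (sin \<theta>)^2 / rho r \<theta> else if i = 4 then
    - 1 / rho r \<theta> else (0::real))" for i :: 4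

definition L11 where "L11 l r \<theta> = (if l = 3 then - 2 * a^2 * sin \<theta> * cos \<theta> / rho r \<theta> else 0)" for
    l :: 4
definition L12 where "L12 l r \<theta> = (if l = 3 then 2 * a * sin \<theta> * cos \<theta> / rho r \<theta> else 0)" for l :: 4
definition L21 where "L21 l r \<theta> = (if l = 2 then - 2 * a * r / rho r \<theta> else 0)" for l :: 4
definition L22 where "L22 l r \<theta> = (if l = 2 then 2 * r / rho r \<theta> else 0)" for l :: 4

lemma sin_sq: "(sin \<theta>)^2 = 1 - (cos \<theta>)^2" for \<theta> :: real
  by (simp add: sin_squared_eq)

text \<open>As rewrite rules these make every polynomial at most linear in sin \<theta>; the second
  form catches squares inside right-nested products.\<close>

lemma sin_mult: "sin \<theta> * sin \<theta> = 1 - cos \<theta> * cos \<theta>"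
  "sin \<theta> * (sin \<theta> * x) = x - cos \<theta> * (cos \<theta> * x)" for \<theta> x :: real
  using sin_sq[of \<theta>] by (simp_all add: power2_eq_square mult.assoc[symmetric] left_diff_distrib)

text \<open>All four equations rest on r^2 + a^2 - a^2 sin^2 \<theta> = \<open>rho\<close>, which
  says that the matrix with rows \<open>fo\<close>, \<open>fe\<close> has determinant
  \<open>- rho\<close>.\<close>

lemma frame_dual:
  assumes "dom r \<theta>"
  shows "fo 1 r \<theta> * eo 1 r \<theta> + fo 4 r \<theta> * eo 4 r \<theta> = 1"
      "fo 1 r \<theta> * ee 1 r \<theta> + fo 4 r \<theta> * ee 4 r \<theta> = 0"
    "fe 1 r \<theta> * eo 1 r \<theta> + fe 4 r \<theta> * eo 4 r \<theta> = 0" "fe 1 r \<theta> * ee 1 r \<theta> + fe 4 r \<theta> * ee 4 r \<theta> = 1"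
  using domD[OF assms]
  by (simp_all add: fo_def fe_def eo_def ee_def divide_simps) (simp_all add: rho_eq power2_eq_square
      algebra_simps sin_mult)

lemma frame_complete:
  assumes "dom r \<theta>" "i \<in> {1,4}" "j \<in> {1,4}"
  shows "eo i r \<theta> * fo j r \<theta> + ee i r \<theta> * fe j r \<theta> = (if i = j then 1 else 0)"
  using domD[OF assms(1)] assms(2,3)
  by (auto simp: fo_def fe_def eo_def ee_def divide_simps) (simp_all add: rho_eq power2_eq_square
      algebra_simps sin_mult)

text \<open>Entrywise these are \<open>dM = L M\<close> and
  \<open>d(M^-1) = - M^-1 L\<close>.\<close>

lemma frame_deriv:
  assumes "dom r \<theta>"
  shows "has_pd l (fo i) (L11 l r \<theta> * fo i r \<theta> + L12 l r \<theta> * fe i r \<theta>) r \<theta>"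
    "has_pd l (fe i) (L21 l r \<theta> * fo i r \<theta> + L22 l r \<theta> * fe i r \<theta>) r \<theta>"
    "has_pd l (eo i) (- L11 l r \<theta> * eo i r \<theta> - L21 l r \<theta> * ee i r \<theta>) r \<theta>"
    "has_pd l (ee i) (- L12 l r \<theta> * eo i r \<theta> - L22 l r \<theta> * ee i r \<theta>) r \<theta>"
proof -
  note nz = domD[OF assms]
  have l: "l = 1 \<or> l = 2 \<or> l = 3 \<or> l = 4" using exhaust_4 by blast
  have i: "i = 1 \<or> i = 4 \<or> i \<notin> {1,4}" by auto
  show "has_pd l (fo i) (L11 l r \<theta> * fo i r \<theta> + L12 l r \<theta> * fe i r \<theta>) r \<theta>"
    using l i
    by (elim disjE; simp add: fo_def L11_def L12_def fe_def;
        (auto intro!: derivative_eq_intros basic_DERIV' simp: nz)?;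
        (simp add: divide_simps nz; simp add: rho_eq power2_eq_square algebra_simps sin_mult)?)
  show "has_pd l (fe i) (L21 l r \<theta> * fo i r \<theta> + L22 l r \<theta> * fe i r \<theta>) r \<theta>"
    using l i
    by (elim disjE; simp add: fo_def L21_def L22_def fe_def;
        (auto intro!: derivative_eq_intros basic_DERIV' simp: nz)?;
        (simp add: divide_simps nz; simp add: rho_eq power2_eq_square algebra_simps sin_mult)?)
  show "has_pd l (eo i) (- L11 l r \<theta> * eo i r \<theta> - L21 l r \<theta> * ee i r \<theta>) r \<theta>"
    using l i
    by (elim disjE; simp add: eo_def ee_def L11_def L21_def;
        (auto intro!: derivative_eq_intros basic_DERIV' simp: nz)?;
        (simp add: divide_simps nz; simp add: rho_eq power2_eq_square algebra_simps sin_mult)?)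
  show "has_pd l (ee i) (- L12 l r \<theta> * eo i r \<theta> - L22 l r \<theta> * ee i r \<theta>) r \<theta>"
    using l i
    by (elim disjE; simp add: eo_def ee_def L12_def L22_def;
        (auto intro!: derivative_eq_intros basic_DERIV' simp: nz)?;
        (simp add: divide_simps nz; simp add: rho_eq power2_eq_square algebra_simps sin_mult)?)
qed

text \<open>
  \<open>low x = M\<^sup>T x M\<close> and \<open>mix n = M\<^sup>-\<^sup>1 n M\<close>, hence \<open>\<partial> (low x) = low (\<partial> x + L\<^sup>T x + x L)\<close> and
  \<open>\<partial> (mix n) = mix (\<partial> n + n L - L n)\<close>.
\<close>

definition "low x11 x12 x21 x22 i j r \<theta> =
  fo i r \<theta> * (x11 * fo j r \<theta> + x12 * fe j r \<theta>) + fe i r \<theta> * (x21 * fo j r \<theta> + x22 * fe j r \<theta>)"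

definition "mix n11 n12 n21 n22 i j r \<theta> =
  eo i r \<theta> * (n11 * fo j r \<theta> + n12 * fe j r \<theta>) + ee i r \<theta> * (n21 * fo j r \<theta> + n22 * fe j r \<theta>)"

lemma low_mix:
  assumes "dom r \<theta>"
  shows "(\<Sum>k\<in>{1,4}. low x11 x12 x21 x22 i k r \<theta> * mix n11 n12 n21 n22 k j r \<theta>) =
    low (x11 * n11 + x12 * n21) (x11 * n12 + x12 * n22) (x21 * n11 + x22 * n21) (x21 * n12 + x22 *
        n22) i j r \<theta>"
  using frame_dual[OF assms] unfolding low_def mix_def
  by simp algebra

text \<open>Traces are invariant under conjugation by \<open>M\<close>; \<open>tr_mix_mix\<close> is
  the same for a product.\<close>

lemma tr_mix:
  assumes "dom r \<theta>"
  shows "(\<Sum>k\<in>{1,4}. mix n11 n12 n21 n22 k k r \<theta>) = n11 + n22"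
  using frame_dual[OF assms] unfolding mix_def by simp algebra

lemma tr_mix_mix:
  assumes "dom r \<theta>"
  shows "(\<Sum>k\<in>{1,4}. \<Sum>p\<in>{1,4}. mix n11 n12 n21 n22 k p r \<theta> * mix m11 m12 m21 m22 p k r \<theta>) =
    n11 * m11 + n12 * m21 + n21 * m12 + n22 * m22"
  using frame_dual[OF assms] unfolding mix_def by simp algebra

lemma low_deriv:
  assumes D: "dom r \<theta>"
    and x: "has_pd l X11 d11 r \<theta>" "has_pd l X12 d12 r \<theta>" "has_pd l X21 d21 r \<theta>"
        "has_pd l X22 d22 r \<theta>"
    and "x11 = X11 r \<theta>" "x12 = X12 r \<theta>" "x21 = X21 r \<theta>" "x22 = X22 r \<theta>"
  shows "has_pd l (\<lambda>r \<theta>. low (X11 r \<theta>) (X12 r \<theta>) (X21 r \<theta>) (X22 r \<theta>) i j r \<theta>)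
    (low (d11 + 2 * x11 * L11 l r \<theta> + (x12 + x21) * L21 l r \<theta>)
      (d12 + L11 l r \<theta> * x12 + L21 l r \<theta> * x22 + x11 * L12 l r \<theta> + x12 * L22 l r \<theta>)
      (d21 + L12 l r \<theta> * x11 + L22 l r \<theta> * x21 + x21 * L11 l r \<theta> + x22 * L21 l r \<theta>)
      (d22 + 2 * x22 * L22 l r \<theta> + (x12 + x21) * L12 l r \<theta>) i j r \<theta>) r \<theta>"
  unfolding low_def assms(6-)
  by (rule has_pd_cong, (rule has_pd_add has_pd_mult frame_deriv[OF D] x)+) algebra

lemma mix_deriv:
  assumes D: "dom r \<theta>"
    and x: "has_pd l X11 d11 r \<theta>" "has_pd l X12 d12 r \<theta>" "has_pd l X21 d21 r \<theta>"
        "has_pd l X22 d22 r \<theta>"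
    and "x11 = X11 r \<theta>" "x12 = X12 r \<theta>" "x21 = X21 r \<theta>" "x22 = X22 r \<theta>"
  shows "has_pd l (\<lambda>r \<theta>. mix (X11 r \<theta>) (X12 r \<theta>) (X21 r \<theta>) (X22 r \<theta>) i j r \<theta>)
    (mix (d11 + x12 * L21 l r \<theta> - L12 l r \<theta> * x21)
      (d12 + x11 * L12 l r \<theta> + x12 * L22 l r \<theta> - L11 l r \<theta> * x12 - L12 l r \<theta> * x22)
      (d21 + x21 * L11 l r \<theta> + x22 * L21 l r \<theta> - L21 l r \<theta> * x11 - L22 l r \<theta> * x21)
      (d22 + x21 * L12 l r \<theta> - L21 l r \<theta> * x12) i j r \<theta>) r \<theta>"
  unfolding mix_def assms(6-)
  by (rule has_pd_cong, (rule has_pd_add has_pd_mult frame_deriv[OF D] x)+) algebra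

text \<open>Coefficients of the diagonalised metric: \<open>cA\<close> belongs to \<omega>^2,
  \<open>cB\<close> to \<eta>^2, \<open>cC\<close> to dr^2 and \<open>cD\<close> to
  d\<theta>^2.\<close>

definition "cA r \<theta> = - Q r \<theta> / (rho r \<theta> * (Om r \<theta>)^2)"
definition "cB r \<theta> = P r \<theta> * (sin \<theta>)^2 / (rho r \<theta> * (Om r \<theta>)^2)"
definition "cC r \<theta> = rho r \<theta> / (Q r \<theta> * (Om r \<theta>)^2)"
definition "cD r \<theta> = rho r \<theta> / (P r \<theta> * (Om r \<theta>)^2)"

text \<open>
  \<open>n = D\<^sup>-\<^sup>1 (\<partial> D + L\<^sup>T D + D L)\<close> with \<open>D = diag cA cB\<close> represents \<open>N\<close> on the Killing block;
  \<open>nu\<close> and \<open>nv\<close> are the logarithmic derivatives of \<open>cC\<close> and \<open>cD\<close>.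
\<close>

definition n11 where "n11 l r \<theta> = (if l = 2 then Q1 r \<theta> / Q r \<theta> - 2 * r / rho r \<theta>
    + 2 * \<alpha> * cos \<theta> / Om r \<theta>
  else if l = 3 then - 2 * a^2 * sin \<theta> * cos \<theta> / rho r \<theta> - 2 * \<alpha> * r * sin \<theta> / Om r \<theta> else
      0)" for l :: 4
definition n12 where "n12 l r \<theta> = (if l = 2 then 2 * r * a * P r \<theta> * (sin \<theta>)^2 / (Q r \<theta> * rho r \<theta>)
  else if l = 3 then 2 * a * sin \<theta> * cos \<theta> / rho r \<theta> else 0)" for l :: 4
definition n21 where "n21 l r \<theta> = (if l = 2 then - 2 * r * a / rho r \<theta>
  else if l = 3 then - 2 * a * cos \<theta> * Q r \<theta> / (P r \<theta> * sin \<theta> * rho r \<theta>) else 0)" for l :: 4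
definition n22 where "n22 l r \<theta> = (if l = 2 then 2 * r / rho r \<theta> + 2 * \<alpha> * cos \<theta> / Om r \<theta>
  else if l = 3 then P1 r \<theta> / P r \<theta> + 2 * cos \<theta> / sin \<theta> + 2 * a^2 * sin \<theta> * cos \<theta> / rho r \<theta>
    - 2 * \<alpha> * r * sin \<theta> / Om r \<theta> else 0)" for l :: 4
definition nu where "nu l r \<theta> = (if l = 2 then 2 * r / rho r \<theta> - Q1 r \<theta> / Q r \<theta>
    + 2 * \<alpha> * cos \<theta> / Om r \<theta>
  else if l = 3 then - 2 * a^2 * sin \<theta> * cos \<theta> / rho r \<theta> - 2 * \<alpha> * r * sin \<theta> / Om r \<theta> else
      0)" for l :: 4
definition nv where "nv l r \<theta> = (if l = 2 then 2 * r / rho r \<theta> + 2 * \<alpha> * cos \<theta> / Om r \<theta>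
  else if l = 3 then - 2 * a^2 * sin \<theta> * cos \<theta> / rho r \<theta> - P1 r \<theta> / P r \<theta> - 2 * \<alpha> * r * sin \<theta> / Om r
      \<theta> else 0)" for l :: 4

text \<open>A diagonal entry of \<open>n\<close> is the logarithmic derivative of \<open>cA\<close>
  or \<open>cB\<close> plus twice the corresponding diagonal entry of \<open>L\<close>; the first
  two claims solve for that logarithmic derivative.\<close>

lemma coef_deriv:
  assumes "dom r \<theta>"
  shows "has_pd l cA (cA r \<theta> * (n11 l r \<theta> - 2 * L11 l r \<theta>)) r \<theta>"
    "has_pd l cB (cB r \<theta> * (n22 l r \<theta> - 2 * L22 l r \<theta>)) r \<theta>"
    "has_pd l cC (cC r \<theta> * nu l r \<theta>) r \<theta>"
    "has_pd l cD (cD r \<theta> * nv l r \<theta>) r \<theta>"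
proof -
  note nz = domD[OF assms]
  show "has_pd l cA (cA r \<theta> * (n11 l r \<theta> - 2 * L11 l r \<theta>)) r \<theta>"
    by (rule has_pdI[of _ _ "\<lambda>l. cA r \<theta> * (n11 l r \<theta> - 2 * L11 l r \<theta>)"];
        auto simp: cA_def n11_def L11_def nz intro!: derivative_eq_intros basic_DERIV'; simp add: nz
            divide_simps; algebra)
  show "has_pd l cB (cB r \<theta> * (n22 l r \<theta> - 2 * L22 l r \<theta>)) r \<theta>"
    by (rule has_pdI[of _ _ "\<lambda>l. cB r \<theta> * (n22 l r \<theta> - 2 * L22 l r \<theta>)"];
        auto simp: cB_def n22_def L22_def nz intro!: derivative_eq_intros basic_DERIV'; simp add: nz
            divide_simps; algebra)
  show "has_pd l cC (cC r \<theta> * nu l r \<theta>) r \<theta>"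
    by (rule has_pdI[of _ _ "\<lambda>l. cC r \<theta> * nu l r \<theta>"];
        auto simp: cC_def nu_def nz intro!: derivative_eq_intros basic_DERIV'; simp add: nz
            divide_simps; algebra)
  show "has_pd l cD (cD r \<theta> * nv l r \<theta>) r \<theta>"
    by (rule has_pdI[of _ _ "\<lambda>l. cD r \<theta> * nv l r \<theta>"];
        auto simp: cD_def nv_def nz intro!: derivative_eq_intros basic_DERIV'; simp add: nz
            divide_simps; algebra)
qed

text \<open>The off-diagonal entry of \<open>dD + L^T D + D L\<close> receives nothing from the
  diagonal \<open>dD\<close>. As this matrix is symmetric, one expression gives both
  \<open>cA n12\<close> and \<open>cB n21\<close>.\<close>

lemma n_rel:
  assumes "dom r \<theta>"
  shows "cA r \<theta> * L12 l r \<theta> + cB r \<theta> * L21 l r \<theta> = cA r \<theta> * n12 l r \<theta>"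
    "cA r \<theta> * L12 l r \<theta> + cB r \<theta> * L21 l r \<theta> = cB r \<theta> * n21 l r \<theta>"
  using domD[OF assms]
  by (simp_all add: cA_def cB_def L12_def L21_def n12_def n21_def power2_eq_square divide_simps)

definition G :: "4 \<Rightarrow> 4 \<Rightarrow> real \<Rightarrow> real \<Rightarrow> real" where
  "G i j r \<theta> = low (cA r \<theta>) 0 0 (cB r \<theta>) i j r \<theta>
    + (if i = 2 \<and> j = 2 then cC r \<theta> else 0) + (if i = 3 \<and> j = 3 then cD r \<theta> else 0)"

definition H :: "4 \<Rightarrow> 4 \<Rightarrow> real \<Rightarrow> real \<Rightarrow> real" where
  "H i j r \<theta> = eo i r \<theta> * eo j r \<theta> / cA r \<theta> + ee i r \<theta> * ee j r \<theta> / cB r \<theta>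
    + (if i = 2 \<and> j = 2 then 1 / cC r \<theta> else 0) + (if i = 3 \<and> j = 3 then 1 / cD r \<theta> else 0)"

definition N :: "4 \<Rightarrow> 4 \<Rightarrow> 4 \<Rightarrow> real \<Rightarrow> real \<Rightarrow> real" where
  "N l i j r \<theta> = mix (n11 l r \<theta>) (n12 l r \<theta>) (n21 l r \<theta>) (n22 l r \<theta>) i j r \<theta>
    + (if i = 2 \<and> j = 2 then nu l r \<theta> else 0) + (if i = 3 \<and> j = 3 then nv l r \<theta> else 0)"

definition S :: "(real^4) set" where "S = {x. dom (x $ 2) (x $ 3)}"

lemma open_S: "open S"
proof -
  have "S = {x. 0 < Om (x$2) (x$3)} \<inter> {x. rho (x$2) (x$3) \<noteq> 0} \<inter> {x. Q (x$2) (x$3) \<noteq> 0}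
      \<inter> {x. 0 < P (x$2) (x$3)} \<inter> {x. sin (x$3) \<noteq> 0}"
    by (auto simp: S_def dom_def)
  also have "open \<dots>"
    unfolding Om_eq rho_eq P_eq Q_eq
    by (intro open_Int open_Collect_less open_Collect_neq continuous_intros)
  finally show ?thesis .
qed

lemma frame_zero: "i \<notin> {1,4} \<Longrightarrow> fo i r \<theta> = 0" "i \<notin> {1,4} \<Longrightarrow> fe i r \<theta> = 0"
  "i \<notin> {1,4} \<Longrightarrow> eo i r \<theta> = 0" "i \<notin> {1,4} \<Longrightarrow> ee i r \<theta> = 0"
  by (simp_all add: fo_def fe_def eo_def ee_def)

lemma low_zero: "low x11 x12 x21 x22 i 2 r \<theta> = 0" "low x11 x12 x21 x22 i 3 r \<theta> = 0"
    "low x11 x12 x21 x22 2 i r \<theta> = 0" "low x11 x12 x21 x22 3 i r \<theta> = 0"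
  and mix_zero: "mix x11 x12 x21 x22 i 2 r \<theta> = 0" "mix x11 x12 x21 x22 i 3 r \<theta> = 0"
    "mix x11 x12 x21 x22 2 i r \<theta> = 0" "mix x11 x12 x21 x22 3 i r \<theta> = 0"
  by (simp_all add: low_def mix_def frame_zero)

lemma metric_eq: "g y $ i $ j = G i j (y $ 2) (y $ 3)"
proof -
  have i: "i = 1 \<or> i = 2 \<or> i = 3 \<or> i = 4" and j: "j = 1 \<or> j = 2 \<or> j = 3 \<or> j = 4"
    using exhaust_4 by blast+
  show ?thesis
    using i j
    by (elim disjE; simp add: KN_metric_def G_def low_def fo_def fe_def cA_def cB_def cC_def cD_def
        Om_def rho_def P_def Q_def Let_def axis_def vector_def mult_ac
          add_divide_distrib diff_divide_distrib)
qed

lemma c_nz: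
  assumes "dom r \<theta>"
  shows "cA r \<theta> \<noteq> 0" "cB r \<theta> \<noteq> 0" "cC r \<theta> \<noteq> 0" "cD r \<theta> \<noteq> 0"
  using domD[OF assms] by (simp_all add: cA_def cB_def cC_def cD_def)

sublocale block_metric S g dom G H N
proof
  show "open S" by (rule open_S)
  show "y \<in> S \<longleftrightarrow> dom (y $ 2) (y $ 3)" for y by (simp add: S_def)
  show "g y $ i $ j = G i j (y $ 2) (y $ 3)" for y i j by (rule metric_eq)
  show "G i j r \<theta> = G j i r \<theta>" for i j r \<theta>
    by (auto simp: G_def low_def algebra_simps)
  show "(\<Sum>k\<in>UNIV. H i k r \<theta> * G k j r \<theta>) = (if i = j then 1 else 0)" if "dom r \<theta>" for i j r \<theta>
  proof -
    have *: "(\<Sum>k\<in>UNIV. H i k r \<theta> * G k j r \<theta>) = (\<Sum>k\<in>{1,4}. (eo i r \<theta> * eo k r \<theta> / cA r \<theta>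
        + ee i r \<theta> * ee k r \<theta> / cB r \<theta>)
       * low (cA r \<theta>) 0 0 (cB r \<theta>) k j r \<theta>) + (if i = 2 \<and> j = 2 then 1 else 0) + (if i = 3 \<and> j = 3
           then 1 else 0)"
      using c_nz[OF that] by (simp add: sum_4 H_def G_def frame_zero low_def)
    have "(\<Sum>k\<in>{1,4}. (eo i r \<theta> * eo k r \<theta> / cA r \<theta> + ee i r \<theta> * ee k r \<theta> / cB r \<theta>)
       * low (cA r \<theta>) 0 0 (cB r \<theta>) k j r \<theta>) = (if i \<in> {1,4} \<and> j \<in> {1,4} then if i = j then 1 else 0
           else 0)"
    proof -
      \<comment> \<open>The reciprocals become variables tied down by polynomial equations, a form
        suited to \<open>algebra\<close>.\<close>
      define iA iB where "iA = 1 / cA r \<theta>" and "iB = 1 / cB r \<theta>"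
      have 1: "cA r \<theta> * iA = 1" "cB r \<theta> * iB = 1"
        using c_nz[OF that] by (simp_all add: iA_def iB_def)
      have 2: "eo i r \<theta> * eo k r \<theta> / cA r \<theta> + ee i r \<theta> * ee k r \<theta> / cB r \<theta> =
        eo i r \<theta> * eo k r \<theta> * iA + ee i r \<theta> * ee k r \<theta> * iB" for k
        by (simp add: iA_def iB_def)
      have "(\<Sum>k\<in>{1,4}. (eo i r \<theta> * eo k r \<theta> / cA r \<theta> + ee i r \<theta> * ee k r \<theta> / cB r \<theta>)
        * low (cA r \<theta>) 0 0 (cB r \<theta>) k j r \<theta>) = eo i r \<theta> * fo j r \<theta> + ee i r \<theta> * fe j r \<theta>"
        unfolding 2 low_def using 1 frame_dual[OF that] by simp algebra
      then show ?thesis using frame_complete[OF that, of i j] by (auto simp: frame_zero)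
    qed
    then show ?thesis unfolding * using exhaust_4[of i] exhaust_4[of j] by auto
  qed
  show "has_pd l (G i j) (\<Sum>k\<in>UNIV. G i k r \<theta> * N l k j r \<theta>) r \<theta>" if D: "dom r \<theta>" for l i j r \<theta>
  proof -
    have "(\<Sum>k\<in>UNIV. G i k r \<theta> * N l k j r \<theta>) =
      (\<Sum>k\<in>{1,4}. low (cA r \<theta>) 0 0 (cB r \<theta>) i k r \<theta> * mix (n11 l r \<theta>) (n12 l r \<theta>) (n21 l r \<theta>) (n22 l
          r \<theta>) k j r \<theta>)
      + (if i = 2 \<and> j = 2 then cC r \<theta> * nu l r \<theta> else 0) + (if i = 3 \<and> j = 3 then cD r \<theta> * nv l r \<theta>
          else 0)"
      by (simp add: sum_4 G_def N_def low_zero mix_zero)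
    also have "\<dots> = low (cA r \<theta> * n11 l r \<theta>) (cA r \<theta> * n12 l r \<theta>) (cB r \<theta> * n21 l r \<theta>) (cB r \<theta>
        * n22 l r \<theta>) i j r \<theta>
      + (if i = 2 \<and> j = 2 then cC r \<theta> * nu l r \<theta> else 0) + (if i = 3 \<and> j = 3 then cD r \<theta> * nv l r \<theta>
          else 0)"
      unfolding low_mix[OF D] by simp
    finally have eq: "(\<Sum>k\<in>UNIV. G i k r \<theta> * N l k j r \<theta>) = \<dots>" .
    have "has_pd l (\<lambda>r \<theta>. low (cA r \<theta>) 0 0 (cB r \<theta>) i j r \<theta>)
      (low (cA r \<theta> * n11 l r \<theta>) (cA r \<theta> * n12 l r \<theta>) (cB r \<theta> * n21 l r \<theta>) (cB r \<theta> * n22 l r \<theta>) i j r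
          \<theta>) r \<theta>"
      by (rule has_pd_cong[OF low_deriv[OF D coef_deriv(1)[OF D] has_pd_const has_pd_const
          coef_deriv(2)[OF D] refl refl refl refl]])
        (simp add: n_rel[OF D, symmetric] algebra_simps)
    moreover have "has_pd l (\<lambda>r \<theta>. if i = 2 \<and> j = 2 then cC r \<theta> else 0) (if i = 2 \<and> j = 2
        then cC r \<theta> * nu l r \<theta> else 0) r \<theta>"
      "has_pd l (\<lambda>r \<theta>. if i = 3 \<and> j = 3 then cD r \<theta> else 0) (if i = 3 \<and> j = 3 then cD r \<theta> * nv l r \<theta>
          else 0) r \<theta>"
      using coef_deriv(3,4)[OF D] by (auto simp: has_pd_const)
    moreover have "G i j = (\<lambda>r \<theta>. low (cA r \<theta>) 0 0 (cB r \<theta>) i j r \<theta>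
      + (if i = 2 \<and> j = 2 then cC r \<theta> else 0) + (if i = 3 \<and> j = 3 then cD r \<theta> else 0))"
      by (intro ext) (rule G_def)
    ultimately show ?thesis unfolding eq by (simp only: has_pd_add)
  qed
  show "block_diag (\<lambda>i j. G i j r \<theta>)" for r \<theta>
    by (auto simp: block_diag_def G_def low_def fo_def fe_def)
  show "block_diag (\<lambda>i j. H i j r \<theta>)" for r \<theta>
    by (auto simp: block_diag_def H_def eo_def ee_def)
  show "block_diag (\<lambda>i j. N l i j r \<theta>)" for l r \<theta>
    by (auto simp: block_diag_def N_def mix_def fo_def fe_def eo_def ee_def)
  show "N 1 i j r \<theta> = 0" "N 4 i j r \<theta> = 0" for i j r \<theta>
    by (simp_all add: N_def mix_def n11_def n12_def n21_def n22_def nu_def nv_def)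
qed

section \<open>The Ricci tensor\<close>

text \<open>This is \<open>sqrt |det g|\<close> up to sign. The factors \<open>P\<close> and
  \<open>Q\<close> cancel between the Killing and the meridian block, and the determinant of
  \<open>M\<close> contributes \<open>rho\<close>.\<close>

definition "W r \<theta> = rho r \<theta> * sin \<theta> / (Om r \<theta>)^4"

text \<open>The \<open>z\<close> functions collect the terms of \<open>n11\<close> over
  \<open>rho\<close> and \<open>Om\<close>, the \<open>y\<close> functions those of
  \<open>n22\<close>, all divided by \<open>Om^2\<close>. In direction 3 a factor sin \<theta> is
  split off, and \<open>z3\<close> has the sign reversed.\<close>

definition "z2 r \<theta> = 2 * \<alpha> * cos \<theta> / (Om r \<theta>)^3 - 2 * r / (rho r \<theta> * (Om r \<theta>)^2)"
definition "dz2 r \<theta> = 6 * \<alpha>^2 * (cos \<theta>)^2 / (Om r \<theta>)^4 - 2 / (rho r \<theta> * (Om r \<theta>)^2)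
  + 4 * r^2 / ((rho r \<theta>)^2 * (Om r \<theta>)^2) - 4 * r * \<alpha> * cos \<theta> / (rho r \<theta> * (Om r \<theta>)^3)"
definition "y2 r \<theta> = 2 * \<alpha> * cos \<theta> / (Om r \<theta>)^3 + 2 * r / (rho r \<theta> * (Om r \<theta>)^2)"
definition "dy2 r \<theta> = 6 * \<alpha>^2 * (cos \<theta>)^2 / (Om r \<theta>)^4 + 2 / (rho r \<theta> * (Om r \<theta>)^2)
  - 4 * r^2 / ((rho r \<theta>)^2 * (Om r \<theta>)^2) + 4 * r * \<alpha> * cos \<theta> / (rho r \<theta> * (Om r \<theta>)^3)"
definition "z3 r \<theta> = 2 * a^2 * cos \<theta> / (rho r \<theta> * (Om r \<theta>)^2) + 2 * \<alpha> * r / (Om r \<theta>)^3"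
definition "dz3 r \<theta> = sin \<theta> * (- 2 * a^2 / (rho r \<theta> * (Om r \<theta>)^2)
    + 4 * a^4 * (cos \<theta>)^2 / ((rho r \<theta>)^2 * (Om r \<theta>)^2)
  - 4 * a^2 * \<alpha> * r * cos \<theta> / (rho r \<theta> * (Om r \<theta>)^3) - 6 * \<alpha>^2 * r^2 / (Om r \<theta>)^4)"
definition "y3 r \<theta> = 2 * a^2 * cos \<theta> / (rho r \<theta> * (Om r \<theta>)^2) - 2 * \<alpha> * r / (Om r \<theta>)^3"
definition "dy3 r \<theta> = sin \<theta> * (- 2 * a^2 / (rho r \<theta> * (Om r \<theta>)^2)
    + 4 * a^4 * (cos \<theta>)^2 / ((rho r \<theta>)^2 * (Om r \<theta>)^2)
  - 4 * a^2 * \<alpha> * r * cos \<theta> / (rho r \<theta> * (Om r \<theta>)^3) + 6 * \<alpha>^2 * r^2 / (Om r \<theta>)^4)"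

lemma zy_deriv:
  assumes "dom r \<theta>"
  shows "((\<lambda>r. z2 r \<theta>) has_real_derivative dz2 r \<theta>) (at r)"
    "((\<lambda>r. y2 r \<theta>) has_real_derivative dy2 r \<theta>) (at r)"
    "((\<lambda>\<theta>. z3 r \<theta>) has_real_derivative dz3 r \<theta>) (at \<theta>)"
    "((\<lambda>\<theta>. y3 r \<theta>) has_real_derivative dy3 r \<theta>) (at \<theta>)"
  using domD(1,2)[OF assms] unfolding z2_def dz2_def y2_def dy2_def z3_def dz3_def y3_def dy3_def
  by (auto intro!: derivative_eq_intros basic_DERIV'; simp add: divide_simps; algebra)+

text \<open>
  \<open>k l = W g\<^sup>l\<^sup>l n l\<close>; multiplication by \<open>W g\<^sup>l\<^sup>l\<close> removes the denominators \<open>P\<close>, \<open>Q\<close> of \<open>n\<close>.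
\<close>

definition k11 where "k11 l r \<theta> = (if l = 2 then sin \<theta> * (Q1 r \<theta> / (Om r \<theta>)^2 + Q r \<theta> * z2 r \<theta>)
  else - ((sin \<theta>)^2 * P r \<theta> * z3 r \<theta>))" for l :: 4
definition k12 where "k12 l r \<theta>
    = (if l = 2 then 2 * a * (sin \<theta>)^3 * P r \<theta> * r / (rho r \<theta> * (Om r \<theta>)^2)
  else 2 * a * cos \<theta> * (sin \<theta>)^2 * P r \<theta> / (rho r \<theta> * (Om r \<theta>)^2))" for l :: 4
definition k21 where "k21 l r \<theta>
    = (if l = 2 then - 2 * a * sin \<theta> * r * Q r \<theta> / (rho r \<theta> * (Om r \<theta>)^2)
  else - 2 * a * cos \<theta> * Q r \<theta> / (rho r \<theta> * (Om r \<theta>)^2))" for l :: 4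
definition k22 where "k22 l r \<theta> = (if l = 2 then sin \<theta> * Q r \<theta> * y2 r \<theta>
  else (sin \<theta> * P1 r \<theta> + 2 * cos \<theta> * P r \<theta>) / (Om r \<theta>)^2 + P r \<theta> * (sin \<theta>)^2 * y3 r \<theta>)" for l :: 4

definition dk11 where "dk11 l r \<theta> = (if l = 2 then sin \<theta> * (Q2 r \<theta> / (Om r \<theta>)^2
    + 2 * \<alpha> * cos \<theta> * Q1 r \<theta> / (Om r \<theta>)^3 + Q1 r \<theta> * z2 r \<theta> + Q r \<theta> * dz2 r \<theta>)
  else - (2 * sin \<theta> * cos \<theta> * P r \<theta> + (sin \<theta>)^2 * P1 r \<theta>) * z3 r \<theta> - (sin \<theta>)^2 * P r \<theta> * dz3 r
      \<theta>)" for l :: 4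
definition dk12 where "dk12 l r \<theta>
    = (if l = 2 then 2 * a * (sin \<theta>)^3 * P r \<theta> * (1 / (rho r \<theta> * (Om r \<theta>)^2)
    - 2 * r^2 / ((rho r \<theta>)^2 * (Om r \<theta>)^2) + 2 * \<alpha> * cos \<theta> * r / (rho r \<theta> * (Om r \<theta>)^3))
  else 2 * a * ((2 * (cos \<theta>)^2 * sin \<theta> * P r \<theta> - (sin \<theta>)^3 * P r \<theta> + cos \<theta> * (sin \<theta>)^2 * P1 r \<theta>)
      / (rho r \<theta> * (Om r \<theta>)^2)
    + 2 * a^2 * (cos \<theta>)^2 * (sin \<theta>)^3 * P r \<theta> / ((rho r \<theta>)^2 * (Om r \<theta>)^2)
    - 2 * \<alpha> * r * cos \<theta> * (sin \<theta>)^3 * P r \<theta> / (rho r \<theta> * (Om r \<theta>)^3)))" for l :: 4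
definition dk21 where "dk21 l r \<theta>
    = (if l = 2 then - 2 * a * sin \<theta> * ((Q r \<theta> + r * Q1 r \<theta>) / (rho r \<theta> * (Om r \<theta>)^2)
    - 2 * r^2 * Q r \<theta> / ((rho r \<theta>)^2 * (Om r \<theta>)^2) + 2 * \<alpha> * cos \<theta> * r * Q r \<theta>
        / (rho r \<theta> * (Om r \<theta>)^3))
  else - 2 * a * Q r \<theta> * sin \<theta> * (- 1 / (rho r \<theta> * (Om r \<theta>)^2)
    + 2 * a^2 * (cos \<theta>)^2 / ((rho r \<theta>)^2 * (Om r \<theta>)^2) - 2 * \<alpha> * r * cos \<theta>
        / (rho r \<theta> * (Om r \<theta>)^3)))" for l :: 4
definition dk22 where "dk22 l r \<theta> = (if l = 2 then sin \<theta> * (Q1 r \<theta> * y2 r \<theta> + Q r \<theta> * dy2 r \<theta>)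
  else (3 * cos \<theta> * P1 r \<theta> + sin \<theta> * P2 r \<theta> - 2 * sin \<theta> * P r \<theta>) / (Om r \<theta>)^2
    - 2 * \<alpha> * r * sin \<theta> * (sin \<theta> * P1 r \<theta> + 2 * cos \<theta> * P r \<theta>) / (Om r \<theta>)^3
    + (2 * sin \<theta> * cos \<theta> * P r \<theta> + (sin \<theta>)^2 * P1 r \<theta>) * y3 r \<theta> + P r \<theta> * (sin \<theta>)^2 * dy3 r
        \<theta>)" for l :: 4

lemma k_deriv:
  assumes D: "dom r \<theta>" and l: "l \<in> {2, 3}"
  shows "has_pd l (k11 l) (dk11 l r \<theta>) r \<theta>" "has_pd l (k12 l) (dk12 l r \<theta>) r \<theta>"
    "has_pd l (k21 l) (dk21 l r \<theta>) r \<theta>" "has_pd l (k22 l) (dk22 l r \<theta>) r \<theta>"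
proof -
  note nz = domD[OF D]
  note intros = derivative_eq_intros basic_DERIV' zy_deriv[OF D, THEN DERIV_cong]
  have "((\<lambda>r. k11 2 r \<theta>) has_real_derivative dk11 2 r \<theta>) (at r)"
       "((\<lambda>r. k12 2 r \<theta>) has_real_derivative dk12 2 r \<theta>) (at r)"
       "((\<lambda>r. k21 2 r \<theta>) has_real_derivative dk21 2 r \<theta>) (at r)"
       "((\<lambda>r. k22 2 r \<theta>) has_real_derivative dk22 2 r \<theta>) (at r)"
       "((\<lambda>\<theta>. k11 3 r \<theta>) has_real_derivative dk11 3 r \<theta>) (at \<theta>)"
       "((\<lambda>\<theta>. k12 3 r \<theta>) has_real_derivative dk12 3 r \<theta>) (at \<theta>)"
       "((\<lambda>\<theta>. k21 3 r \<theta>) has_real_derivative dk21 3 r \<theta>) (at \<theta>)"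
       "((\<lambda>\<theta>. k22 3 r \<theta>) has_real_derivative dk22 3 r \<theta>) (at \<theta>)"
    unfolding k11_def k12_def k21_def k22_def dk11_def dk12_def dk21_def dk22_def
      coord_if_simps
    by (auto intro!: intros simp: nz; (simp add: nz divide_simps)?; algebra)+
  then show "has_pd l (k11 l) (dk11 l r \<theta>) r \<theta>" "has_pd l (k12 l) (dk12 l r \<theta>) r \<theta>"
    "has_pd l (k21 l) (dk21 l r \<theta>) r \<theta>" "has_pd l (k22 l) (dk22 l r \<theta>) r \<theta>"
    using l by auto
qed

lemma k_eq:
  assumes D: "dom r \<theta>" and l: "l \<in> {2, 3}"
  shows "W r \<theta> * H l l r \<theta> * n11 l r \<theta> = k11 l r \<theta>" "W r \<theta> * H l l r \<theta> * n12 l r \<theta> = k12 l r \<theta>"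
    "W r \<theta> * H l l r \<theta> * n21 l r \<theta> = k21 l r \<theta>" "W r \<theta> * H l l r \<theta> * n22 l r \<theta> = k22 l r \<theta>"
proof -
  note nz = domD[OF D]
  have WH: "W r \<theta> * H 2 2 r \<theta> = Q r \<theta> * sin \<theta> / (Om r \<theta>)^2"
      "W r \<theta> * H 3 3 r \<theta> = P r \<theta> * sin \<theta> / (Om r \<theta>)^2"
    using nz by (simp_all add: W_def H_def frame_zero cC_def cD_def field_simps)
  note defs = WH k11_def k12_def k21_def k22_def n11_def n12_def n21_def n22_def z2_def z3_def
      y2_def y3_def
  have "W r \<theta> * H 2 2 r \<theta> * n11 2 r \<theta> = k11 2 r \<theta>" "W r \<theta> * H 2 2 r \<theta> * n12 2 r \<theta> = k12 2 r \<theta>"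
    "W r \<theta> * H 2 2 r \<theta> * n21 2 r \<theta> = k21 2 r \<theta>" "W r \<theta> * H 2 2 r \<theta> * n22 2 r \<theta> = k22 2 r \<theta>"
    "W r \<theta> * H 3 3 r \<theta> * n11 3 r \<theta> = k11 3 r \<theta>" "W r \<theta> * H 3 3 r \<theta> * n12 3 r \<theta> = k12 3 r \<theta>"
    "W r \<theta> * H 3 3 r \<theta> * n21 3 r \<theta> = k21 3 r \<theta>" "W r \<theta> * H 3 3 r \<theta> * n22 3 r \<theta> = k22 3 r \<theta>"
    by (simp add: defs; (simp add: nz divide_simps)?; (simp add: power2_eq_square power3_eq_cube;
        fail | algebra))+
  then show "W r \<theta> * H l l r \<theta> * n11 l r \<theta> = k11 l r \<theta>" "W r \<theta> * H l l r \<theta> * n12 l r \<theta> = k12 l r \<theta>"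
    "W r \<theta> * H l l r \<theta> * n21 l r \<theta> = k21 l r \<theta>" "W r \<theta> * H l l r \<theta> * n22 l r \<theta> = k22 l r \<theta>"
    using l by auto
qed

text \<open>
  The eigenvalues of the mixed Ricci tensor: \<open>ric1\<close> for \<open>eo\<close>, \<open>\<partial>\<^sub>r\<close> and \<open>ric2\<close> for \<open>ee\<close>, \<open>\<partial>\<^sub>\<theta>\<close>.
\<close>

definition "ric1 r \<theta> = \<Lambda> - q^2 * (Om r \<theta>)^4 / (rho r \<theta>)^2"
definition "ric2 r \<theta> = \<Lambda> + q^2 * (Om r \<theta>)^4 / (rho r \<theta>)^2"

text \<open>Minus the derivative of \<open>P\<close> with respect to cos \<theta>. With sin \<theta>
  split off from \<open>P1\<close>, the residuals contain only even powers of sin \<theta>.\<close>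

definition p1 where "p1 \<theta> = 2 * \<alpha> * m - 2 * (\<alpha>^2 * (a^2 + q^2) + \<Lambda> * a^2 / 3) * cos \<theta>" for \<theta> :: real

lemma P1_p1: "P1 r \<theta> = sin \<theta> * p1 \<theta>"
  by (simp add: P1_def p1_def)

text \<open>
  Inverses of \<open>Om\<close>, \<open>rho\<close>, \<open>P\<close>, \<open>Q\<close> enter the polynomial identities as separate variables. An
  equation for the Ricci tensor then reduces to the vanishing of a polynomial \<open>residual\<close>, its
  difference of both sides with denominators cleared.
\<close>

lemmas to_inverse = divide_inverse inverse_mult_distrib power_inverse[symmetric]

definition "residual_oo r \<theta> =
  Q2 r \<theta> * (Om r \<theta>)^2 * (rho r \<theta>)^2 + 4 * \<alpha> * cos \<theta> * Q1 r \<theta> * Om r \<theta> * (rho r \<theta>)^2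
    - 2 * r * Q1 r \<theta> * (Om r \<theta>)^2 * rho r \<theta>
    + Q r \<theta> * (6 * \<alpha>^2 * (cos \<theta>)^2 * (rho r \<theta>)^2 - 2 * (Om r \<theta>)^2 * rho r \<theta> + 4 * r^2 * (Om r \<theta>)^2
      - 4 * r * \<alpha> * cos \<theta> * Om r \<theta> * rho r \<theta>)
    - 4 * a^2 * r^2 * (sin \<theta>)^2 * P r \<theta> * (Om r \<theta>)^2
    - (2 * cos \<theta> * P r \<theta> + (sin \<theta>)^2 * p1 \<theta>) * (2 * a^2 * cos \<theta> * (Om r \<theta>)^2 * rho r \<theta> + 2 * \<alpha> * r *
        Om r \<theta> * (rho r \<theta>)^2)
    - (sin \<theta>)^2 * P r \<theta> * (4 * a^4 * (cos \<theta>)^2 * (Om r \<theta>)^2 - 2 * a^2 * (Om r \<theta>)^2 * rho r \<theta>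
      - 4 * a^2 * \<alpha> * r * cos \<theta> * Om r \<theta> * rho r \<theta> - 6 * \<alpha>^2 * r^2 * (rho r \<theta>)^2)
    + 4 * a^2 * (cos \<theta>)^2 * Q r \<theta> * (Om r \<theta>)^2 + 2 * \<Lambda> * (rho r \<theta>)^3 - 2 * q^2 * rho r \<theta>
        * (Om r \<theta>)^4"

text \<open>Here the field equation enters through the explicit \<open>P\<close> and
  \<open>Q\<close>. Once \<open>sin_sq\<close> has removed the sine, r and cos \<theta> act as
  independent variables and a polynomial identity remains.\<close>

lemma residual_oo: "residual_oo r \<theta> = 0"
  unfolding residual_oo_def sin_sq Q_eq Q1_def Q2_def P_eq p1_def Om_eq rho_eq by algebra

definition "residual_ee r \<theta> =
  Q1 r \<theta> * (2 * \<alpha> * cos \<theta> * Om r \<theta> * (rho r \<theta>)^2 + 2 * r * (Om r \<theta>)^2 * rho r \<theta>)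
    + Q r \<theta> * (6 * \<alpha>^2 * (cos \<theta>)^2 * (rho r \<theta>)^2 + 2 * (Om r \<theta>)^2 * rho r \<theta> - 4 * r^2 * (Om r \<theta>)^2
      + 4 * r * \<alpha> * cos \<theta> * Om r \<theta> * rho r \<theta>)
    + 4 * a^2 * r^2 * (sin \<theta>)^2 * P r \<theta> * (Om r \<theta>)^2
    + (3 * cos \<theta> * p1 \<theta> + P2 r \<theta> - 2 * P r \<theta>) * (Om r \<theta>)^2 * (rho r \<theta>)^2
    - 2 * \<alpha> * r * ((sin \<theta>)^2 * p1 \<theta> + 2 * cos \<theta> * P r \<theta>) * Om r \<theta> * (rho r \<theta>)^2
    + (2 * cos \<theta> * P r \<theta> + (sin \<theta>)^2 * p1 \<theta>) * (2 * a^2 * cos \<theta> * (Om r \<theta>)^2 * rho r \<theta> - 2 * \<alpha> * r *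
        Om r \<theta> * (rho r \<theta>)^2)
    + (sin \<theta>)^2 * P r \<theta> * (4 * a^4 * (cos \<theta>)^2 * (Om r \<theta>)^2 - 2 * a^2 * (Om r \<theta>)^2 * rho r \<theta>
      - 4 * a^2 * \<alpha> * r * cos \<theta> * Om r \<theta> * rho r \<theta> + 6 * \<alpha>^2 * r^2 * (rho r \<theta>)^2)
    - 4 * a^2 * (cos \<theta>)^2 * Q r \<theta> * (Om r \<theta>)^2 + 2 * \<Lambda> * (rho r \<theta>)^3 + 2 * q^2 * rho r \<theta>
        * (Om r \<theta>)^4"

lemma residual_ee: "residual_ee r \<theta> = 0"
  unfolding residual_ee_def P2_def sin_sq Q_eq Q1_def P_eq p1_def Om_eq rho_eq by algebra

lemma frame_ricci:
  assumes D: "dom r \<theta>"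
  shows frame_ricci_oo: "dk11 2 r \<theta> + k12 2 r \<theta> * L21 2 r \<theta> - L12 2 r \<theta> * k21 2 r \<theta>
      + (dk11 3 r \<theta> + k12 3 r \<theta> * L21 3 r \<theta> - L12 3 r \<theta> * k21 3 r \<theta>) = - 2 * W r \<theta> * ric1 r
          \<theta>" (is ?A)
    and frame_ricci_oe: "dk12 2 r \<theta> + k11 2 r \<theta> * L12 2 r \<theta> + k12 2 r \<theta> * L22 2 r \<theta>
        - L11 2 r \<theta> * k12 2 r \<theta> - L12 2 r \<theta> * k22 2 r \<theta>
      + (dk12 3 r \<theta> + k11 3 r \<theta> * L12 3 r \<theta> + k12 3 r \<theta> * L22 3 r \<theta> - L11 3 r \<theta> * k12 3 r \<theta> - L12 3
          r \<theta> * k22 3 r \<theta>) = 0" (is ?B)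
    and frame_ricci_eo: "dk21 2 r \<theta> + k21 2 r \<theta> * L11 2 r \<theta> + k22 2 r \<theta> * L21 2 r \<theta>
        - L21 2 r \<theta> * k11 2 r \<theta> - L22 2 r \<theta> * k21 2 r \<theta>
      + (dk21 3 r \<theta> + k21 3 r \<theta> * L11 3 r \<theta> + k22 3 r \<theta> * L21 3 r \<theta> - L21 3 r \<theta> * k11 3 r \<theta> - L22 3
          r \<theta> * k21 3 r \<theta>) = 0" (is ?C)
    and frame_ricci_ee: "dk22 2 r \<theta> + k21 2 r \<theta> * L12 2 r \<theta> - L21 2 r \<theta> * k12 2 r \<theta>
      + (dk22 3 r \<theta> + k21 3 r \<theta> * L12 3 r \<theta> - L21 3 r \<theta> * k12 3 r \<theta>) = - 2 * W r \<theta> * ric2 r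
          \<theta>" (is ?D)
proof -
  define u where "u = inverse (Om r \<theta>)"
  define i where "i = inverse (rho r \<theta>)"
  have u: "u * Om r \<theta> = 1" and i: "i * rho r \<theta> = 1"
    using domD[OF D] by (simp_all add: u_def i_def)
  note defs = dk11_def dk12_def dk21_def dk22_def k11_def k12_def k21_def k22_def L11_def L12_def
      L21_def L22_def
    z2_def z3_def dz2_def dz3_def y2_def y3_def dy2_def dy3_def W_def ric1_def ric2_def P1_p1
    coord_if_simps to_inverse u_def[symmetric] i_def[symmetric]
  have "dk11 2 r \<theta> + k12 2 r \<theta> * L21 2 r \<theta> - L12 2 r \<theta> * k21 2 r \<theta>
      + (dk11 3 r \<theta> + k12 3 r \<theta> * L21 3 r \<theta> - L12 3 r \<theta> * k21 3 r \<theta>) - - 2 * W r \<theta> * ric1 r \<theta> = sin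
          \<theta> * i^2 * u^4 * residual_oo r \<theta>"
    unfolding defs residual_oo_def using u i by algebra
  then show ?A by (simp add: residual_oo)
  \<comment> \<open>The off-diagonal entries cancel identically in \<open>P\<close>,
    \<open>Q\<close>, their derivatives and the letters \<open>u\<close>, \<open>i\<close>.\<close>
  show ?B
    unfolding defs by algebra
  show ?C
    unfolding defs by algebra
  have "dk22 2 r \<theta> + k21 2 r \<theta> * L12 2 r \<theta> - L21 2 r \<theta> * k12 2 r \<theta>
      + (dk22 3 r \<theta> + k21 3 r \<theta> * L12 3 r \<theta> - L21 3 r \<theta> * k12 3 r \<theta>) - - 2 * W r \<theta> * ric2 r \<theta> = sin
          \<theta> * i^2 * u^4 * residual_ee r \<theta>"
    unfolding defs residual_ee_def using u i by algebra
  then show ?D by (simp add: residual_ee)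
qed

lemma mix_add: "mix x11 x12 x21 x22 i j r \<theta> + mix y11 y12 y21 y22 i j r \<theta> =
    mix (x11 + y11) (x12 + y12) (x21 + y21) (x22 + y22) i j r \<theta>"
  unfolding mix_def by algebra

lemma N_simps:
  "k \<in> {1,4} \<Longrightarrow> N l k j r \<theta> = mix (n11 l r \<theta>) (n12 l r \<theta>) (n21 l r \<theta>) (n22 l r \<theta>) k j r \<theta>"
  "N l 2 2 r \<theta> = nu l r \<theta>" "N l 3 3 r \<theta> = nv l r \<theta>"
  by (auto simp: N_def mix_zero)

lemma G_simps:
  "k \<in> {1,4} \<Longrightarrow> G i k r \<theta> = low (cA r \<theta>) 0 0 (cB r \<theta>) i k r \<theta>"
  "G 2 2 r \<theta> = cC r \<theta>" "G 3 3 r \<theta> = cD r \<theta>"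
  by (auto simp: G_def low_zero)

lemma H_simps: "H 2 2 r \<theta> = 1 / cC r \<theta>" "H 3 3 r \<theta> = 1 / cD r \<theta>"
  by (auto simp: H_def frame_zero)

lemma N_trace:
  assumes "dom r \<theta>"
  shows "(\<Sum>k\<in>UNIV. N l k k r \<theta>) = n11 l r \<theta> + n22 l r \<theta> + nu l r \<theta> + nv l r \<theta>"
  using tr_mix[OF assms, of "n11 l r \<theta>" "n12 l r \<theta>" "n21 l r \<theta>" "n22 l r \<theta>"]
  by (simp add: sum_4 N_simps)

text \<open>\<open>h2\<close> and \<open>h3\<close> are the logarithmic derivatives of
  \<open>W\<close> in r and \<theta>, as \<open>W_deriv\<close> confirms.\<close>

definition "h2 r \<theta> = 2 * r / rho r \<theta> + 4 * \<alpha> * cos \<theta> / Om r \<theta>"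
definition "h3 r \<theta> = cos \<theta> / sin \<theta> - sin \<theta> * (4 * \<alpha> * r / Om r \<theta> + 2 * a^2 * cos \<theta> / rho r \<theta>)"

lemma N_half_trace:
  assumes "dom r \<theta>"
  shows "(\<Sum>k\<in>UNIV. N 2 k k r \<theta>) / 2 = h2 r \<theta>" "(\<Sum>k\<in>UNIV. N 3 k k r \<theta>) / 2 = h3 r \<theta>"
  unfolding N_trace[OF assms] using domD[OF assms]
  by (simp_all add: n11_def n22_def nu_def nv_def h2_def h3_def field_simps)

lemma W_deriv:
  assumes "dom r \<theta>"
  shows "has_pd l W (W r \<theta> * ((\<Sum>k\<in>UNIV. N l k k r \<theta>) / 2)) r \<theta>"
proof -
  note nz = domD[OF assms]
  have "((\<lambda>r. W r \<theta>) has_real_derivative W r \<theta> * h2 r \<theta>) (at r)"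
    "((\<lambda>\<theta>. W r \<theta>) has_real_derivative W r \<theta> * h3 r \<theta>) (at \<theta>)"
    unfolding W_def h2_def h3_def
    by (auto intro!: derivative_eq_intros basic_DERIV' simp: nz; simp add: nz divide_simps;
        algebra)+
  then show ?thesis
    using exhaust_4[of l] N_half_trace[OF assms] by (auto simp: N_Killing)
qed

lemma KN_ricci_Killing:
  assumes x: "x \<in> S" and ij: "i \<in> {1,4}" "j \<in> {1,4}"
  shows "ricci g x $ i $ j =
    low (cA (x$2) (x$3) * ric1 (x$2) (x$3)) 0 0 (cB (x$2) (x$3) * ric2 (x$2) (x$3)) i j (x$2) (x$3)"
proof -
  let ?r = "x $ 2" and ?\<theta> = "x $ 3"
  have D: "dom ?r ?\<theta>" using x S_dom by blast
  have W: "W r \<theta> \<noteq> 0" if "dom r \<theta>" for r \<theta>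
    using domD[OF that] by (simp add: W_def)
  \<comment> \<open>The derivative of the divergence field, computed in the frame by
    \<open>mix_deriv\<close>; adding both directions makes it diagonal by
    \<open>frame_ricci\<close>.\<close>
  define e where "e l k = mix (dk11 l ?r ?\<theta> + k12 l ?r ?\<theta> * L21 l ?r ?\<theta> - L12 l ?r ?\<theta> * k21 l ?r ?\<theta>)
      (dk12 l ?r ?\<theta> + k11 l ?r ?\<theta> * L12 l ?r ?\<theta> + k12 l ?r ?\<theta> * L22 l ?r ?\<theta> - L11 l ?r ?\<theta> * k12 l ?r
          ?\<theta> - L12 l ?r ?\<theta> * k22 l ?r ?\<theta>)
      (dk21 l ?r ?\<theta> + k21 l ?r ?\<theta> * L11 l ?r ?\<theta> + k22 l ?r ?\<theta> * L21 l ?r ?\<theta> - L21 l ?r ?\<theta> * k11 l ?r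
          ?\<theta> - L22 l ?r ?\<theta> * k21 l ?r ?\<theta>)
      (dk22 l ?r ?\<theta> + k21 l ?r ?\<theta> * L12 l ?r ?\<theta> - L21 l ?r ?\<theta> * k12 l ?r ?\<theta>) k j ?r ?\<theta>" for l k
  have e: "has_pd l (\<lambda>r \<theta>. W r \<theta> * H l l r \<theta> * N l k j r \<theta>) (e l k) ?r ?\<theta>"
    if l: "l \<in> {2,3}" and k: "k \<in> {1,4}" for l k
  proof (rule has_pd_transform[OF _ D])
    show "has_pd l (\<lambda>r \<theta>. mix (k11 l r \<theta>) (k12 l r \<theta>) (k21 l r \<theta>) (k22 l r \<theta>) k j r \<theta>) (e l k) ?r
        ?\<theta>"
      unfolding e_def by (rule mix_deriv[OF D k_deriv[OF D l] refl refl refl refl])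
    fix r \<theta> assume D': "dom r \<theta>"
    have "mix (k11 l r \<theta>) (k12 l r \<theta>) (k21 l r \<theta>) (k22 l r \<theta>) k j r \<theta> =
      W r \<theta> * H l l r \<theta> * mix (n11 l r \<theta>) (n12 l r \<theta>) (n21 l r \<theta>) (n22 l r \<theta>) k j r \<theta>"
      unfolding k_eq[OF D' l, symmetric] mix_def by algebra
    then show "mix (k11 l r \<theta>) (k12 l r \<theta>) (k21 l r \<theta>) (k22 l r \<theta>) k j r \<theta>
        = W r \<theta> * H l l r \<theta> * N l k j r \<theta>"
      by (simp only: N_simps(1)[OF k])
  qed
  have sum_e: "e 2 k + e 3 k = mix (- 2 * W ?r ?\<theta> * ric1 ?r ?\<theta>) 0 0 (- 2 * W ?r ?\<theta> * ric2 ?r ?\<theta>) k j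
      ?r ?\<theta>" for k
    unfolding e_def mix_add frame_ricci[OF D] ..
  have "ricci g x $ i $ j = - (\<Sum>k\<in>{1,4}. G i k ?r ?\<theta> * (e 2 k + e 3 k)) / (2 * W ?r ?\<theta>)"
    by (rule ricci_Killing[OF x ij W W_deriv[OF D] e])
  also have "(\<Sum>k\<in>{1,4}. G i k ?r ?\<theta> * (e 2 k + e 3 k)) =
      (\<Sum>k\<in>{1,4}. low (cA ?r ?\<theta>) 0 0 (cB ?r ?\<theta>) i k ?r ?\<theta> * mix (- 2 * W ?r ?\<theta> * ric1 ?r ?\<theta>) 0
          0 (- 2 * W ?r ?\<theta> * ric2 ?r ?\<theta>) k j ?r ?\<theta>)"
    unfolding sum_e by (intro sum.cong refl) (simp add: G_simps)
  also have "- \<dots> / (2 * W ?r ?\<theta>)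
      = low (cA ?r ?\<theta> * ric1 ?r ?\<theta>) 0 0 (cB ?r ?\<theta> * ric2 ?r ?\<theta>) i j ?r ?\<theta>"
    unfolding low_mix[OF D] using W[OF D] by (simp add: low_def field_simps)
  finally show ?thesis .
qed

section \<open>Ricci components in the r and \<theta> directions\<close>

definition "dnu2 r \<theta> = 2 / rho r \<theta> - 4 * r^2 / (rho r \<theta>)^2 + 2 * \<alpha>^2 * (cos \<theta>)^2 / (Om r \<theta>)^2
  - (Q2 r \<theta> * Q r \<theta> - (Q1 r \<theta>)^2) / (Q r \<theta>)^2"
definition "dv2 r \<theta> = 2 / rho r \<theta> - 4 * r^2 / (rho r \<theta>)^2 + 2 * \<alpha>^2 * (cos \<theta>)^2 / (Om r \<theta>)^2"
definition "dv3 r \<theta> = - cos \<theta> * (2 * a^2 * cos \<theta> / rho r \<theta> + 2 * \<alpha> * r / Om r \<theta>)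
  - (sin \<theta>)^2 * (4 * a^4 * (cos \<theta>)^2 / (rho r \<theta>)^2 - 2 * a^2 / rho r \<theta> - 2 * \<alpha>^2 * r^2
      / (Om r \<theta>)^2)"
definition "dnv3 r \<theta> = dv3 r \<theta> - (P2 r \<theta> * P r \<theta> - (P1 r \<theta>)^2) / (P r \<theta>)^2"
text \<open>The mixed second derivative of log (\<open>rho / Om^2\<close>): it is both the
  r-derivative of \<open>nu 3\<close> and the \<theta>-derivative of \<open>nv 2\<close>. In the
  same way \<open>dh23\<close> is the mixed second derivative of log \<open>W\<close>.\<close>

definition "d23 r \<theta> = sin \<theta> * (4 * a^2 * r * cos \<theta> / (rho r \<theta>)^2 - 2 * \<alpha> / Om r \<theta>
    - 2 * \<alpha>^2 * r * cos \<theta> / (Om r \<theta>)^2)"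
definition "dh22 r \<theta> = 2 / rho r \<theta> - 4 * r^2 / (rho r \<theta>)^2 + 4 * \<alpha>^2 * (cos \<theta>)^2 / (Om r \<theta>)^2"
definition "dh23 r \<theta> = sin \<theta> * (4 * a^2 * r * cos \<theta> / (rho r \<theta>)^2 - 4 * \<alpha> / Om r \<theta>
    - 4 * \<alpha>^2 * r * cos \<theta> / (Om r \<theta>)^2)"
definition "dh33 r \<theta> = - cos \<theta> * (4 * \<alpha> * r / Om r \<theta> + 2 * a^2 * cos \<theta> / rho r \<theta>)
  - (sin \<theta>)^2 * (4 * a^4 * (cos \<theta>)^2 / (rho r \<theta>)^2 - 2 * a^2 / rho r \<theta> - 4 * \<alpha>^2 * r^2 / (Om r \<theta>)^2)
      - 1 / (sin \<theta>)^2"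

lemma log_deriv_deriv:
  assumes "dom r \<theta>"
  shows "((\<lambda>r. nu 2 r \<theta>) has_real_derivative dnu2 r \<theta>) (at r)"
    "((\<lambda>\<theta>. nu 3 r \<theta>) has_real_derivative dv3 r \<theta>) (at \<theta>)"
    "((\<lambda>r. nu 3 r \<theta>) has_real_derivative d23 r \<theta>) (at r)"
    "((\<lambda>r. nv 2 r \<theta>) has_real_derivative dv2 r \<theta>) (at r)"
    "((\<lambda>\<theta>. nv 2 r \<theta>) has_real_derivative d23 r \<theta>) (at \<theta>)"
    "((\<lambda>\<theta>. nv 3 r \<theta>) has_real_derivative dnv3 r \<theta>) (at \<theta>)"
    "((\<lambda>r. h2 r \<theta>) has_real_derivative dh22 r \<theta>) (at r)"
    "((\<lambda>\<theta>. h2 r \<theta>) has_real_derivative dh23 r \<theta>) (at \<theta>)"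
    "((\<lambda>r. h3 r \<theta>) has_real_derivative dh23 r \<theta>) (at r)"
  unfolding nu_def nv_def h2_def h3_def dnu2_def dv2_def dv3_def dnv3_def d23_def dh22_def dh23_def
      coord_if_simps
  by (auto intro!: derivative_eq_intros basic_DERIV' simp: domD[OF assms]; (simp add: domD[OF assms]
      divide_simps)?; algebra)+

lemma h3_deriv:
  assumes "dom r \<theta>"
  shows "((\<lambda>\<theta>. h3 r \<theta>) has_real_derivative dh33 r \<theta>) (at \<theta>)"
proof -
  note nz = domD[OF assms]
  \<comment> \<open>The cotangent is separated because its derivative needs sin^2 + cos^2 = 1, while
    the derivative of \<open>B\<close> is an identity with sine and cosine as free letters.\<close>
  define A B where "A \<theta> = cos \<theta> / sin \<theta>" and
      "B \<theta> = sin \<theta> * (4 * \<alpha> * r / Om r \<theta> + 2 * a^2 * cos \<theta> / rho r \<theta>)" for \<theta>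
  have "(A has_real_derivative (- sin \<theta> * sin \<theta> - cos \<theta> * cos \<theta>) / (sin \<theta> * sin \<theta>)) (at \<theta>)"
    unfolding A_def by (auto intro!: derivative_eq_intros simp: nz)
  also have "(- sin \<theta> * sin \<theta> - cos \<theta> * cos \<theta>) / (sin \<theta> * sin \<theta>) = - (1 / (sin \<theta>)^2)"
    by (simp add: power2_eq_square sin_mult)
  finally have "(A has_real_derivative - (1 / (sin \<theta>)^2)) (at \<theta>)" .
  moreover have "(B has_real_derivative cos \<theta> * (4 * \<alpha> * r / Om r \<theta> + 2 * a^2 * cos \<theta> / rho r \<theta>)
  + (sin \<theta>)^2 * (4 * a^4 * (cos \<theta>)^2 / (rho r \<theta>)^2 - 2 * a^2 / rho r \<theta> - 4 * \<alpha>^2 * r^2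
      / (Om r \<theta>)^2)) (at \<theta>)"
    unfolding B_def
    by (auto intro!: derivative_eq_intros basic_DERIV' simp: nz; simp add: nz divide_simps; algebra)
  moreover have "h3 r = (\<lambda>\<theta>. A \<theta> - B \<theta>)" by (auto simp: A_def B_def h3_def)
  ultimately show ?thesis
    unfolding dh33_def by (auto intro!: derivative_eq_intros)
qed

text \<open>Supplies the differentiability of the single summands demanded by
  \<open>ricci_eq\<close>, where only existence matters.\<close>

lemma N_diag_differentiable:
  assumes D: "dom r \<theta>" and "i \<in> {2,3}" "j \<in> {2,3}"
  shows "\<exists>e. has_pd j (N i k k) e r \<theta>"
proof -
  note nz = domD[OF D]
  \<comment> \<open>The witnesses stay schematic and are assembled by the derivative rules.\<close>
  have ex: "\<exists>d. has_pd j (n11 i) d r \<theta>" "\<exists>d. has_pd j (n12 i) d r \<theta>" "\<exists>d. has_pd j (n21 i) d r \<theta>"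
    "\<exists>d. has_pd j (n22 i) d r \<theta>" "\<exists>d. has_pd j (nu i) d r \<theta>" "\<exists>d. has_pd j (nv i) d r \<theta>"
    using assms(2,3)
    by (auto simp: n11_def n12_def n21_def n22_def nu_def nv_def)
      (rule exI, (rule derivative_eq_intros basic_DERIV' refl | simp add: nz)+)+
  obtain d1 d2 d3 d4 where d: "has_pd j (n11 i) d1 r \<theta>" "has_pd j (n12 i) d2 r \<theta>"
      "has_pd j (n21 i) d3 r \<theta>"
    "has_pd j (n22 i) d4 r \<theta>" using ex(1-4) by blast
  consider "k \<in> {1,4}" | "k = 2" | "k = 3" using exhaust_4[of k] by auto
  then show ?thesis
  proof cases
    case 1
    have "N i k k = (\<lambda>r \<theta>. mix (n11 i r \<theta>) (n12 i r \<theta>) (n21 i r \<theta>) (n22 i r \<theta>) k k r \<theta>)"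
      by (intro ext) (simp add: N_simps(1)[OF 1])
    then show ?thesis using mix_deriv[OF D d refl refl refl refl, of k k] by auto
  next
    case 2
    then have "N i k k = nu i" by (intro ext) (simp add: N_simps)
    then show ?thesis using ex(5) by simp
  next
    case 3
    then have "N i k k = nv i" by (intro ext) (simp add: N_simps)
    then show ?thesis using ex(6) by simp
  qed
qed

lemma KN_Gam_meridian:
  assumes "dom r \<theta>"
  shows "Gam 2 2 2 r \<theta> = nu 2 r \<theta> / 2" "Gam 2 2 3 r \<theta> = nu 3 r \<theta> / 2" "Gam 2 3 2 r \<theta> = nu 3 r \<theta> / 2"
    "Gam 2 3 3 r \<theta> = - Q r \<theta> * nv 2 r \<theta> / (2 * P r \<theta>)"
    "Gam 3 2 2 r \<theta> = - P r \<theta> * nu 3 r \<theta> / (2 * Q r \<theta>)"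
    "Gam 3 2 3 r \<theta> = nv 2 r \<theta> / 2" "Gam 3 3 2 r \<theta> = nv 2 r \<theta> / 2" "Gam 3 3 3 r \<theta> = nv 3 r \<theta> / 2"
  using domD[OF assms] c_nz[OF assms]
  by (simp_all add: Gam_meridian[OF assms] N_simps G_simps H_simps) (simp_all add: cC_def cD_def
      mult.commute)

lemma KN_ricci_meridian:
  assumes x: "x \<in> S" and ij: "i \<in> {2,3}" "j \<in> {2,3}"
    and d: "has_pd 2 (Gam 2 j i) d2 (x $ 2) (x $ 3)" "has_pd 3 (Gam 3 j i) d3 (x $ 2) (x $ 3)"
    and h: "has_pd j (if i = 2 then h2 else h3) h (x $ 2) (x $ 3)"
  shows "ricci g x $ i $ j = d2 + d3 - h
    + h2 (x $ 2) (x $ 3) * Gam 2 j i (x $ 2) (x $ 3) + h3 (x $ 2) (x $ 3) * Gam 3 j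
        i (x $ 2) (x $ 3)
    - (n11 j (x $ 2) (x $ 3) * n11 i (x $ 2) (x $ 3) + n12 j (x $ 2) (x $ 3) * n21 i (x $ 2) (x $ 3)
       + n21 j (x $ 2) (x $ 3) * n12 i (x $ 2) (x $ 3) + n22 j (x $ 2) (x $ 3) * n22
           i (x $ 2) (x $ 3)) / 4
    - (\<Sum>k\<in>{2,3}. \<Sum>p\<in>{2,3}. Gam k j p (x $ 2) (x $ 3) * Gam p k i (x $ 2) (x $ 3))"
proof -
  let ?r = "x $ 2" and ?\<theta> = "x $ 3"
  have D: "dom ?r ?\<theta>" using x S_dom by blast
  define d where "d k = (if k = 2 then d2 else d3)" for k :: 4
  have tab: "Gam k k i r \<theta> = N i k k r \<theta> / 2" if "dom r \<theta>" for k r \<theta>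
    using ij(1) exhaust_4[of k] by (auto simp: Gam_Killing Gam_meridian that)
  have "has_pd k (Gam k j i) (d k) ?r ?\<theta>" if "k \<in> {2,3}" for k
    using that assms(4,5) by (auto simp: d_def)
  moreover have "has_pd j (\<lambda>r \<theta>. \<Sum>k\<in>UNIV. Gam k k i r \<theta>) h ?r ?\<theta>"
  proof (rule has_pd_transform[OF h D])
    fix r \<theta> assume "dom r \<theta>"
    then show "(if i = 2 then h2 else h3) r \<theta> = (\<Sum>k\<in>UNIV. Gam k k i r \<theta>)"
      using ij(1) by (auto simp: tab N_half_trace[symmetric] sum_divide_distrib)
  qed
  moreover have "\<exists>e. has_pd j (Gam k k i) e ?r ?\<theta>" for k
  proof -
    obtain e where "has_pd j (N i k k) e ?r ?\<theta>" using N_diag_differentiable[OF D ij] by blast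
    from has_pd_transform[OF has_pd_cmult[OF this, of "1/2"] D, of "Gam k k i"] show ?thesis
      by (auto simp: tab)
  qed
  ultimately have "ricci g x $ i $ j = d 2 + d 3 - h
    + (\<Sum>p\<in>{2,3}. (\<Sum>k\<in>UNIV. N p k k ?r ?\<theta>) / 2 * Gam p j i ?r ?\<theta>)
    - (\<Sum>k\<in>{1,4}. \<Sum>p\<in>{1,4}. N j k p ?r ?\<theta> * N i p k ?r ?\<theta>) / 4
    - (\<Sum>k\<in>{2,3}. \<Sum>p\<in>{2,3}. Gam k j p ?r ?\<theta> * Gam p k i ?r ?\<theta>)"
    by (intro ricci_meridian[OF x ij])
  also have "(\<Sum>p\<in>{2,3}. (\<Sum>k\<in>UNIV. N p k k ?r ?\<theta>) / 2 * Gam p j i ?r ?\<theta>)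
    = h2 ?r ?\<theta> * Gam 2 j i ?r ?\<theta> + h3 ?r ?\<theta> * Gam 3 j i ?r ?\<theta>"
    unfolding N_half_trace[OF D, symmetric] by simp
  also have "(\<Sum>k\<in>{1,4}. \<Sum>p\<in>{1,4}. N j k p ?r ?\<theta> * N i p k ?r ?\<theta>) =
    (\<Sum>k\<in>{1,4}. \<Sum>p\<in>{1,4}. mix (n11 j ?r ?\<theta>) (n12 j ?r ?\<theta>) (n21 j ?r ?\<theta>) (n22 j ?r ?\<theta>) k p ?r ?\<theta>
      * mix (n11 i ?r ?\<theta>) (n12 i ?r ?\<theta>) (n21 i ?r ?\<theta>) (n22 i ?r ?\<theta>) p k ?r ?\<theta>)"
    by (intro sum.cong refl) (simp add: N_simps)
  also have "\<dots> = n11 j ?r ?\<theta> * n11 i ?r ?\<theta> + n12 j ?r ?\<theta> * n21 i ?r ?\<theta>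
       + n21 j ?r ?\<theta> * n12 i ?r ?\<theta> + n22 j ?r ?\<theta> * n22 i ?r ?\<theta>"
    by (rule tr_mix_mix[OF D])
  finally show ?thesis by (simp add: d_def)
qed

text \<open>
  The numerators over \<open>rho * Om\<close> of the logarithmic derivatives in the meridian components.
\<close>

definition "V r \<theta> = 2 * r * Om r \<theta> + 2 * \<alpha> * cos \<theta> * rho r \<theta>"
definition "Y r \<theta> = 2 * \<alpha> * cos \<theta> * rho r \<theta> - 2 * r * Om r \<theta>"
definition "H2 r \<theta> = 2 * r * Om r \<theta> + 4 * \<alpha> * cos \<theta> * rho r \<theta>"
definition "W3 r \<theta> = 2 * a^2 * cos \<theta> * Om r \<theta> + 2 * \<alpha> * r * rho r \<theta>"
definition "X3 r \<theta> = 2 * a^2 * cos \<theta> * Om r \<theta> - 2 * \<alpha> * r * rho r \<theta>"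
definition "E3 r \<theta> = 2 * a^2 * cos \<theta> * Om r \<theta> + 4 * \<alpha> * r * rho r \<theta>"

definition "residual_rr r \<theta> =
    2 * Q r \<theta> * rho r \<theta> * (Om r \<theta>)^2 - 4 * r^2 * Q r \<theta> * (Om r \<theta>)^2 - Q2 r \<theta> * (rho r \<theta>)^2
        * (Om r \<theta>)^2
      + 2 * \<alpha>^2 * (cos \<theta>)^2 * Q r \<theta> * (rho r \<theta>)^2
    + (sin \<theta>)^2 * p1 \<theta> * W3 r \<theta> * rho r \<theta> * Om r \<theta> + P r \<theta> * (cos \<theta> * W3 r \<theta> * rho r \<theta> * Om r \<theta>
      + (sin \<theta>)^2 * (4 * a^4 * (cos \<theta>)^2 * (Om r \<theta>)^2 - 2 * a^2 * rho r \<theta> * (Om r \<theta>)^2 - 2 * \<alpha>^2 *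
          r^2 * (rho r \<theta>)^2))
    - 2 * Q r \<theta> * (2 * rho r \<theta> * (Om r \<theta>)^2 - 4 * r^2 * (Om r \<theta>)^2 + 4 * \<alpha>^2 * (cos \<theta>)^2
        * (rho r \<theta>)^2)
    + H2 r \<theta> * (Q r \<theta> * V r \<theta> - Q1 r \<theta> * rho r \<theta> * Om r \<theta>)
    - P r \<theta> * ((sin \<theta>)^2 * E3 r \<theta> * W3 r \<theta> - cos \<theta> * W3 r \<theta> * rho r \<theta> * Om r \<theta>)
    - (2 * Q1 r \<theta> * Y r \<theta> * rho r \<theta> * Om r \<theta> + Q r \<theta> * (Y r \<theta>)^2 + Q r \<theta> * (V r \<theta>)^2
      - 8 * r^2 * a^2 * P r \<theta> * (sin \<theta>)^2 * (Om r \<theta>)^2) / 2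
    - (Q r \<theta> * (V r \<theta>)^2 - 2 * Q1 r \<theta> * V r \<theta> * rho r \<theta> * Om r \<theta>) / 2
    + P r \<theta> * (sin \<theta>)^2 * (W3 r \<theta>)^2 - Q r \<theta> * (V r \<theta>)^2 / 2
    - 2 * \<Lambda> * (rho r \<theta>)^3 + 2 * q^2 * rho r \<theta> * (Om r \<theta>)^4"

lemma residual_rr: "residual_rr r \<theta> = 0"
  unfolding residual_rr_def V_def Y_def H2_def W3_def E3_def sin_sq Q_eq Q1_def Q2_def P_eq p1_def
      Om_eq rho_eq by algebra

definition "residual_tt r \<theta> =
    - (Q1 r \<theta> * V r \<theta> * rho r \<theta> * Om r \<theta> + Q r \<theta> * (2 * rho r \<theta> * (Om r \<theta>)^2 - 4 * r^2 * (Om r \<theta>)^2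
        + 2 * \<alpha>^2 * (cos \<theta>)^2 * (rho r \<theta>)^2))
    - P r \<theta> * (cos \<theta> * W3 r \<theta> * rho r \<theta> * Om r \<theta>
      + (sin \<theta>)^2 * (4 * a^4 * (cos \<theta>)^2 * (Om r \<theta>)^2 - 2 * a^2 * rho r \<theta> * (Om r \<theta>)^2 - 2 * \<alpha>^2 *
          r^2 * (rho r \<theta>)^2))
    - P2 r \<theta> * (rho r \<theta>)^2 * (Om r \<theta>)^2
    + 2 * P r \<theta> * (cos \<theta> * E3 r \<theta> * rho r \<theta> * Om r \<theta>
      + (sin \<theta>)^2 * (4 * a^4 * (cos \<theta>)^2 * (Om r \<theta>)^2 - 2 * a^2 * rho r \<theta> * (Om r \<theta>)^2 - 4 * \<alpha>^2 *
          r^2 * (rho r \<theta>)^2))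
    + 2 * P r \<theta> * (rho r \<theta>)^2 * (Om r \<theta>)^2 - H2 r \<theta> * Q r \<theta> * V r \<theta>
    + (P r \<theta> * (sin \<theta>)^2 * E3 r \<theta> * W3 r \<theta> - P r \<theta> * cos \<theta> * W3 r \<theta> * rho r \<theta> * Om r \<theta>
      + (sin \<theta>)^2 * p1 \<theta> * E3 r \<theta> * rho r \<theta> * Om r \<theta> - cos \<theta> * p1 \<theta> * (rho r \<theta>)^2 * (Om r \<theta>)^2)
    - (P r \<theta> * (sin \<theta>)^2 * (W3 r \<theta>)^2 - 8 * a^2 * (cos \<theta>)^2 * Q r \<theta> * (Om r \<theta>)^2
      + 4 * cos \<theta> * p1 \<theta> * (rho r \<theta>)^2 * (Om r \<theta>)^2 + 2 * (sin \<theta>)^2 * p1 \<theta> * X3 r \<theta> * rho r \<theta> * Om r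
          \<theta>
      + 4 * P r \<theta> * cos \<theta> * X3 r \<theta> * rho r \<theta> * Om r \<theta> + P r \<theta> * (sin \<theta>)^2 * (X3 r \<theta>)^2) / 2
    - P r \<theta> * (sin \<theta>)^2 * (W3 r \<theta>)^2 / 2 + Q r \<theta> * (V r \<theta>)^2
    - (P r \<theta> * (sin \<theta>)^2 * (W3 r \<theta>)^2 + 2 * (sin \<theta>)^2 * p1 \<theta> * W3 r \<theta> * rho r \<theta> * Om r \<theta>) / 2
    - 2 * \<Lambda> * (rho r \<theta>)^3 - 2 * q^2 * rho r \<theta> * (Om r \<theta>)^4"

lemma residual_tt: "residual_tt r \<theta> = 0"
  unfolding residual_tt_def V_def H2_def W3_def X3_def E3_def P2_def sin_sq Q_eq Q1_def P_eq p1_def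
      Om_eq rho_eq by algebra

lemma KN_ricci_rr:
  assumes x: "x \<in> S"
  shows "ricci g x $ 2 $ 2 = cC (x$2) (x$3) * ric1 (x$2) (x$3)"
proof -
  define r where "r = x $ 2"
  define \<theta> where "\<theta> = x $ 3"
  have D: "dom r \<theta>" using x S_dom unfolding r_def \<theta>_def by blast
  note nz = domD[OF D]
  have d: "has_pd 2 (Gam 2 2 2) (dnu2 r \<theta> / 2) r \<theta>"
    by (rule has_pd_transform[OF _ D, of _ "\<lambda>r \<theta>. nu 2 r \<theta> / 2"])
      (simp_all add: KN_Gam_meridian DERIV_cdivide log_deriv_deriv D)
  have d': "has_pd 3 (Gam 3 2 2) (- (P1 r \<theta> * nu 3 r \<theta> + P r \<theta> * dv3 r \<theta>) / (2 * Q r \<theta>)) r \<theta>"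
  proof (rule has_pd_transform[OF _ D])
    show "has_pd 3 (\<lambda>r \<theta>. - P r \<theta> * nu 3 r \<theta> / (2 * Q r \<theta>)) (- (P1 r \<theta> * nu 3 r \<theta>
        + P r \<theta> * dv3 r \<theta>) / (2 * Q r \<theta>)) r \<theta>"
      by (auto simp: nz intro!: derivative_eq_intros basic_DERIV' log_deriv_deriv[OF D, THEN
          DERIV_cong]; simp add: nz divide_simps; algebra)
  qed (simp only: KN_Gam_meridian)
  have h: "has_pd 2 (if (2::4) = 2 then h2 else h3) (dh22 r \<theta>) r \<theta>"
    using log_deriv_deriv[OF D] by simp
  define u i w v where "u = inverse (Om r \<theta>)" and "i = inverse (rho r \<theta>)" and "w = inverse (Q r \<theta>)"
    and "v = inverse (sin \<theta>)"
  have u: "u * Om r \<theta> = 1" and i: "i * rho r \<theta> = 1" and w: "w * Q r \<theta> = 1" and v: "v * sin \<theta> = 1"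
    using nz by (simp_all add: u_def i_def w_def v_def)
  note defs = dnu2_def dv3_def dh22_def h2_def h3_def n11_def n12_def n21_def n22_def nu_def nv_def
      ric1_def cC_def P1_p1
    coord_if_simps to_inverse
    u_def[symmetric] i_def[symmetric] w_def[symmetric] v_def[symmetric]
  have ric: "ricci g x $ 2 $ 2 = dnu2 r \<theta> / 2 + - (P1 r \<theta> * nu 3 r \<theta>
      + P r \<theta> * dv3 r \<theta>) / (2 * Q r \<theta>)
    - dh22 r \<theta> + h2 r \<theta> * (nu 2 r \<theta> / 2) + h3 r \<theta> * (- P r \<theta> * nu 3 r \<theta> / (2 * Q r \<theta>))
    - (n11 2 r \<theta> * n11 2 r \<theta> + n12 2 r \<theta> * n21 2 r \<theta> + n21 2 r \<theta> * n12 2 r \<theta> + n22 2 r \<theta> * n22 2 r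
        \<theta>) / 4
    - (nu 2 r \<theta> / 2 * (nu 2 r \<theta> / 2) + nu 3 r \<theta> / 2 * (- P r \<theta> * nu 3 r \<theta> / (2 * Q r \<theta>))
      + (- P r \<theta> * nu 3 r \<theta> / (2 * Q r \<theta>) * (nu 3 r \<theta> / 2) + nv 2 r \<theta> / 2
          * (nv 2 r \<theta> / 2)))" (is "_ = ?R")
    using KN_ricci_meridian[OF x, of 2 2] d d' h
    unfolding r_def[symmetric] \<theta>_def[symmetric] by (simp add: KN_Gam_meridian D)
  define w3 e3 y0 y2 g2 where "w3 = 2 * a^2 * cos \<theta> * i + 2 * \<alpha> * r * u"
    and "e3 = 2 * a^2 * cos \<theta> * i + 4 * \<alpha> * r * u" and "y0 = 2 * \<alpha> * cos \<theta> * u - 2 * r * i"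
    and "y2 = 2 * r * i + 2 * \<alpha> * cos \<theta> * u" and "g2 = 2 * r * i + 4 * \<alpha> * cos \<theta> * u"
  \<comment> \<open>Twice the difference of the two sides is affine in \<open>w = 1 / Q\<close>,
    with coefficients \<open>B\<close> and \<open>A\<close>: the terms in \<open>w^2\<close> from
    \<open>dnu2\<close>, from the square of \<open>nu 2\<close> and from the square of
    \<open>n11 2\<close> add up to 0. Multiplying by \<open>Q\<close> therefore leaves only the
    denominators \<open>rho\<close> and \<open>Om\<close>.\<close>
  define B where "B = (2 * i - 4 * r^2 * i^2 + 2 * \<alpha>^2 * (cos \<theta>)^2 * u^2)
    - 2 * (2 * i - 4 * r^2 * i^2 + 4 * \<alpha>^2 * (cos \<theta>)^2 * u^2) + g2 * y2 - (y0^2 + 3 * y2^2) / 2"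
  define A where "A = - Q2 r \<theta> + (sin \<theta>)^2 * p1 \<theta> * w3
    + P r \<theta> * (cos \<theta> * w3 + (sin \<theta>)^2 * (4 * a^4 * (cos \<theta>)^2 * i^2 - 2 * a^2 * i - 2 * \<alpha>^2 * r^2 *
        u^2))
    - g2 * Q1 r \<theta> - P r \<theta> * ((sin \<theta>)^2 * e3 * w3 - cos \<theta> * w3)
    - Q1 r \<theta> * y0 + 4 * r^2 * a^2 * P r \<theta> * (sin \<theta>)^2 * i^2 + Q1 r \<theta> * y2 + P r \<theta> * (sin \<theta>)^2 * w3^2
    - 2 * rho r \<theta> * u^2 * (\<Lambda> - q^2 * (Om r \<theta>)^4 * i^2)"
  have diff: "?R - cC r \<theta> * ric1 r \<theta> = (B + w * A) / 2"
  proof -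
    define s c where "s = sin \<theta>" and "c = cos \<theta>"
    have n: "nu 2 r \<theta> = y2 - Q1 r \<theta> * w" "nu 3 r \<theta> = - s * w3" "n11 2 r \<theta> = Q1 r \<theta> * w + y0"
      "nv 2 r \<theta> = y2" "h2 r \<theta> = g2" "h3 r \<theta> = c * v - s * e3" "n22 2 r \<theta> = y2"
      "n12 2 r \<theta> = 2 * r * a * P r \<theta> * s^2 * w * i" "n21 2 r \<theta> = - 2 * r * a * i"
      unfolding defs w3_def e3_def y0_def y2_def g2_def s_def c_def by - (rule TrueI refl |
          algebra)+
    have sq: "h3 r \<theta> * (- P r \<theta> * nu 3 r \<theta> / (2 * Q r \<theta>)) = P r \<theta> * (c * w3
        - s^2 * e3 * w3) * w / 2"
      unfolding n using v unfolding s_def[symmetric] to_inverse w_def[symmetric] by algebra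
    have "(Q2 r \<theta> * Q r \<theta> - (Q1 r \<theta>)^2) * w^2 = Q2 r \<theta> * w - (Q1 r \<theta>)^2 * w^2"
      using w by algebra
    then have dnu: "dnu2 r \<theta> = 2 * i - 4 * r^2 * i^2 + 2 * \<alpha>^2 * c^2 * u^2
        - (Q2 r \<theta> * w - (Q1 r \<theta>)^2 * w^2)"
      unfolding defs unfolding s_def[symmetric] c_def[symmetric] by algebra
    have dh: "dh22 r \<theta> = 2 * i - 4 * r^2 * i^2 + 4 * \<alpha>^2 * c^2 * u^2"
      "dv3 r \<theta> = - c * w3 - s^2 * (4 * a^4 * c^2 * i^2 - 2 * a^2 * i - 2 * \<alpha>^2 * r^2 * u^2)"
      "cC r \<theta> * ric1 r \<theta> = w * rho r \<theta> * u^2 * (\<Lambda> - q^2 * (Om r \<theta>)^4 * i^2)"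
      unfolding defs w3_def unfolding s_def[symmetric] c_def[symmetric] by - (rule TrueI refl |
          algebra)+
    have quot: "- P r \<theta> * nu 3 r \<theta> / (2 * Q r \<theta>) = P r \<theta> * s * w3 * w / 2"
      "- (P1 r \<theta> * nu 3 r \<theta> + P r \<theta> * dv3 r \<theta>) / (2 * Q r \<theta>) = (s^2 * p1 \<theta> * w3 - P r \<theta> * dv3 r \<theta>)
          * w / 2"
      unfolding n P1_p1 to_inverse w_def[symmetric] s_def[symmetric] by algebra+
    show ?thesis
      unfolding sq unfolding quot dnu unfolding n dh A_def B_def s_def[symmetric] c_def[symmetric]
      by (simp add: algebra_simps power2_eq_square add_divide_distrib diff_divide_distrib)
  qed
  have "Q r \<theta> * B + A = i^2 * u^2 * residual_rr r \<theta>"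
    unfolding A_def B_def w3_def e3_def y0_def y2_def g2_def residual_rr_def V_def Y_def H2_def
        W3_def E3_def using u i by algebra
  then have "w * (Q r \<theta> * B + A) = 0" by (simp add: residual_rr)
  then have "B + w * A = 0" using w by (simp add: distrib_left mult.assoc[symmetric])
  then have "?R = cC r \<theta> * ric1 r \<theta>" using diff by simp
  with ric show ?thesis
    unfolding r_def \<theta>_def by (rule trans)
qed

lemma KN_ricci_tt:
  assumes x: "x \<in> S"
  shows "ricci g x $ 3 $ 3 = cD (x$2) (x$3) * ric2 (x$2) (x$3)"
proof -
  define r where "r = x $ 2"
  define \<theta> where "\<theta> = x $ 3"
  have D: "dom r \<theta>" using x S_dom unfolding r_def \<theta>_def by blast
  note nz = domD[OF D]
  have d: "has_pd 3 (Gam 3 3 3) (dnv3 r \<theta> / 2) r \<theta>"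
    by (rule has_pd_transform[OF _ D, of _ "\<lambda>r \<theta>. nv 3 r \<theta> / 2"])
      (simp_all add: KN_Gam_meridian DERIV_cdivide log_deriv_deriv D)
  have d': "has_pd 2 (Gam 2 3 3) (- (Q1 r \<theta> * nv 2 r \<theta> + Q r \<theta> * dv2 r \<theta>) / (2 * P r \<theta>)) r \<theta>"
  proof (rule has_pd_transform[OF _ D])
    show "has_pd 2 (\<lambda>r \<theta>. - Q r \<theta> * nv 2 r \<theta> / (2 * P r \<theta>)) (- (Q1 r \<theta> * nv 2 r \<theta>
        + Q r \<theta> * dv2 r \<theta>) / (2 * P r \<theta>)) r \<theta>"
      by (auto simp: nz intro!: derivative_eq_intros basic_DERIV' log_deriv_deriv[OF D, THEN
          DERIV_cong]; simp add: nz divide_simps; algebra)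
  qed (simp only: KN_Gam_meridian)
  have h: "has_pd 3 (if (3::4) = 2 then h2 else h3) (dh33 r \<theta>) r \<theta>"
    using h3_deriv[OF D] by simp
  define u i w v where "u = inverse (Om r \<theta>)" and "i = inverse (rho r \<theta>)" and "w = inverse (P r \<theta>)"
    and "v = inverse (sin \<theta>)"
  have u: "u * Om r \<theta> = 1" and i: "i * rho r \<theta> = 1" and w: "w * P r \<theta> = 1" and v: "v * sin \<theta> = 1"
    using nz by (simp_all add: u_def i_def w_def v_def)
  have v2: "v^2 * (1 - (cos \<theta>)^2) = 1"
    unfolding sin_sq[symmetric] power_mult_distrib[symmetric] v by simp
  note defs = dnv3_def dv2_def dv3_def dh33_def h2_def h3_def n11_def n12_def n21_def n22_def nu_def
      nv_def ric2_def cD_def P1_p1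
    coord_if_simps to_inverse
    u_def[symmetric] i_def[symmetric] w_def[symmetric] v_def[symmetric]
  have ric: "ricci g x $ 3 $ 3 = - (Q1 r \<theta> * nv 2 r \<theta> + Q r \<theta> * dv2 r \<theta>) / (2 * P r \<theta>)
      + dnv3 r \<theta> / 2
    - dh33 r \<theta> + h2 r \<theta> * (- Q r \<theta> * nv 2 r \<theta> / (2 * P r \<theta>)) + h3 r \<theta> * (nv 3 r \<theta> / 2)
    - (n11 3 r \<theta> * n11 3 r \<theta> + n12 3 r \<theta> * n21 3 r \<theta> + n21 3 r \<theta> * n12 3 r \<theta> + n22 3 r \<theta> * n22 3 r
        \<theta>) / 4
    - (nu 3 r \<theta> / 2 * (nu 3 r \<theta> / 2) + - Q r \<theta> * nv 2 r \<theta> / (2 * P r \<theta>) * (nv 2 r \<theta> / 2)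
      + (nv 2 r \<theta> / 2 * (- Q r \<theta> * nv 2 r \<theta> / (2 * P r \<theta>)) + nv 3 r \<theta> / 2
          * (nv 3 r \<theta> / 2)))" (is "_ = ?R")
    using KN_ricci_meridian[OF x, of 3 3] d d' h
    unfolding r_def[symmetric] \<theta>_def[symmetric] by (simp add: KN_Gam_meridian D)
  define w3 e3 x3 y2 g2 where "w3 = 2 * a^2 * cos \<theta> * i + 2 * \<alpha> * r * u"
    and "e3 = 2 * a^2 * cos \<theta> * i + 4 * \<alpha> * r * u" and "x3 = 2 * a^2 * cos \<theta> * i - 2 * \<alpha> * r * u"
    and "y2 = 2 * r * i + 2 * \<alpha> * cos \<theta> * u" and "g2 = 2 * r * i + 4 * \<alpha> * cos \<theta> * u"
  define B where "B = - (cos \<theta> * w3 + (sin \<theta>)^2 * (4 * a^4 * (cos \<theta>)^2 * i^2 - 2 * a^2 * i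
      - 2 * \<alpha>^2 * r^2 * u^2))
    + 2 * (cos \<theta> * e3 + (sin \<theta>)^2 * (4 * a^4 * (cos \<theta>)^2 * i^2 - 2 * a^2 * i - 4 * \<alpha>^2 * r^2 * u^2))
    + 2 + (sin \<theta>)^2 * e3 * w3 - cos \<theta> * w3
    - ((sin \<theta>)^2 * w3^2 + 4 * cos \<theta> * x3 + (sin \<theta>)^2 * x3^2) / 2 - (sin \<theta>)^2 * w3^2"
  define A where "A = - (Q1 r \<theta> * y2 + Q r \<theta> * (2 * i - 4 * r^2 * i^2 + 2 * \<alpha>^2 * (cos \<theta>)^2 * u^2))
    - P2 r \<theta> - g2 * Q r \<theta> * y2 + (sin \<theta>)^2 * p1 \<theta> * e3 - cos \<theta> * p1 \<theta>
    - (4 * cos \<theta> * p1 \<theta> + 2 * (sin \<theta>)^2 * p1 \<theta> * x3 - 8 * a^2 * (cos \<theta>)^2 * Q r \<theta> * i^2) / 2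
    + Q r \<theta> * y2^2 - (sin \<theta>)^2 * p1 \<theta> * w3 - 2 * rho r \<theta> * u^2 * (\<Lambda> + q^2 * (Om r \<theta>)^4 * i^2)"
  \<comment> \<open>The poles at sin \<theta> = 0 are \<open>v^2\<close> from \<open>dh33\<close>
    and \<open>- (cos \<theta>)^2 v^2\<close> from the square of \<open>n22 3\<close>. Together they
    equal 1, and the last summand records this cancellation; the constant 2 in \<open>B\<close>
    accounts for that 1. The terms in \<open>w^2\<close> cancel as in the radial case.\<close>
  have diff: "?R - cD r \<theta> * ric2 r \<theta> = (B + w * A) / 2 + (v^2 * (1 - (cos \<theta>)^2) - 1)"
  proof -
    define s c where "s = sin \<theta>" and "c = cos \<theta>"
    have n: "nv 3 r \<theta> = - s * (w3 + p1 \<theta> * w)" "nu 3 r \<theta> = - s * w3" "n11 3 r \<theta> = - s * w3"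
      "nv 2 r \<theta> = y2" "h2 r \<theta> = g2" "h3 r \<theta> = c * v - s * e3"
          "n22 3 r \<theta> = s * p1 \<theta> * w + 2 * c * v + s * x3"
      "n12 3 r \<theta> = 2 * a * s * c * i" "n21 3 r \<theta> = - 2 * a * c * Q r \<theta> * w * v * i"
      unfolding defs w3_def e3_def x3_def y2_def g2_def s_def c_def by - (rule TrueI refl |
          algebra)+
    have sq: "h3 r \<theta> * (nv 3 r \<theta> / 2) = (s^2 * e3 - c) * (w3 + p1 \<theta> * w) / 2"
      "n22 3 r \<theta> * n22 3 r \<theta> = s^2 * (p1 \<theta> * w + x3)^2 + 4 * c^2 * v^2 + 4 * c * (p1 \<theta> * w + x3)"
      "n12 3 r \<theta> * n21 3 r \<theta> = - 4 * a^2 * c^2 * Q r \<theta> * w * i^2"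
      "n21 3 r \<theta> * n12 3 r \<theta> = - 4 * a^2 * c^2 * Q r \<theta> * w * i^2"
      unfolding n using v unfolding s_def[symmetric] by - (rule TrueI refl | algebra)+
    have "(P2 r \<theta> * P r \<theta> - (s * p1 \<theta>)^2) * w^2 = P2 r \<theta> * w - s^2 * (p1 \<theta>)^2 * w^2"
      using w by algebra
    then have dnv: "dnv3 r \<theta> = - c * w3 - s^2 * (4 * a^4 * c^2 * i^2 - 2 * a^2 * i
        - 2 * \<alpha>^2 * r^2 * u^2)
        - (P2 r \<theta> * w - s^2 * (p1 \<theta>)^2 * w^2)"
      unfolding defs w3_def unfolding s_def[symmetric] c_def[symmetric] by algebra
    have dh: "dh33 r \<theta> = - c * e3 - s^2 * (4 * a^4 * c^2 * i^2 - 2 * a^2 * i - 4 * \<alpha>^2 * r^2 * u^2)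
        - v^2"
      "dv2 r \<theta> = 2 * i - 4 * r^2 * i^2 + 2 * \<alpha>^2 * c^2 * u^2"
      "cD r \<theta> * ric2 r \<theta> = w * rho r \<theta> * u^2 * (\<Lambda> + q^2 * (Om r \<theta>)^4 * i^2)"
      unfolding defs e3_def unfolding s_def[symmetric] c_def[symmetric] by - (rule TrueI refl |
          algebra)+
    have quot: "- Q r \<theta> * nv 2 r \<theta> / (2 * P r \<theta>) = - Q r \<theta> * y2 * w / 2"
      "- (Q1 r \<theta> * nv 2 r \<theta> + Q r \<theta> * dv2 r \<theta>) / (2 * P r \<theta>) =
          - (Q1 r \<theta> * y2 + Q r \<theta> * dv2 r \<theta>) * w / 2"
      unfolding n to_inverse w_def[symmetric] by algebra+
    show ?thesis
      unfolding sq quot dnv unfolding n dh A_def B_def s_def[symmetric] c_def[symmetric]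
      by (simp add: algebra_simps power2_eq_square add_divide_distrib diff_divide_distrib)
  qed
  have "P r \<theta> * B + A = i^2 * u^2 * residual_tt r \<theta>"
    unfolding A_def B_def w3_def e3_def x3_def y2_def g2_def residual_tt_def V_def H2_def W3_def
        X3_def E3_def using u i by algebra
  then have "w * (P r \<theta> * B + A) = 0" by (simp add: residual_tt)
  then have "B + w * A = 0" using w by (simp add: distrib_left mult.assoc[symmetric])
  then have "?R = cD r \<theta> * ric2 r \<theta>" using diff v2 by simp
  with ric show ?thesis
    unfolding r_def \<theta>_def by (rule trans)
qed

lemma KN_ricci_rt:
  assumes x: "x \<in> S"
  shows "ricci g x $ 2 $ 3 = 0" "ricci g x $ 3 $ 2 = 0"
proof -
  define r where "r = x $ 2"
  define \<theta> where "\<theta> = x $ 3"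
  have D: "dom r \<theta>" using x S_dom unfolding r_def \<theta>_def by blast
  note nz = domD[OF D]
  have d: "has_pd 2 (Gam 2 3 2) (d23 r \<theta> / 2) r \<theta>" "has_pd 2 (Gam 2 2 3) (d23 r \<theta> / 2) r \<theta>"
    by (rule has_pd_transform[OF _ D, of _ "\<lambda>r \<theta>. nu 3 r \<theta> / 2"];
      simp add: KN_Gam_meridian DERIV_cdivide log_deriv_deriv D)+
  have d': "has_pd 3 (Gam 3 3 2) (d23 r \<theta> / 2) r \<theta>" "has_pd 3 (Gam 3 2 3) (d23 r \<theta> / 2) r \<theta>"
    by (rule has_pd_transform[OF _ D, of _ "\<lambda>r \<theta>. nv 2 r \<theta> / 2"];
      simp add: KN_Gam_meridian DERIV_cdivide log_deriv_deriv D)+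
  have h: "has_pd 3 (if (2::4) = 2 then h2 else h3) (dh23 r \<theta>) r \<theta>"
    "has_pd 2 (if (3::4) = 2 then h2 else h3) (dh23 r \<theta>) r \<theta>"
    using log_deriv_deriv[OF D] by simp_all
  define u i w y v where "u = inverse (Om r \<theta>)" and "i = inverse (rho r \<theta>)" and
      "w = inverse (P r \<theta>)"
    and "y = inverse (Q r \<theta>)" and "v = inverse (sin \<theta>)"
  have w: "w * P r \<theta> = 1" and y: "y * Q r \<theta> = 1" and v: "v * sin \<theta> = 1"
    using nz by (simp_all add: w_def y_def v_def)
  note defs = d23_def dh23_def h2_def h3_def n11_def n12_def n21_def n22_def nu_def nv_def P1_p1
    coord_if_simps to_inverse
    u_def[symmetric] i_def[symmetric] w_def[symmetric] y_def[symmetric] v_def[symmetric]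
  define R where "R = d23 r \<theta> / 2 + d23 r \<theta> / 2 - dh23 r \<theta> + h2 r \<theta> * (nu 3 r \<theta> / 2)
      + h3 r \<theta> * (nv 2 r \<theta> / 2)
    - (n11 3 r \<theta> * n11 2 r \<theta> + n12 3 r \<theta> * n21 2 r \<theta> + n21 3 r \<theta> * n12 2 r \<theta> + n22 3 r \<theta> * n22 2 r
        \<theta>) / 4
    - (nu 3 r \<theta> / 2 * (nu 2 r \<theta> / 2) + - Q r \<theta> * nv 2 r \<theta> / (2 * P r \<theta>) * (- P r \<theta> * nu 3 r \<theta>
        / (2 * Q r \<theta>))
      + (nv 2 r \<theta> / 2 * (nu 3 r \<theta> / 2) + nv 3 r \<theta> / 2 * (nv 2 r \<theta> / 2)))"
  \<comment> \<open>The bracket is 1 - \<open>rho / rho\<close> once \<open>rho\<close> is written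
    out.\<close>
  have "R = 2 * \<alpha> * u * sin \<theta> * (1 - i * (r^2 + a^2 * (cos \<theta>)^2))"
    unfolding R_def defs using w y v by algebra
  also have "\<dots> = 0"
    using nz by (simp add: i_def rho_eq[symmetric])
  finally have "R = 0" .
  moreover have "ricci g x $ 2 $ 3 = R"
    using KN_ricci_meridian[OF x, of 2 3] d d' h
    unfolding r_def[symmetric] \<theta>_def[symmetric] R_def by (simp add: KN_Gam_meridian D)
  moreover have "ricci g x $ 3 $ 2 = R"
    using KN_ricci_meridian[OF x, of 3 2] d d' h
    unfolding r_def[symmetric] \<theta>_def[symmetric] R_def by (simp add: KN_Gam_meridian D algebra_simps)
  ultimately show "ricci g x $ 2 $ 3 = 0" "ricci g x $ 3 $ 2 = 0"
    by simp_all
qed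

definition Ric :: "4 \<Rightarrow> 4 \<Rightarrow> real \<Rightarrow> real \<Rightarrow> real" where
  "Ric i j r \<theta> = low (cA r \<theta> * ric1 r \<theta>) 0 0 (cB r \<theta> * ric2 r \<theta>) i j r \<theta>
    + (if i = 2 \<and> j = 2 then cC r \<theta> * ric1 r \<theta> else 0) + (if i = 3 \<and> j = 3 then cD r \<theta> * ric2 r \<theta>
        else 0)"

lemma KN_ricci:
  assumes x: "x \<in> S"
  shows "ricci g x $ i $ j = Ric i j (x $ 2) (x $ 3)"
proof -
  consider "i \<in> {1,4}" "j \<in> {1,4}" | "i \<in> {1,4}" "j \<in> {2,3}" | "i \<in> {2,3}" "j \<in> {1,4}" | "i \<in> {2,3}"
      "j \<in> {2,3}"
    using exhaust_4[of i] exhaust_4[of j] by auto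
  then show ?thesis
  proof cases
    case 1
    then show ?thesis by (subst KN_ricci_Killing[OF x 1]) (auto simp: Ric_def)
  next
    case 2
    then show ?thesis using ricci_offblock(1)[OF x 2] by (auto simp: Ric_def low_zero)
  next
    case 3
    then show ?thesis using ricci_offblock(2)[OF x 3(2,1)] by (auto simp: Ric_def low_zero)
  next
    case 4
    then show ?thesis using KN_ricci_rr[OF x] KN_ricci_rt[OF x] KN_ricci_tt[OF x]
        by (auto simp: Ric_def low_zero)
  qed
qed

section \<open>The covariant derivative of the Ricci tensor\<close>

text \<open>This is q^2 times the inverse square of \<open>rho / Om^2\<close>, so its logarithmic
  derivatives are -2 times \<open>nv 2\<close> and \<open>nu 3\<close>.\<close>

definition "f r \<theta> = q^2 * (Om r \<theta>)^4 / (rho r \<theta>)^2"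
definition df where "df l r \<theta> = (if l = 2 then - 2 * f r \<theta> * (2 * r / rho r \<theta>
    + 2 * \<alpha> * cos \<theta> / Om r \<theta>)
  else if l = 3 then 2 * f r \<theta> * sin \<theta> * (2 * a^2 * cos \<theta> / rho r \<theta> + 2 * \<alpha> * r / Om r \<theta>) else
      0)" for l :: 4

lemma ric12_eq: "ric1 r \<theta> = \<Lambda> - f r \<theta>" "ric2 r \<theta> = \<Lambda> + f r \<theta>"
  by (simp_all add: ric1_def ric2_def f_def)

lemma f_deriv:
  assumes "dom r \<theta>"
  shows "has_pd l f (df l r \<theta>) r \<theta>"
  by (rule has_pdI[of _ _ "\<lambda>l. df l r \<theta>"];
      auto simp: f_def df_def domD[OF assms] intro!: derivative_eq_intros basic_DERIV';
      simp add: domD[OF assms] divide_simps; algebra)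

lemma ric12_deriv:
  assumes "dom r \<theta>"
  shows "has_pd l ric1 (- df l r \<theta>) r \<theta>" "has_pd l ric2 (df l r \<theta>) r \<theta>"
proof -
  have "ric1 = (\<lambda>r \<theta>. \<Lambda> + (-1) * f r \<theta>)" "ric2 = (\<lambda>r \<theta>. \<Lambda> + f r \<theta>)"
    by (auto simp: fun_eq_iff ric12_eq)
  then show "has_pd l ric1 (- df l r \<theta>) r \<theta>" "has_pd l ric2 (df l r \<theta>) r \<theta>"
    using has_pd_add[OF has_pd_const has_pd_cmult[OF f_deriv[OF assms, of l], of "-1"], of \<Lambda>]
      has_pd_add[OF has_pd_const f_deriv[OF assms, of l], of \<Lambda>] by auto
qed

lemma Ric_simps:
  "i \<in> {1,4} \<or> j \<in> {1,4} \<Longrightarrow> Ric i j r \<theta> = low (cA r \<theta> * ric1 r \<theta>) 0 0 (cB r \<theta> * ric2 r \<theta>) i j r \<theta>"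
  "Ric 2 2 r \<theta> = cC r \<theta> * ric1 r \<theta>" "Ric 3 3 r \<theta> = cD r \<theta> * ric2 r \<theta>"
  by (auto simp: Ric_def low_zero)

lemma Ric_block: "block_diag (\<lambda>i j. Ric i j r \<theta>)"
  by (auto simp: block_diag_def Ric_def low_def fo_def fe_def)

lemma Ric_sym: "Ric i j r \<theta> = Ric j i r \<theta>"
  by (auto simp: Ric_def low_def algebra_simps)

lemma Ric_deriv:
  assumes D: "dom r \<theta>"
  shows "i \<in> {1,4} \<Longrightarrow> has_pd l (Ric i j)
      (low (cA r \<theta> * (n11 l r \<theta> * ric1 r \<theta> - df l r \<theta>)) (cA r \<theta> * ric1 r \<theta> * L12 l r \<theta> + cB r \<theta> *
          ric2 r \<theta> * L21 l r \<theta>)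
        (cA r \<theta> * ric1 r \<theta> * L12 l r \<theta> + cB r \<theta> * ric2 r \<theta> * L21 l r \<theta>) (cB r \<theta> * (n22 l r \<theta> * ric2
            r \<theta> + df l r \<theta>)) i j r \<theta>) r \<theta>"
    and "has_pd l (Ric 2 2) (cC r \<theta> * (nu l r \<theta> * ric1 r \<theta> - df l r \<theta>)) r \<theta>"
    and "has_pd l (Ric 3 3) (cD r \<theta> * (nv l r \<theta> * ric2 r \<theta> + df l r \<theta>)) r \<theta>"
proof -
  assume i: "i \<in> {1,4}"
  have Ric: "Ric i j = (\<lambda>r \<theta>. low (cA r \<theta> * ric1 r \<theta>) 0 0 (cB r \<theta> * ric2 r \<theta>) i j r \<theta>)"
    using i by (intro ext) (simp add: Ric_simps)
  show "has_pd l (Ric i j)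
      (low (cA r \<theta> * (n11 l r \<theta> * ric1 r \<theta> - df l r \<theta>)) (cA r \<theta> * ric1 r \<theta> * L12 l r \<theta> + cB r \<theta> *
          ric2 r \<theta> * L21 l r \<theta>)
        (cA r \<theta> * ric1 r \<theta> * L12 l r \<theta> + cB r \<theta> * ric2 r \<theta> * L21 l r \<theta>) (cB r \<theta> * (n22 l r \<theta> * ric2
            r \<theta> + df l r \<theta>)) i j r \<theta>) r \<theta>"
    unfolding Ric
    by (rule has_pd_cong[OF low_deriv[OF D has_pd_mult[OF coef_deriv(1)[OF D] ric12_deriv(1)[OF D]]
        has_pd_const has_pd_const
            has_pd_mult[OF coef_deriv(2)[OF D] ric12_deriv(2)[OF D]] refl refl refl refl]])
      (simp add: algebra_simps)
next
  have Ric: "Ric 2 2 = (\<lambda>r \<theta>. cC r \<theta> * ric1 r \<theta>)" "Ric 3 3 = (\<lambda>r \<theta>. cD r \<theta> * ric2 r \<theta>)"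
    by (intro ext; simp add: Ric_simps)+
  show "has_pd l (Ric 2 2) (cC r \<theta> * (nu l r \<theta> * ric1 r \<theta> - df l r \<theta>)) r \<theta>"
    unfolding Ric by (rule has_pd_cong[OF has_pd_mult[OF coef_deriv(3)[OF D] ric12_deriv(1)[OF D]]])
        (simp add: algebra_simps)
  show "has_pd l (Ric 3 3) (cD r \<theta> * (nv l r \<theta> * ric2 r \<theta> + df l r \<theta>)) r \<theta>"
    unfolding Ric by (rule has_pd_cong[OF has_pd_mult[OF coef_deriv(4)[OF D] ric12_deriv(2)[OF D]]])
        (simp add: algebra_simps)
qed


lemma dG_low:
  assumes D: "dom r \<theta>" and "i \<in> {1,4}"
  shows "dG l i j r \<theta> = low (cA r \<theta> * n11 l r \<theta>) (cA r \<theta> * n12 l r \<theta>) (cB r \<theta> * n21 l r \<theta>) (cB r \<theta>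
      * n22 l r \<theta>) i j r \<theta>"
proof -
  have "dG l i j r \<theta> = (\<Sum>k\<in>{1,4}. low (cA r \<theta>) 0 0 (cB r \<theta>) i k r \<theta>
      * mix (n11 l r \<theta>) (n12 l r \<theta>) (n21 l r \<theta>) (n22 l r \<theta>) k j r \<theta>)"
    unfolding dG_Killing[OF assms(2)] by (intro sum.cong refl) (simp add: G_simps N_simps)
  then show ?thesis unfolding low_mix[OF D] by simp
qed

lemma Ric_N:
  assumes D: "dom r \<theta>" and "i \<in> {1,4}" "j \<in> {1,4}"
  shows "(\<Sum>k\<in>{1,4}. Ric i k r \<theta> * N l k j r \<theta>)
      = low (cA r \<theta> * ric1 r \<theta> * n11 l r \<theta>) (cA r \<theta> * ric1 r \<theta> * n12 l r \<theta>)
    (cB r \<theta> * ric2 r \<theta> * n21 l r \<theta>) (cB r \<theta> * ric2 r \<theta> * n22 l r \<theta>) i j r \<theta>"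
proof -
  have "(\<Sum>k\<in>{1,4}. Ric i k r \<theta> * N l k j r \<theta>)
      = (\<Sum>k\<in>{1,4}. low (cA r \<theta> * ric1 r \<theta>) 0 0 (cB r \<theta> * ric2 r \<theta>) i k r \<theta> * mix (n11 l r \<theta>) (n12 l
      r \<theta>) (n21 l r \<theta>) (n22 l r \<theta>) k j r \<theta>)"
    by (intro sum.cong refl) (simp add: Ric_simps N_simps)
  then show ?thesis unfolding low_mix[OF D] by simp
qed

lemma low_transpose: "low x11 x12 x21 x22 i j r \<theta> = low x11 x21 x12 x22 j i r \<theta>"
  unfolding low_def by algebra

lemma low_cong: "x11 = y11 \<Longrightarrow> x12 = y12 \<Longrightarrow> x21 = y21 \<Longrightarrow> x22 = y22 \<Longrightarrow>
    low x11 x12 x21 x22 i j r \<theta> = low y11 y12 y21 y22 i j r \<theta>"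
  by simp

lemma low_lin: "low x11 x12 x21 x22 i j r \<theta> - low y11 y12 y21 y22 i j r \<theta> =
    low (x11 - y11) (x12 - y12) (x21 - y21) (x22 - y22) i j r \<theta>"
  "low x11 x12 x21 x22 i j r \<theta> + low y11 y12 y21 y22 i j r \<theta> =
    low (x11 + y11) (x12 + y12) (x21 + y21) (x22 + y22) i j r \<theta>"
  "c * low x11 x12 x21 x22 i j r \<theta> = low (c * x11) (c * x12) (c * x21) (c * x22) i j r \<theta>"
  "low x11 x12 x21 x22 i j r \<theta> / 2 = low (x11 / 2) (x12 / 2) (x21 / 2) (x22 / 2) i j r \<theta>"
  unfolding low_def by algebra+

abbreviation dRic :: "real^4 \<Rightarrow> 4 \<Rightarrow> 4 \<Rightarrow> 4 \<Rightarrow> real" where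
  "dRic x l i j \<equiv> cov_deriv g (ricci g) l i j x"

text \<open>The contribution of \<Lambda> g drops out, so every nonzero component carries
  \<open>f\<close> or \<open>df\<close>. The first three clauses are frame matrices, ready to be
  read off by \<open>contract_low\<close>.\<close>

lemma dRic_components:
  assumes x: "x \<in> S" and r: "r = x $ 2" and \<theta>: "\<theta> = x $ 3"
  shows "\<And>l i j. l \<in> {2,3} \<Longrightarrow> i \<in> {1,4} \<Longrightarrow> j \<in> {1,4} \<Longrightarrow> dRic x l i j =
      low (- cA r \<theta> * df l r \<theta>) (f r \<theta> * (cB r \<theta> * L21 l r \<theta> - cA r \<theta> * L12 l r \<theta>))
        (f r \<theta> * (cB r \<theta> * L21 l r \<theta> - cA r \<theta> * L12 l r \<theta>)) (cB r \<theta> * df l r \<theta>) i j r \<theta>"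
    and "\<And>i j. i \<in> {1,4} \<Longrightarrow> j \<in> {1,4} \<Longrightarrow> dRic x i 2 j =
      low 0 (- f r \<theta> * cA r \<theta> * n12 2 r \<theta>) 0 (- f r \<theta> * cB r \<theta> * n22 2 r \<theta>) i j r \<theta>"
    and "\<And>i j. i \<in> {1,4} \<Longrightarrow> j \<in> {1,4} \<Longrightarrow> dRic x i 3 j =
      low (f r \<theta> * cA r \<theta> * n11 3 r \<theta>) 0 (f r \<theta> * cA r \<theta> * n12 3 r \<theta>) 0 i j r \<theta>"
    and "\<And>i l j. i \<in> {1,4} \<Longrightarrow> l \<in> {2,3} \<Longrightarrow> j \<in> {1,4} \<Longrightarrow> dRic x i j l = dRic x i l j"
    and "dRic x 2 2 2 = - cC r \<theta> * df 2 r \<theta>" "dRic x 3 2 2 = - cC r \<theta> * df 3 r \<theta>"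
    and "dRic x 2 3 3 = cD r \<theta> * df 2 r \<theta>" "dRic x 3 3 3 = cD r \<theta> * df 3 r \<theta>"
    and "dRic x 2 2 3 = f r \<theta> * cC r \<theta> * nu 3 r \<theta>" "dRic x 2 3 2 = f r \<theta> * cC r \<theta> * nu 3 r \<theta>"
    and "dRic x 3 2 3 = - f r \<theta> * cD r \<theta> * nv 2 r \<theta>" "dRic x 3 3 2 = - f r \<theta> * cD r \<theta> * nv 2 r \<theta>"
    and "\<And>i j l. i \<in> {1,4} \<Longrightarrow> j \<in> {1,4} \<Longrightarrow> l \<in> {1,4} \<Longrightarrow> dRic x l i j = 0"
    and "\<And>i j l. i \<in> {1,4} \<Longrightarrow> j \<in> {2,3} \<Longrightarrow> l \<in> {2,3} \<Longrightarrow> dRic x l i j = 0"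
    and "\<And>i j l. i \<in> {1,4} \<Longrightarrow> j \<in> {2,3} \<Longrightarrow> l \<in> {2,3} \<Longrightarrow> dRic x l j i = 0"
    and "\<And>i j l. i \<in> {2,3} \<Longrightarrow> j \<in> {2,3} \<Longrightarrow> l \<in> {1,4} \<Longrightarrow> dRic x l i j = 0"
proof -
  have D: "dom r \<theta>" using x S_dom r \<theta> by blast
  have R: "\<forall>y\<in>S. \<forall>i j. ricci g y $ i $ j = Ric i j (y $ 2) (y $ 3)"
    by (simp add: KN_ricci)
  note cd = cov_deriv_block[where T = "ricci g" and F = Ric, OF x R Ric_block Ric_sym, folded r \<theta>]
  have sym: "dRic x l j i = dRic x l i j" if "l \<in> {1,4} \<or> i \<in> {1,4} \<or> (i = 2 \<and> j = 3)" for l i j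
  proof (rule cd(3))
    show "has_pd l (Ric i j) (if l \<in> {1,4} \<or> (i = 2 \<and> j = 3) then 0
        else low (cA r \<theta> * (n11 l r \<theta> * ric1 r \<theta> - df l r \<theta>)) (cA r \<theta> * ric1 r \<theta> * L12 l r \<theta> + cB r
        \<theta> * ric2 r \<theta> * L21 l r \<theta>)
        (cA r \<theta> * ric1 r \<theta> * L12 l r \<theta> + cB r \<theta> * ric2 r \<theta> * L21 l r \<theta>) (cB r \<theta> * (n22 l r \<theta> * ric2
            r \<theta> + df l r \<theta>)) i j r \<theta>) r \<theta>"
    proof (cases "i \<in> {1,4}")
      case True
      then show ?thesis using Ric_deriv(1)[OF D, of i l j] by auto
    next
      case False
      moreover have "Ric 2 3 = (\<lambda>r \<theta>. 0)" by (intro ext) (simp add: Ric_def low_zero)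
      ultimately show ?thesis using that by (auto simp: has_pd_const)
    qed
  qed
  show 1: "dRic x l i j =
      low (- cA r \<theta> * df l r \<theta>) (f r \<theta> * (cB r \<theta> * L21 l r \<theta> - cA r \<theta> * L12 l r \<theta>))
        (f r \<theta> * (cB r \<theta> * L21 l r \<theta> - cA r \<theta> * L12 l r \<theta>)) (cB r \<theta> * df l r \<theta>) i j r \<theta>"
    if "l \<in> {2,3}" "i \<in> {1,4}" "j \<in> {1,4}" for l i j
  proof -
    have NT: "(\<Sum>k\<in>{1,4}. N l k i r \<theta> * Ric k j r \<theta>) = (\<Sum>k\<in>{1,4}. Ric j k r \<theta> * N l k i r \<theta>)"
      by (intro sum.cong refl) (simp add: Ric_sym[of _ j] mult.commute)
    show ?thesis
      unfolding cd(1)[OF that Ric_deriv(1)[OF D that(2)]] sum.distrib NT Ric_N[OF D that(2,3)]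
          Ric_N[OF D that(3,2)]
        low_transpose[of _ _ _ _ j i] low_lin ric12_eq
    proof (rule low_cong, goal_cases)
      case 1
      show ?case by algebra
    next
      case 2
      \<comment> \<open>By \<open>n_rel\<close> both \<open>cA n12\<close> and \<open>cB n21\<close>
        equal \<open>cA L12 + cB L21\<close>, so the connection terms amount to this sum times the
        mean of \<open>ric1\<close> and \<open>ric2\<close>, which is \<Lambda>. It cancels the
        \<Lambda> part of the derivative and leaves \<open>f\<close> times a difference.\<close>
      show ?case using n_rel[OF D, of l] by algebra
    next
      case 3
      show ?case using n_rel[OF D, of l] by algebra
    next
      case 4
      show ?case by algebra
    qed
  qed
  have 2: "dRic x i l j = (H l l r \<theta> * Ric l l r \<theta> * dG l i j r \<theta>
    - low (cA r \<theta> * ric1 r \<theta> * n11 l r \<theta>) (cB r \<theta> * ric2 r \<theta> * n21 l r \<theta>) (cA r \<theta> * ric1 r \<theta> * n12 l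
        r \<theta>) (cB r \<theta> * ric2 r \<theta> * n22 l r \<theta>) i j r \<theta>) / 2"
    if "l \<in> {2,3}" "i \<in> {1,4}" "j \<in> {1,4}" for l i j
  proof -
    have NT: "(\<Sum>k\<in>{1,4}. N l k i r \<theta> * Ric k j r \<theta>) = (\<Sum>k\<in>{1,4}. Ric j k r \<theta> * N l k i r \<theta>)"
      by (intro sum.cong refl) (simp add: Ric_sym[of _ j] mult.commute)
    show ?thesis
      unfolding cd(2)[OF that] NT Ric_N[OF D that(3,2)] low_transpose[of _ _ _ _ j i] ..
  qed
  have HT: "H 2 2 r \<theta> * Ric 2 2 r \<theta> = ric1 r \<theta>" "H 3 3 r \<theta> * Ric 3 3 r \<theta> = ric2 r \<theta>"
    using c_nz[OF D] by (simp_all add: H_simps Ric_simps)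
  have n21: "cB r \<theta> * n21 l r \<theta> = cA r \<theta> * n12 l r \<theta>"
      "cB r \<theta> * ric2 r \<theta> * n21 l r \<theta> = cA r \<theta> * ric2 r \<theta> * n12 l r \<theta>" for l
    using n_rel[OF D, of l] by (simp_all add: mult.commute mult.left_commute)
  show "dRic x i 2 j = low 0 (- f r \<theta> * cA r \<theta> * n12 2 r \<theta>) 0 (- f r \<theta> * cB r \<theta> * n22 2 r \<theta>) i j r
      \<theta>"
    if "i \<in> {1,4}" "j \<in> {1,4}" for i j
    using that by (subst 2) (simp_all add: HT dG_low[OF D] low_lin n21 ric12_eq algebra_simps)
  show "dRic x i 3 j = low (f r \<theta> * cA r \<theta> * n11 3 r \<theta>) 0 (f r \<theta> * cA r \<theta> * n12 3 r \<theta>) 0 i j r \<theta>"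
    if "i \<in> {1,4}" "j \<in> {1,4}" for i j
    using that by (subst 2) (simp_all add: HT dG_low[OF D] low_lin n21 ric12_eq algebra_simps)
  show "dRic x i j l = dRic x i l j" if "i \<in> {1,4}" "l \<in> {2,3}" "j \<in> {1,4}" for i j l
    using that sym[of i l j] by blast
  show "dRic x 2 2 2 = - cC r \<theta> * df 2 r \<theta>"
    unfolding cd(4)[OF Ric_deriv(2)[OF D]] by (simp add: N_simps Ric_simps algebra_simps)
  show "dRic x 3 2 2 = - cC r \<theta> * df 3 r \<theta>"
    unfolding cd(5)[OF Ric_deriv(2)[OF D]] by (simp add: N_simps Ric_simps algebra_simps)
  show "dRic x 2 3 3 = cD r \<theta> * df 2 r \<theta>"
    unfolding cd(6)[OF Ric_deriv(3)[OF D]] by (simp add: N_simps Ric_simps algebra_simps)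
  show "dRic x 3 3 3 = cD r \<theta> * df 3 r \<theta>"
    unfolding cd(7)[OF Ric_deriv(3)[OF D]] by (simp add: N_simps Ric_simps algebra_simps)
  show 23: "dRic x 2 2 3 = f r \<theta> * cC r \<theta> * nu 3 r \<theta>"
    using c_nz[OF D] unfolding cd(8) by (simp add: N_simps Ric_simps H_simps G_simps ric12_eq
        field_simps)
  show 33: "dRic x 3 2 3 = - f r \<theta> * cD r \<theta> * nv 2 r \<theta>"
    using c_nz[OF D] unfolding cd(9) by (simp add: N_simps Ric_simps H_simps G_simps ric12_eq
        field_simps)
  show "dRic x 2 3 2 = f r \<theta> * cC r \<theta> * nu 3 r \<theta>" "dRic x 3 3 2 = - f r \<theta> * cD r \<theta> * nv 2 r \<theta>"
    using sym[of 2 2 3] sym[of 3 2 3] 23 33 by simp_all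
  show "dRic x l i j = 0" if "i \<in> {1,4}" "j \<in> {1,4}" "l \<in> {1,4}" for i j l
    using that by (rule cd(10))
  show 3: "dRic x l i j = 0" if "i \<in> {1,4}" "j \<in> {2,3}" "l \<in> {2,3}" for i j l
    using that by (rule cd(11))
  show "dRic x l j i = 0" if "i \<in> {1,4}" "j \<in> {2,3}" "l \<in> {2,3}" for i j l
    using 3[OF that] sym[OF disjI2[OF disjI1[OF that(1)]], of l j] by simp
  show "dRic x l i j = 0" if "i \<in> {2,3}" "j \<in> {2,3}" "l \<in> {1,4}" for i j l
    using that by (rule cd(12))
qed

section \<open>The norm as a weighted sum of squares\<close>

definition frame :: "4 \<Rightarrow> 4 \<Rightarrow> real \<Rightarrow> real \<Rightarrow> real" where
  "frame b h r \<theta> = (if b = 1 then eo h r \<theta> else if b = 4 then ee h r \<theta> else if b = h then 1 else 0)"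

text \<open>Reciprocals of the squared lengths of the frame vectors. Leaving the frame unnormalised
  covers both signs of \<open>Q\<close>.\<close>

definition frame_weight :: "4 \<Rightarrow> real \<Rightarrow> real \<Rightarrow> real" where
  "frame_weight b r \<theta> = 1 / (if b = 1 then cA r \<theta> else if b = 2 then cC r \<theta> else if b = 3
      then cD r \<theta> else cB r \<theta>)"

lemma H_eq_frame: "H i j r \<theta> = (\<Sum>a\<in>UNIV. frame_weight a r \<theta> * frame a i r \<theta> * frame a j r \<theta>)"
  by (auto simp: sum_4 H_def frame_weight_def frame_def)

lemma contract_meridian: "l \<in> {2,3} \<Longrightarrow> (\<Sum>h\<in>UNIV. frame l h r \<theta> * X h) = X l"
  by (auto simp: sum_4 frame_def)

text \<open>Evaluating \<open>M^T x M\<close> on the columns of \<open>M^-1\<close> returns the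
  entries of \<open>x\<close>.\<close>

lemma contract_low:
  assumes D: "dom r \<theta>" and bc: "b \<in> {1,4}" "c \<in> {1,4}"
    and X: "\<And>i j. i \<in> {1,4} \<Longrightarrow> j \<in> {1,4} \<Longrightarrow> X i j = low x11 x12 x21 x22 i j r \<theta>"
  shows "(\<Sum>i\<in>UNIV. frame b i r \<theta> * (\<Sum>j\<in>UNIV. frame c j r \<theta> * X i j))
    = (if b = 1 then if c = 1 then x11 else x12 else if c = 1 then x21 else x22)"
proof -
  have e: "eo 2 r \<theta> = 0" "eo 3 r \<theta> = 0" "ee 2 r \<theta> = 0" "ee 3 r \<theta> = 0"
    by (simp_all add: frame_zero)
  have "(\<Sum>i\<in>UNIV. frame b i r \<theta> * (\<Sum>j\<in>UNIV. frame c j r \<theta> * X i j)) =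
    (\<Sum>i\<in>{1,4}. frame b i r \<theta> * (\<Sum>j\<in>{1,4}. frame c j r \<theta> * low x11 x12 x21 x22 i j r \<theta>))"
    using bc by (auto simp: sum_4 frame_def e X)
  also have "\<dots> = ((\<Sum>i\<in>{1,4}. frame b i r \<theta> * fo i r \<theta>) * (x11 * (\<Sum>j\<in>{1,4}. frame c j r \<theta> * fo j r \<theta>)
      + x12 * (\<Sum>j\<in>{1,4}. frame c j r \<theta> * fe j r \<theta>))
     + (\<Sum>i\<in>{1,4}. frame b i r \<theta> * fe i r \<theta>) * (x21 * (\<Sum>j\<in>{1,4}. frame c j r \<theta> * fo j r \<theta>) + x22
         * (\<Sum>j\<in>{1,4}. frame c j r \<theta> * fe j r \<theta>)))"
    unfolding low_def by simp algebra
  also have "\<dots> = (if b = 1 then if c = 1 then x11 else x12 else if c = 1 then x21 else x22)"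
    using bc frame_dual[OF D] by (auto simp: frame_def mult.commute)
  finally show ?thesis .
qed

text \<open>For each meridian direction \<open>l\<close> the four components \<open>l b b\<close>,
  with \<open>b\<close> running through the frame, each contribute the square of
  \<open>df l\<close>, hence the factor 4. Every other contribution occurs twice, by symmetry of the
  Ricci tensor.\<close>

lemma norm_frame:
  assumes x: "x \<in> S" and r: "r = x $ 2" and \<theta>: "\<theta> = x $ 3"
  shows "norm_sq3 g (cov_deriv g (ricci g)) x =
    (4 * (df 2 r \<theta>)^2 + 2 * (f r \<theta>)^2 * (cB r \<theta> / cA r \<theta> * (L21 2 r \<theta>)^2 + cA r \<theta> / cB r \<theta>
        * (n12 2 r \<theta>)^2
      + (n22 2 r \<theta>)^2 + (nv 2 r \<theta>)^2)) / cC r \<theta>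
    + (4 * (df 3 r \<theta>)^2 + 2 * (f r \<theta>)^2 * (cA r \<theta> / cB r \<theta> * (L12 3 r \<theta>)^2 + cA r \<theta> / cB r \<theta>
        * (n12 3 r \<theta>)^2
      + (n11 3 r \<theta>)^2 + (nu 3 r \<theta>)^2)) / cD r \<theta>"
proof -
  have D: "dom r \<theta>" using x S_dom r \<theta> by blast
  note t = dRic_components[OF x r \<theta>]
  define Sf where "Sf d b c
      = (\<Sum>h\<in>UNIV. frame d h r \<theta> * (\<Sum>i\<in>UNIV. frame b i r \<theta> * (\<Sum>j\<in>UNIV. frame c j r \<theta> * dRic x h i
      j)))" for d b c
  have norm: "norm_sq3 g (cov_deriv g (ricci g)) x =
    (\<Sum>a\<in>UNIV. \<Sum>b\<in>UNIV. \<Sum>c\<in>UNIV. frame_weight a r \<theta> * frame_weight b r \<theta> * frame_weight c r \<theta>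
        * (Sf a b c)^2)"
    unfolding Sf_def
    by (rule norm_sq3_frame) (simp only: inv_metric_eq[OF x] H_eq_frame r \<theta>)
  have S1: "Sf l b c = (if b = 1 then if c = 1 then - cA r \<theta> * df l r \<theta>
      else f r \<theta> * (cB r \<theta> * L21 l r \<theta> - cA r \<theta> * L12 l r \<theta>)
      else if c = 1 then f r \<theta> * (cB r \<theta> * L21 l r \<theta> - cA r \<theta> * L12 l r \<theta>) else cB r \<theta> * df l r \<theta>)"
    if "l \<in> {2,3}" "b \<in> {1,4}" "c \<in> {1,4}" for l b c
    unfolding Sf_def contract_meridian[OF that(1)]
    by (rule contract_low[OF D that(2,3)]) (rule t(1)[OF that(1)])
  have S2: "Sf b 2 c = (if c = 1 then 0 else if b = 1 then - f r \<theta> * cA r \<theta> * n12 2 r \<theta> else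
      - f r \<theta> * cB r \<theta> * n22 2 r \<theta>)"
     "Sf b 3 c = (if c = 4 then 0 else if b = 1 then f r \<theta> * cA r \<theta> * n11 3 r \<theta>
         else f r \<theta> * cA r \<theta> * n12 3 r \<theta>)"
    if "b \<in> {1,4}" "c \<in> {1,4}" for b c
    using contract_low[OF D that t(2)] contract_low[OF D that t(3)] that
    unfolding Sf_def by (auto simp: contract_meridian)
  have S3: "Sf b c l = Sf b l c" if "b \<in> {1,4}" "c \<in> {1,4}" "l \<in> {2,3}" for b c l
  proof -
    have frame0: "frame b h r \<theta> = 0" "frame c h r \<theta> = 0" if "h \<notin> {1,4}" for h
      using \<open>b \<in> {1,4}\<close> \<open>c \<in> {1,4}\<close> that by (auto simp: frame_def frame_zero)
    have *: "frame b h r \<theta> * (frame c i r \<theta> * dRic x h i l)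
        = frame b h r \<theta> * (frame c i r \<theta> * dRic x h l i)" for h i
      using frame0(1)[of h] frame0(2)[of i] t(4)[of h l i] that(3)
          by (cases "h \<in> {1,4} \<and> i \<in> {1,4}") auto
    show ?thesis
      unfolding Sf_def contract_meridian[OF that(3)] by (simp add: sum_distrib_left *)
  qed
  have S4: "Sf d b c = dRic x d b c" if "d \<in> {2,3}" "b \<in> {2,3}" "c \<in> {2,3}" for d b c
    unfolding Sf_def using that by (simp add: contract_meridian)
  have S5: "Sf d b c = 0" if "d \<in> {1,4}" "b \<in> {1,4}" "c \<in> {1,4}" for d b c
  proof -
    have frame0: "frame k h r \<theta> = 0" if "h \<notin> {1,4}" "k \<in> {1,4}" for k h
      using that by (auto simp: frame_def frame_zero)
    have *: "frame d h r \<theta> * (frame b i r \<theta> * (frame c j r \<theta> * dRic x h i j)) = 0" for h i j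
      using frame0[of h d] frame0[of i b] frame0[of j c] t(13)[of i j h] that
      by (cases "h \<in> {1,4} \<and> i \<in> {1,4} \<and> j \<in> {1,4}") auto
    show ?thesis unfolding Sf_def sum_distrib_left * by simp
  qed
  have S6: "Sf b l l' = 0" "Sf l b l' = 0" "Sf l l' b = 0" if "b \<in> {1,4}" "l \<in> {2,3}" "l' \<in> {2,3}"
      for b l l'
  proof -
    have frame0: "frame b h r \<theta> = 0" if "h \<notin> {1,4}" for h
      using \<open>b \<in> {1,4}\<close> that by (auto simp: frame_def frame_zero)
    have *: "frame b h r \<theta> * dRic x h l l' = 0" "frame b h r \<theta> * dRic x l h l' = 0"
        "frame b h r \<theta> * dRic x l l' h = 0" for h
      using frame0[of h] t(14)[of h l' l] t(15)[of h l' l] t(16)[of l l' h] that(2,3)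
      by (cases "h \<in> {1,4}"; simp)+
    show "Sf b l l' = 0" "Sf l b l' = 0" "Sf l l' b = 0"
      unfolding Sf_def contract_meridian[OF that(2)] contract_meridian[OF that(3)] * by simp_all
  qed
  have L0: "L12 2 r \<theta> = 0" "L21 3 r \<theta> = 0" by (simp_all add: L12_def L21_def)
  show ?thesis
    unfolding norm using c_nz[OF D]
    by (simp add: sum_4 S1 S2 S3[of _ _ 2] S3[of _ _ 3] S4 S5 S6 L0 t(5-12) frame_weight_def)
      (simp add: field_simps power2_eq_square)
qed

text \<open>Over the common denominator the terms \<alpha> r^2 cos \<theta>, respectively \<alpha>
  a^2 r (cos \<theta>)^2, cancel.\<close>

lemma radial_factor:
  assumes "dom r \<theta>"
  shows "2 * r / rho r \<theta> + 2 * \<alpha> * cos \<theta> / Om r \<theta>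
      = 2 * (r + \<alpha> * a^2 * (cos \<theta>)^3) / (rho r \<theta> * Om r \<theta>)"
    "2 * a^2 * cos \<theta> / rho r \<theta> + 2 * \<alpha> * r / Om r \<theta> = 2 * (a^2 * cos \<theta>
        + \<alpha> * r^3) / (rho r \<theta> * Om r \<theta>)"
proof -
  have "r * Om r \<theta> + \<alpha> * cos \<theta> * rho r \<theta> = r + \<alpha> * a^2 * (cos \<theta>)^3"
    "a^2 * cos \<theta> * Om r \<theta> + \<alpha> * r * rho r \<theta> = a^2 * cos \<theta> + \<alpha> * r^3"
    unfolding Om_eq rho_eq by algebra+
  from this[symmetric] show
      "2 * r / rho r \<theta> + 2 * \<alpha> * cos \<theta> / Om r \<theta>
      = 2 * (r + \<alpha> * a^2 * (cos \<theta>)^3) / (rho r \<theta> * Om r \<theta>)"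
    "2 * a^2 * cos \<theta> / rho r \<theta> + 2 * \<alpha> * r / Om r \<theta> = 2 * (a^2 * cos \<theta>
        + \<alpha> * r^3) / (rho r \<theta> * Om r \<theta>)"
    using domD[OF assms] by (simp_all add: field_simps)
qed

lemma KN_norm:
  assumes x: "x \<in> S" and r: "r = x $ 2" and \<theta>: "\<theta> = x $ 3"
  shows "norm_sq3 g (cov_deriv g (ricci g)) x =
    q^4 * (Om r \<theta>)^8 / (rho r \<theta>)^7 * (80 * (Q r \<theta> * (r + \<alpha> * a^2 * (cos \<theta>)^3)^2 + P r \<theta> * (sin \<theta>)^2
        * (a^2 * cos \<theta> + \<alpha> * r^3)^2)
      - 16 * a^2 * (Om r \<theta>)^2 * (r^2 * P r \<theta> * (sin \<theta>)^2 + (cos \<theta>)^2 * Q r \<theta>))"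
proof -
  have D: "dom r \<theta>" using x S_dom r \<theta> by blast
  note nz = domD[OF D]
  \<comment> \<open>Half the r-derivative of log (\<open>rho / Om^2\<close>); \<open>z\<close> below
    is minus half its \<theta>-derivative, divided by sin \<theta>.\<close>
  define y where "y = (r + \<alpha> * a^2 * (cos \<theta>)^3) / (rho r \<theta> * Om r \<theta>)"
  define z where "z = (a^2 * cos \<theta> + \<alpha> * r^3) / (rho r \<theta> * Om r \<theta>)"
  have yz: "2 * r / rho r \<theta> + 2 * \<alpha> * cos \<theta> / Om r \<theta> = 2 * y"
    "2 * a^2 * cos \<theta> / rho r \<theta> + 2 * \<alpha> * r / Om r \<theta> = 2 * z"
    using radial_factor[OF D] by (simp_all add: y_def z_def)
  have d: "df 2 r \<theta> = - 4 * f r \<theta> * y" "df 3 r \<theta> = 4 * f r \<theta> * sin \<theta> * z"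
    by (simp_all add: df_def yz)
  have n: "n22 2 r \<theta> = 2 * y" "nv 2 r \<theta> = 2 * y" by (simp_all add: n22_def nv_def yz)
  have "n11 3 r \<theta> = - sin \<theta> * (2 * a^2 * cos \<theta> / rho r \<theta> + 2 * \<alpha> * r / Om r \<theta>)"
    "nu 3 r \<theta> = - sin \<theta> * (2 * a^2 * cos \<theta> / rho r \<theta> + 2 * \<alpha> * r / Om r \<theta>)"
    by (simp_all add: n11_def nu_def algebra_simps)
  then have n': "n11 3 r \<theta> = - 2 * sin \<theta> * z" "nu 3 r \<theta> = - 2 * sin \<theta> * z"
    unfolding yz by simp_all
  have cL: "cB r \<theta> / cA r \<theta> * (L21 2 r \<theta>)^2 =
      - 4 * a^2 * r^2 * P r \<theta> * (sin \<theta>)^2 / (Q r \<theta> * (rho r \<theta>)^2)"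
    "cA r \<theta> / cB r \<theta> * (n12 2 r \<theta>)^2 = - 4 * a^2 * r^2 * P r \<theta> * (sin \<theta>)^2 / (Q r \<theta> * (rho r \<theta>)^2)"
    "cA r \<theta> / cB r \<theta> * (L12 3 r \<theta>)^2 = - 4 * a^2 * (cos \<theta>)^2 * Q r \<theta> / (P r \<theta> * (rho r \<theta>)^2)"
    "cA r \<theta> / cB r \<theta> * (n12 3 r \<theta>)^2 = - 4 * a^2 * (cos \<theta>)^2 * Q r \<theta> / (P r \<theta> * (rho r \<theta>)^2)"
    using nz by (simp_all add: cA_def cB_def L21_def n12_def L12_def power2_eq_square mult_ac)
  have cCD: "cC r \<theta> = rho r \<theta> / (Q r \<theta> * (Om r \<theta>)^2)" "cD r \<theta> = rho r \<theta> / (P r \<theta> * (Om r \<theta>)^2)"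
    by (simp_all add: cC_def cD_def)
  \<comment> \<open>Here 80 = 4 * 16 + 2 * (4 + 4), with 64 from \<open>df\<close> and 16 from the
    connection terms in \<open>y\<close> or \<open>z\<close>. The 16 a^2 term is 2 * (4 + 4) a^2
    from the rotation terms in \<open>cL\<close>, negative because \<open>cA\<close> and
    \<open>cB\<close> enter as a quotient.\<close>
  have "norm_sq3 g (cov_deriv g (ricci g)) x =
    (f r \<theta>)^2 * (Om r \<theta>)^2 / rho r \<theta> * (80 * (Q r \<theta> * y^2 + P r \<theta> * (sin \<theta>)^2 * z^2)
      - 16 * a^2 * (r^2 * P r \<theta> * (sin \<theta>)^2 + (cos \<theta>)^2 * Q r \<theta>) / (rho r \<theta>)^2)"
    unfolding norm_frame[OF x r \<theta>] cL cCD d n n' using nz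
    by (simp add: field_simps power2_eq_square)
  also have "\<dots> = q^4 * (Om r \<theta>)^8 / (rho r \<theta>)^7 * (80 * (Q r \<theta> * (r + \<alpha> * a^2 * (cos \<theta>)^3)^2
      + P r \<theta> * (sin \<theta>)^2 * (a^2 * cos \<theta> + \<alpha> * r^3)^2)
      - 16 * a^2 * (Om r \<theta>)^2 * (r^2 * P r \<theta> * (sin \<theta>)^2 + (cos \<theta>)^2 * Q r \<theta>))"
  proof -
    have "(f r \<theta>)^2 * (Om r \<theta>)^2 / rho r \<theta>
        = q^4 * (Om r \<theta>)^8 / (rho r \<theta>)^7 * ((Om r \<theta>)^2 * (rho r \<theta>)^2)"
      using nz by (simp add: f_def eval_nat_numeral field_simps)
    moreover have "(Om r \<theta>)^2 * (rho r \<theta>)^2 * (80 * (Q r \<theta> * y^2 + P r \<theta> * (sin \<theta>)^2 * z^2)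
      - 16 * a^2 * (r^2 * P r \<theta> * (sin \<theta>)^2 + (cos \<theta>)^2 * Q r \<theta>) / (rho r \<theta>)^2) =
      80 * (Q r \<theta> * (r + \<alpha> * a^2 * (cos \<theta>)^3)^2 + P r \<theta> * (sin \<theta>)^2 * (a^2 * cos \<theta> + \<alpha> * r^3)^2)
      - 16 * a^2 * (Om r \<theta>)^2 * (r^2 * P r \<theta> * (sin \<theta>)^2 + (cos \<theta>)^2 * Q r \<theta>)"
    proof -
      have "(r + \<alpha> * a^2 * (cos \<theta>)^3) = y * rho r \<theta> * Om r \<theta>"
          "(a^2 * cos \<theta> + \<alpha> * r^3) = z * rho r \<theta> * Om r \<theta>"
        using nz by (simp_all add: y_def z_def)
      then show ?thesis using nz by (simp add: field_simps power2_eq_square)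
    qed
    ultimately show ?thesis by (simp only: mult.assoc)
  qed
  finally show ?thesis .
qed

end

theorem theorem59:
  fixes a m q \<Lambda> \<alpha> t r \<theta> \<phi> :: real
  assumes "KN_Omega \<alpha> r \<theta> > 0"
    and "KN_rho2 a r \<theta> \<noteq> 0"
    and "KN_Q a m q \<Lambda> \<alpha> r \<noteq> 0"
    and "KN_P a m q \<Lambda> \<alpha> \<theta> > 0"
    and "sin \<theta> \<noteq> 0"
  shows "let g = KN_metric a m q \<Lambda> \<alpha>; c = cos \<theta> in
    norm_sq3 g (cov_deriv g (ricci g)) (vector [t, r, \<theta>, \<phi>]) =
    - (80 * (\<alpha> * r * c - 1)^8 * q^4 / (r^2 + a^2 * c^2)^7) * (
        a^2 * (4 * ((\<alpha>^2 + \<Lambda>/3) * a^2 - \<alpha>^2 * q^2 / 4) * \<alpha>^2 * r^4 / 5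
               - 2 * a^2 * \<alpha>^4 * m * r^3
               + a^2 * \<alpha>^2 * ((\<alpha>^2 + \<Lambda>/3) * a^2 + \<alpha>^2 * q^2 - 1) * r^2
               + 2 * a^2 * \<alpha>^2 * m * r + \<Lambda> * a^4 / 3) * c^6
      - 2 * a^2 * \<alpha> * (- (\<alpha>^2 * m * r^4 / 5)
               + ((- (6 * \<alpha>^2 / 5) - 2 * \<Lambda> / 5) * a^2 - 6 * \<alpha>^2 * q^2 / 5) * r^3
               + a^2 * m) * c^5
      + ((4 * \<alpha>^2 * (\<alpha>^2 + \<Lambda>/3) * a^2 / 5 + \<alpha>^4 * q^2) * r^6
               + 2 * a^2 * \<alpha>^4 * m * r^5 / 5 - 26 * a^2 * \<alpha>^2 * m * r^3 / 5
               - \<Lambda> * a^4 * r^2 / 15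
               - a^4 * ((\<alpha>^2 + \<Lambda>/3) * a^2 + \<alpha>^2 * q^2 - 1)) * c^4
      + 2 * (- (\<alpha>^2 * m * r^6) + 6 * (\<alpha>^2 + \<Lambda>/3) * a^2 * r^5 / 5
               - 13 * a^2 * \<alpha>^2 * m * r^4 / 5 + 13 * a^2 * m * r^2 / 5
               + (- (6/5 * a^4) - 6/5 * a^2 * q^2) * r + a^4 * m) * \<alpha> * c^3
      + (- (\<alpha>^2 * ((\<alpha>^2 + \<Lambda>/3) * a^2 + \<alpha>^2 * q^2 - 1) * r^6)
               - \<Lambda> * a^2 * r^4 / 15 + 26 * a^2 * \<alpha>^2 * m * r^3 / 5
               - 2 * a^2 * m * r / 5 + a^2 * q^2 / 5 - 4 * a^4 / 5) * c^2
      - 2 * \<alpha> * r^2 * (- (5 * \<alpha>^2 * m * r^4) + a^2 * m + 6 * a^2 * r) * c / 5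
      + (\<Lambda> * r^4 / 3 - 2 * \<alpha>^2 * m * r^3
               + ((\<alpha>^2 + \<Lambda>/3) * a^2 + \<alpha>^2 * q^2 - 1) * r^2
               + 2 * m * r - 4 * a^2 / 5 - q^2) * r^2)"
proof -
  interpret kerr_newman a m q \<Lambda> \<alpha> .
  define x where "x = (vector [t, r, \<theta>, \<phi>] :: real^4)"
  have x23: "r = x $ 2" "\<theta> = x $ 3" by (simp_all add: x_def vector_def)
  have "dom r \<theta>" using assms by (simp add: dom_def Om_def rho_def Q_def P_def)
  then have x: "x \<in> S" by (simp add: S_def x23)
  have Om8: "(Om r \<theta>)^8 = (\<alpha> * r * cos \<theta> - 1)^8"
    using power_minus_even[of 8 "Om r \<theta>"] by (simp add: Om_eq)
  \<comment> \<open>The prefactors agree, the eighth power being even, so a polynomial identity for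
    the brackets remains. Dividing the coefficient 16 by 80 produces the fifths in the stated
    coefficients.\<close>
  have q8: "q^4 * (Om r \<theta>)^8 / (rho r \<theta>)^7 * b = - (80 * (\<alpha> * r * cos \<theta> - 1)^8 * q^4 / (r^2
      + a^2 * (cos \<theta>)^2)^7) * b'"
    if "b = - 80 * b'" for b b'
    unfolding Om8 rho_eq that by simp
  show ?thesis
    unfolding Let_def x_def[symmetric] KN_norm[OF x x23]
    by (rule q8) (unfold Q_eq P_eq Om_eq sin_sq, simp add: algebra_simps power2_eq_square
        power3_eq_cube eval_nat_numeral add_divide_distrib diff_divide_distrib)
qed

end
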